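(* Consider the M/G/1 queue with one-bit predictions under the 1bit policy in the external cost model (as described in the context). Let $\rho=\lambda\int_0^\infty x f(x)\,dx$, assume $\rho<1$, let $\mathbb{E}[S^2]=\int_0^\infty x^2 f(x)\,dx$, and let $$\rho^{ext}_{new}=\lambda\int_0^\infty p_T(x)\,x f(x)\,dx .$$ Then the mean response time in equilibrium of a predicted long job of true size $x_J$ is $$\mathbb{E}[T(x_J)]^{1bit,PL}_{ext}=\frac{\lambda}{2(1-\rho)(1-\rho^{ext}_{new})}\,\mathbb{E}[S^2]+\int_0^{x_J}\frac{1}{1-\rho^{ext}_{new}}\,da .$$
   Context: Model: jobs arrive to a single server according to a Poisson process of rate $\lambda$; service times are i.i.d. with density $f$ on $(0,\infty)$, independent of the arrival process. Fix a threshold $T$. Independently over jobs, a job with service time $x$ is predicted short ($b=1$) with probability $p_T(x)$ and predicted long ($b=0$) with probability $1-p_T(x)$. External cost model: predictions are available on arrival and do not use server time. 1bit policy: the server always serves (preemptive-resume) the job with the lowest rank, ranks ordered lexicographically, ties broken First-Come-First-Served, where a job with bit $b$ and age $a$ (amount of service received so far) has rank $\langle 1,-a\rangle$ if $b=1$ and $\langle 2,-a\rangle$ if $b=0$. So predicted short jobs have preemptive priority over predicted long jobs, and each of the two classes is served FCFS. The response time of a job is the time from its arrival to its completion; $\mathbb{E}[T(x_J)]^{1bit,PL}_{ext}$ is the expected response time of a job with $b=0$ and true size $x_J$ that arrives to the stationary system. *)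

theory Defs
  imports "HOL-Probability.Probability"
begin

subsection \<open>Sample paths of the 1bit policy\<close>

text \<open>A job in the system is a triple (predicted short, size, age); a state lists the jobs that are
  present, in order of arrival. An arrival is a triple (time since the previous arrival, size,
  predicted short), where the time of the first arrival is counted from time 0.\<close>

type_synonym job = "bool \<times> real \<times> real"
type_synonym state = "job list"
type_synonym arrival = "real \<times> real \<times> bool"

definition valid_state :: "state \<Rightarrow> bool" where
  "valid_state q \<longleftrightarrow> (\<forall>(b, s, a)\<in>set q. 0 \<le> a \<and> a < s)"

definition valid_arrivals :: "(nat \<Rightarrow> arrival) \<Rightarrow> bool" where
  "valid_arrivals w \<longleftrightarrow> (\<forall>k. fst (w k) > 0 \<and> fst (snd (w k)) > 0) \<and>
     filterlim (\<lambda>n. \<Sum>k\<le>n. fst (w k)) at_top sequentially"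

text \<open>When the system is in state \<open>q\<close> at time 0 and is fed with the arrivals \<open>w\<close>, its jobs are
  numbered in order of arrival: first those of \<open>q\<close>, then those of \<open>w\<close>. The jobs of \<open>q\<close> arrived at
  time 0 or earlier; their arrival time is set to 0, since only the service after time 0 matters
  and the numbering keeps their order.\<close>

definition arrival_time :: "state \<Rightarrow> (nat \<Rightarrow> arrival) \<Rightarrow> nat \<Rightarrow> real" where
  "arrival_time q w i = (if i < length q then 0 else (\<Sum>k\<le>i - length q. fst (w k)))"

definition job_size :: "state \<Rightarrow> (nat \<Rightarrow> arrival) \<Rightarrow> nat \<Rightarrow> real" where
  "job_size q w i = (if i < length q then fst (snd (q ! i)) else fst (snd (w (i - length q))))"

definition predicted_short :: "state \<Rightarrow> (nat \<Rightarrow> arrival) \<Rightarrow> nat \<Rightarrow> bool" where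
  "predicted_short q w i = (if i < length q then fst (q ! i) else snd (snd (w (i - length q))))"

definition initial_age :: "state \<Rightarrow> nat \<Rightarrow> real" where
  "initial_age q i = (if i < length q then snd (snd (q ! i)) else 0)"

text \<open>In what follows, \<open>age i t\<close> is the age (attained service) of job \<open>i\<close> at time \<open>t\<close>.\<close>

definition present :: "state \<Rightarrow> (nat \<Rightarrow> arrival) \<Rightarrow> (nat \<Rightarrow> real \<Rightarrow> real) \<Rightarrow> real \<Rightarrow> nat \<Rightarrow> bool" where
  "present q w age t i \<longleftrightarrow> arrival_time q w i \<le> t \<and> age i t < job_size q w i"

definition rank :: "state \<Rightarrow> (nat \<Rightarrow> arrival) \<Rightarrow> (nat \<Rightarrow> real \<Rightarrow> real) \<Rightarrow> real \<Rightarrow> nat \<Rightarrow> nat \<times> real" where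
  "rank q w age t i = (if predicted_short q w i then 1 else 2, - age i t)"

definition rank_less :: "nat \<times> real \<Rightarrow> nat \<times> real \<Rightarrow> bool" where
  "rank_less r r' \<longleftrightarrow> (r, r') \<in> {(x, y). x < y} <*lex*> {(x, y). x < y}"

definition served :: "state \<Rightarrow> (nat \<Rightarrow> arrival) \<Rightarrow> (nat \<Rightarrow> real \<Rightarrow> real) \<Rightarrow> real \<Rightarrow> nat \<Rightarrow> bool" where
  "served q w age t i \<longleftrightarrow> present q w age t i \<and>
     (\<forall>j. present q w age t j \<and> j \<noteq> i \<longrightarrow>
        rank_less (rank q w age t i) (rank q w age t j) \<or>
        rank q w age t i = rank q w age t j \<and> i < j)"

text \<open>The served job ages at rate 1, all other jobs at rate 0. It is essential to ask for the right
  derivative at every time: if ages were only required to be integrals of the service indicator,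
  then of two waiting jobs of equal rank the later one could be started, since its rank would be
  the lower one at every instant but the first.\<close>

definition onebit_schedule ::
    "state \<Rightarrow> (nat \<Rightarrow> arrival) \<Rightarrow> (nat \<Rightarrow> real \<Rightarrow> real) \<Rightarrow> bool" where
  "onebit_schedule q w age \<longleftrightarrow>
     (\<forall>i. age i 0 = initial_age q i \<and> continuous_on {0..} (age i) \<and>
       (\<forall>t\<ge>0. (age i has_real_derivative (if served q w age t i then 1 else 0)) (at_right t)))"

text \<open>For valid \<open>q\<close> and \<open>w\<close> only finitely many jobs arrive in bounded time, and the ages are
  uniquely determined by the policy on \<open>{0..}\<close>.\<close>

definition onebit_policy :: "(state \<Rightarrow> (nat \<Rightarrow> arrival) \<Rightarrow> nat \<Rightarrow> real \<Rightarrow> real) \<Rightarrow> bool" where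
  "onebit_policy age \<longleftrightarrow>
     (\<forall>q w. valid_state q \<longrightarrow> valid_arrivals w \<longrightarrow> onebit_schedule q w (age q w))"

definition state_at ::
    "(state \<Rightarrow> (nat \<Rightarrow> arrival) \<Rightarrow> nat \<Rightarrow> real \<Rightarrow> real) \<Rightarrow> real \<Rightarrow> state \<Rightarrow> (nat \<Rightarrow> arrival) \<Rightarrow> state" where
  "state_at age t q w =
     map (\<lambda>i. (predicted_short q w i, job_size q w i, age q w i t))
       (sorted_list_of_set {i. present q w (age q w) t i})"

text \<open>A predicted long job of size \<open>x\<close> that finds the system in state \<open>q\<close> on its arrival at time 0
  is appended to \<open>q\<close> with age 0 and is thus job number \<open>length q\<close>. Its response time is infinite if
  it is never completed.\<close>

definition response_time_long ::
    "(state \<Rightarrow> (nat \<Rightarrow> arrival) \<Rightarrow> nat \<Rightarrow> real \<Rightarrow> real) \<Rightarrow> real \<Rightarrow> state \<Rightarrow> (nat \<Rightarrow> arrival) \<Rightarrow> ennreal" where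
  "response_time_long age x q w =
     Inf {ennreal t | t. 0 \<le> t \<and> x \<le> age (q @ [(False, x, 0)]) w (length q) t}"

subsection \<open>The stochastic model\<close>

definition arrival_law :: "real \<Rightarrow> (real \<Rightarrow> real) \<Rightarrow> (real \<Rightarrow> real) \<Rightarrow> (nat \<Rightarrow> arrival) measure" where
  "arrival_law lam f p =
     (\<Pi>\<^sub>M k\<in>UNIV. density lborel (\<lambda>g. ennreal (exponential_density lam g)) \<Otimes>\<^sub>M
        density (lborel \<Otimes>\<^sub>M count_space UNIV)
          (\<lambda>(s, b). ennreal (f s * (if b then p s else 1 - p s))))"

definition state_space :: "state measure" where
  "state_space = sigma UNIV
     {{q. length q = n \<and> (\<forall>i<n. q ! i \<in> A i)} | n A.
        \<forall>i. A i \<in> sets (count_space UNIV \<Otimes>\<^sub>M borel \<Otimes>\<^sub>M borel)}"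

text \<open>The completion makes this notion independent of the values of \<open>age\<close> on the null set of
  arrival sequences that are not valid.\<close>

definition stationary ::
    "real \<Rightarrow> (real \<Rightarrow> real) \<Rightarrow> (real \<Rightarrow> real) \<Rightarrow>
     (state \<Rightarrow> (nat \<Rightarrow> arrival) \<Rightarrow> nat \<Rightarrow> real \<Rightarrow> real) \<Rightarrow> state measure \<Rightarrow> bool" where
  "stationary lam f p age \<pi> \<longleftrightarrow>
     prob_space \<pi> \<and> sets \<pi> = sets state_space \<and> (AE q in \<pi>. valid_state q) \<and>
     (\<forall>t\<ge>0. case_prod (state_at age t) \<in>
               completion (\<pi> \<Otimes>\<^sub>M arrival_law lam f p) \<rightarrow>\<^sub>M state_space \<and>
             distr (completion (\<pi> \<Otimes>\<^sub>M arrival_law lam f p)) state_space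
               (case_prod (state_at age t)) = \<pi>)"

text \<open>The arriving job sees the stationary state, and the Poisson arrivals after time 0 are
  independent of that state.\<close>

definition mean_response_long ::
    "real \<Rightarrow> (real \<Rightarrow> real) \<Rightarrow> (real \<Rightarrow> real) \<Rightarrow>
     (state \<Rightarrow> (nat \<Rightarrow> arrival) \<Rightarrow> nat \<Rightarrow> real \<Rightarrow> real) \<Rightarrow> state measure \<Rightarrow> real \<Rightarrow> ennreal" where
  "mean_response_long lam f p age \<pi> x =
     (\<integral>\<^sup>+ (q, w). response_time_long age x q w \<partial>(\<pi> \<Otimes>\<^sub>M arrival_law lam f p))"

text \<open>Loads and moments are extended nonnegative reals, so that no integrability has to be assumed
  and an infinite second moment is admitted.\<close>

definition load :: "real \<Rightarrow> (real \<Rightarrow> real) \<Rightarrow> ennreal" where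
  "load lam f = ennreal lam * (\<integral>\<^sup>+ x\<in>{0<..}. ennreal (x * f x) \<partial>lborel)"

definition load_new_ext :: "real \<Rightarrow> (real \<Rightarrow> real) \<Rightarrow> (real \<Rightarrow> real) \<Rightarrow> ennreal" where
  "load_new_ext lam f p = ennreal lam * (\<integral>\<^sup>+ x\<in>{0<..}. ennreal (p x * x * f x) \<partial>lborel)"

definition second_moment :: "(real \<Rightarrow> real) \<Rightarrow> ennreal" where
  "second_moment f = (\<integral>\<^sup>+ x\<in>{0<..}. ennreal (x\<^sup>2 * f x) \<partial>lborel)"

end

theory Submission
  imports Defs "HOL-Real_Asymp.Real_Asymp"
begin

text \<open>A predicted long job is overtaken only by predicted short jobs that arrive before it is
  completed, so its response time is the first \<open>t\<close> with \<open>V + x + A t \<le> t\<close>, where \<open>V\<close> is the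
  work found on arrival and \<open>A t\<close> the predicted short work that arrives before \<open>t\<close>. Looking at
  the workload at the arrival epochs turns this into a stopped random walk, and the mean hitting
  time is \<open>(V + x) / (1 - \<rho>_new)\<close>.

  For the mean of the stationary workload \<open>V\<close>, stationarity over a small time \<open>h\<close> is expanded to
  first order in \<open>h\<close>, which needs the schedule only for at most one arrival. It yields
  \<open>E exp (-\<theta> V) * (\<theta> - \<lambda> (1 - E exp (-\<theta> S))) = \<theta> * P (V = 0)\<close>; letting \<open>\<theta>\<close> tend to \<open>0\<close>
  gives first \<open>P (V = 0) = 1 - \<rho>\<close> and then \<open>E V = \<lambda> E S^2 / (2 (1 - \<rho>))\<close>, also if the second
  moment is infinite.\<close>

section \<open>Ages under the 1bit policy\<close>

text \<open>The schedule is not constructed: a path is known only through the continuity and the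
  right derivative of each age, and nothing says beforehand that service periods are intervals.
  Statements about ages are therefore proved by real induction along time and by one-sided mean
  value inequalities. Beyond FCFS among long jobs, only the total service of a set of jobs matters,
  because the order within the set cancels.

  On the probabilistic side, no moment of the workload may be presupposed. Laplace transforms are
  bounded, so their balance equation needs no integrability, whereas a drift identity for
  \<open>V^2\<close> would need a finite mean of \<open>V^2\<close>, which fails for heavy-tailed
  service times. The error of the expansion in \<open>h\<close> is of order \<open>h^2\<close>,
  because it is confined to the event of an arrival up to time \<open>h\<close> and is of order
  \<open>h\<close> in the mean given that event.

  For the hitting time, the identity of the stopped walk is kept in additive form in
  \<open>ennreal\<close>. It determines the mean only after finiteness has been proved separately
  and the mean work left over has been shown to vanish in the limit.\<close>

lemma real_induct_right:
  fixes a t :: real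
  assumes base: "P a"
    and right: "\<And>s. a \<le> s \<Longrightarrow> P s \<Longrightarrow> eventually P (at_right s)"
    and left: "\<And>u. a < u \<Longrightarrow> (\<And>s. a \<le> s \<Longrightarrow> s < u \<Longrightarrow> P s) \<Longrightarrow> P u"
    and t: "a \<le> t"
  shows "P t"
proof (rule ccontr)
  assume nP: "\<not> P t"
  \<comment> \<open>The infimum \<open>i\<close> of the failures is not itself a failure, by
    \<open>base\<close> or \<open>left\<close>; \<open>right\<close> then pushes every failure
    beyond \<open>i\<close>, a contradiction. The principle takes the place of a uniqueness theorem
    for the ages, whose dynamics depends on the ages themselves.\<close>
  define S where "S = {u. a \<le> u \<and> \<not> P u}"
  define i where "i = Inf S"
  have tS: "t \<in> S" using nP t by (simp add: S_def)
  have bdd: "bdd_below S" by (auto simp: S_def bdd_below_def)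
  have ai: "a \<le> i" unfolding i_def using tS by (intro cInf_greatest) (auto simp: S_def)
  have below: "P s" if "a \<le> s" "s < i" for s
  proof (rule ccontr)
    assume "\<not> P s"
    then have "s \<in> S" using that by (simp add: S_def)
    then have "i \<le> s" unfolding i_def by (intro cInf_lower bdd)
    with that show False by simp
  qed
  have Pi: "P i"
  proof (cases "i = a")
    case True then show ?thesis using base by simp
  next
    case False
    with ai have "a < i" by simp
    then show ?thesis using below by (rule left)
  qed
  from right[OF ai Pi] obtain b where b: "b > i" "\<And>y. i < y \<Longrightarrow> y < b \<Longrightarrow> P y"
    unfolding eventually_at_right_field by blast
  have "b \<le> u" if u: "u \<in> S" for u
  proof (rule ccontr)
    assume "\<not> b \<le> u"
    then have ub: "u < b" by simp
    have "i \<le> u" unfolding i_def by (rule cInf_lower[OF u bdd])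
    with ub b Pi have "P u" by (cases "u = i") auto
    with u show False by (simp add: S_def)
  qed
  then have "b \<le> i" unfolding i_def using tS by (intro cInf_greatest) auto
  with b show False by simp
qed

text \<open>A mean value inequality for an arbitrary right derivative \<open>D\<close>, hence usable
  for service indicators. The bound is propagated with slope \<open>c + d\<close>: the strict slack
  \<open>d\<close> makes it survive a little to the right of each point, and continuity carries it
  to limits from the left.\<close>

lemma right_deriv_upper:
  fixes f D :: "real \<Rightarrow> real"
  assumes ab: "a \<le> b" and cont: "continuous_on {a..b} f"
    and der: "\<And>t. a \<le> t \<Longrightarrow> t < b \<Longrightarrow> (f has_real_derivative D t) (at_right t)"
    and le: "\<And>t. a \<le> t \<Longrightarrow> t < b \<Longrightarrow> D t \<le> c"
  shows "f b - f a \<le> c * (b - a)"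
proof (rule field_le_epsilon)
  fix e :: real assume e: "e > 0"
  \<comment> \<open>The \<open>+ 1\<close> covers \<open>a = b\<close>; the accumulated slack
    \<open>d * (b - a)\<close> stays within \<open>e\<close>.\<close>
  define d where "d = e / (b - a + 1)"
  have d: "d > 0" using e ab by (simp add: d_def)
  define P where "P t \<longleftrightarrow> t \<le> b \<longrightarrow> f t - f a \<le> (c + d) * (t - a)" for t
  have "P b"
  proof (rule real_induct_right[where a = a and P = P, OF _ _ _ ab])
    show "P a" by (simp add: P_def)
  next
    fix s assume s: "a \<le> s" "P s"
    show "eventually P (at_right s)"
    proof (cases "s < b")
      case False
      have "eventually (\<lambda>u. s < u) (at_right s)" by (simp add: eventually_at_right_less)
      then show ?thesis by eventually_elim (use False in \<open>simp add: P_def\<close>)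
    next
      case True
      have "((\<lambda>y. (f y - f s) / (y - s)) \<longlongrightarrow> D s) (at_right s)"
        using der[OF s(1) True] by (simp add: has_field_derivative_iff)
      then have "eventually (\<lambda>y. (f y - f s) / (y - s) < c + d) (at_right s)"
        using le[OF s(1) True] d by (intro order_tendstoD) auto
      moreover have "eventually (\<lambda>y. y > s) (at_right s)"
        by (simp add: eventually_at_right_less)
      ultimately show ?thesis
      proof eventually_elim
        case (elim y)
        then have "f y - f s \<le> (c + d) * (y - s)" by (simp add: divide_simps)
        moreover have "f s - f a \<le> (c + d) * (s - a)" using s True by (simp add: P_def)
        ultimately show ?case by (simp add: P_def algebra_simps)
      qed
    qed
  next
    fix u assume u: "a < u" and below: "\<And>s. a \<le> s \<Longrightarrow> s < u \<Longrightarrow> P s"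
    show "P u" unfolding P_def
    proof
      assume ub: "u \<le> b"
      have "continuous_on {a..u} f" using cont by (rule continuous_on_subset) (use ub in auto)
      then have "(f \<longlongrightarrow> f u) (at u within {a..u})"
        using u by (auto simp: continuous_on_def)
      then have "(f \<longlongrightarrow> f u) (at_left u)"
        using u by (simp add: at_within_Icc_at_left)
      then have lim: "((\<lambda>s. f s - f a - (c + d) * (s - a)) \<longlongrightarrow> f u - f a - (c + d) * (u - a)) (at_left u)"
        by (intro tendsto_intros)
      have "eventually (\<lambda>s. f s - f a - (c + d) * (s - a) \<le> 0) (at_left u)"
        unfolding eventually_at_left_field
        using u below ub by (intro exI[of _ a]) (auto simp: P_def)
      then have "f u - f a - (c + d) * (u - a) \<le> 0"
        by (intro tendsto_upperbound[OF lim]) auto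
      then show "f u - f a \<le> (c + d) * (u - a)" by simp
    qed
  qed
  then have "f b - f a \<le> (c + d) * (b - a)" by (simp add: P_def)
  also have "\<dots> = c * (b - a) + d * (b - a)" by (simp add: algebra_simps)
  also have "d * (b - a) \<le> d * (b - a + 1)" using d by (intro mult_left_mono) auto
  also have "d * (b - a + 1) = e" using ab by (simp add: d_def)
  finally show "f b - f a \<le> c * (b - a) + e" by simp
qed

lemma right_deriv_lower:
  fixes f D :: "real \<Rightarrow> real"
  assumes ab: "a \<le> b" and cont: "continuous_on {a..b} f"
    and der: "\<And>t. a \<le> t \<Longrightarrow> t < b \<Longrightarrow> (f has_real_derivative D t) (at_right t)"
    and le: "\<And>t. a \<le> t \<Longrightarrow> t < b \<Longrightarrow> c \<le> D t"
  shows "c * (b - a) \<le> f b - f a"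
proof -
  have "- f b - - f a \<le> - c * (b - a)"
    by (rule right_deriv_upper[where D = "\<lambda>t. - D t" and f = "\<lambda>t. - f t",
          OF ab continuous_on_minus[OF cont] DERIV_minus[OF der]]) (use le in auto)
  then show ?thesis by simp
qed

section \<open>Arrival epochs and the work brought by predicted short jobs\<close>

definition gap :: "arrival \<Rightarrow> real" where "gap y = fst y"
definition service :: "arrival \<Rightarrow> real" where "service y = fst (snd y)"
definition short_service :: "arrival \<Rightarrow> real" where
  "short_service y = (if snd (snd y) then service y else 0)"
definition epoch :: "(nat \<Rightarrow> arrival) \<Rightarrow> nat \<Rightarrow> real" where
  "epoch w k = (\<Sum>j\<le>k. gap (w j))"

text \<open>Only arrivals strictly before \<open>t\<close> count: a short job that arrives at the very moment of
  completion delays nobody.\<close>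

definition short_work :: "(nat \<Rightarrow> arrival) \<Rightarrow> real \<Rightarrow> real" where
  "short_work w t = (\<Sum>k | epoch w k < t. short_service (w k))"

definition workload :: "state \<Rightarrow> real" where
  "workload q = (\<Sum>(b, s, a)\<leftarrow>q. s - a)"

lemma valid_arrivals_gap: "valid_arrivals w \<Longrightarrow> gap (w k) > 0"
  and valid_arrivals_service: "valid_arrivals w \<Longrightarrow> service (w k) > 0"
  and valid_arrivals_epoch: "valid_arrivals w \<Longrightarrow> filterlim (epoch w) at_top sequentially"
  by (auto simp: valid_arrivals_def gap_def service_def epoch_def[abs_def])

lemma finite_epoch_le:
  assumes "valid_arrivals w"
  shows "finite {k. epoch w k \<le> t}"
proof -
  have "eventually (\<lambda>k. epoch w k > t) sequentially"
    using valid_arrivals_epoch[OF assms] by (simp add: filterlim_at_top_dense)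
  then obtain N where N: "\<forall>k\<ge>N. epoch w k > t"
    unfolding eventually_sequentially by blast
  have "{k. epoch w k \<le> t} \<subseteq> {..<N}"
  proof
    fix k assume "k \<in> {k. epoch w k \<le> t}"
    with N show "k \<in> {..<N}" by (cases "N \<le> k") force+
  qed
  then show ?thesis using finite_subset by blast
qed

lemma finite_epoch_less: "valid_arrivals w \<Longrightarrow> finite {k. epoch w k < t}"
  by (rule finite_subset[OF _ finite_epoch_le[of w t]]) auto

lemma epoch_pos: "valid_arrivals w \<Longrightarrow> epoch w k > 0"
  unfolding epoch_def by (intro sum_pos) (auto intro: valid_arrivals_gap)

lemma epoch_mono: "valid_arrivals w \<Longrightarrow> j \<le> k \<Longrightarrow> epoch w j \<le> epoch w k"
  unfolding epoch_def using valid_arrivals_gap[THEN less_imp_le] by (intro sum_mono2) auto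

section \<open>Dynamics of a single sample path\<close>

locale onebit_path =
  fixes q :: state and w :: "nat \<Rightarrow> arrival" and age :: "nat \<Rightarrow> real \<Rightarrow> real"
  assumes valid_q: "valid_state q" and valid_w: "valid_arrivals w"
    and sched: "onebit_schedule q w age"
begin

abbreviation "n \<equiv> length q"
abbreviation "arr \<equiv> arrival_time q w"
abbreviation "sz \<equiv> job_size q w"
abbreviation "sh \<equiv> predicted_short q w"
abbreviation "ini \<equiv> initial_age q"
abbreviation "pres \<equiv> present q w age"
abbreviation "srv \<equiv> served q w age"
abbreviation cls :: "nat \<Rightarrow> nat" where "cls i \<equiv> (if sh i then 1 else 2)"

lemma srv_iff: "srv t i \<longleftrightarrow> pres t i \<and> (\<forall>j. pres t j \<and> j \<noteq> i \<longrightarrow>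
     cls i < cls j \<or> cls i = cls j \<and> (age j t < age i t \<or> age j t = age i t \<and> i < j))"
  unfolding served_def rank_less_def rank_def by auto

lemma srv_present: "srv t i \<Longrightarrow> arr i \<le> t \<and> age i t < sz i"
  by (simp add: served_def present_def)

lemma age_0: "age i 0 = ini i"
  and age_cont: "continuous_on {0..} (age i)"
  and age_deriv: "t \<ge> 0 \<Longrightarrow> (age i has_real_derivative (if srv t i then 1 else 0)) (at_right t)"
  using sched unfolding onebit_schedule_def by auto

lemma age_cont_Icc: "0 \<le> a \<Longrightarrow> continuous_on {a..b} (age i)"
  by (rule continuous_on_subset[OF age_cont]) auto

lemma age_tendsto_right: "s \<ge> 0 \<Longrightarrow> (age i \<longlongrightarrow> age i s) (at_right s)"
proof -
  assume s: "s \<ge> 0"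
  have "continuous_on {s..s+1} (age i)" using s by (rule age_cont_Icc)
  then have "(age i \<longlongrightarrow> age i s) (at s within {s..s+1})" by (auto simp: continuous_on_def)
  then show ?thesis by (simp add: at_within_Icc_at_right)
qed

lemma age_tendsto_left: "s > 0 \<Longrightarrow> (age i \<longlongrightarrow> age i s) (at_left s)"
proof -
  assume s: "s > 0"
  have "continuous_on {0..s} (age i)" by (rule age_cont_Icc) simp
  then have "(age i \<longlongrightarrow> age i s) (at s within {0..s})" using s by (auto simp: continuous_on_def)
  then show ?thesis using s by (simp add: at_within_Icc_at_left)
qed

lemma age_mono: "0 \<le> t \<Longrightarrow> t \<le> u \<Longrightarrow> age i t \<le> age i u"
proof -
  assume tu: "0 \<le> t" "t \<le> u"
  have "0 * (u - t) \<le> age i u - age i t"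
    by (rule right_deriv_lower[where D = "\<lambda>t. if srv t i then 1 else 0", OF tu(2) age_cont_Icc age_deriv])
       (use tu in auto)
  then show ?thesis by simp
qed

lemma age_idle:
  assumes "0 \<le> t" "t \<le> u" "\<And>s. t \<le> s \<Longrightarrow> s < u \<Longrightarrow> \<not> srv s i"
  shows "age i u = age i t"
proof -
  have "age i u - age i t \<le> 0 * (u - t)"
    by (rule right_deriv_upper[where D = "\<lambda>t. if srv t i then 1 else 0", OF assms(2) age_cont_Icc age_deriv])
       (use assms in auto)
  with age_mono[OF assms(1,2), of i] show ?thesis by simp
qed

lemma ini_nonneg: "0 \<le> ini i"
  and ini_less: "ini i < sz i"
proof -
  have "0 \<le> ini i \<and> ini i < sz i"
  proof (cases "i < n")
    case True
    then have "q ! i \<in> set q" by simp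
    with valid_q have "case q ! i of (b, s, a) \<Rightarrow> 0 \<le> a \<and> a < s" unfolding valid_state_def by (rule bspec)
    then show ?thesis using True by (auto simp: initial_age_def job_size_def split: prod.splits)
  next
    case False
    then show ?thesis using valid_arrivals_service[OF valid_w]
      by (auto simp: initial_age_def job_size_def service_def)
  qed
  then show "0 \<le> ini i" "ini i < sz i" by auto
qed

lemma ini_new: "n \<le> i \<Longrightarrow> ini i = 0"
  by (simp add: initial_age_def)

lemma age_nonneg: "0 \<le> t \<Longrightarrow> 0 \<le> age i t"
  using age_mono[of 0 t i] ini_nonneg[of i] by (simp add: age_0)

lemma age_done: "0 \<le> t \<Longrightarrow> t \<le> u \<Longrightarrow> sz i \<le> age i t \<Longrightarrow> age i u = age i t"
proof -
  assume a: "0 \<le> t" "t \<le> u" "sz i \<le> age i t"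
  have "\<not> srv s i" if "t \<le> s" for s
    using age_mono[OF a(1) that, of i] a(3) srv_present[of s i] by linarith
  then show ?thesis using age_idle[OF a(1,2)] by blast
qed

text \<open>When the age reaches the size, the job ceases to be present and is never served again,
  so the age stays there; an overshoot would have to pass through that value.\<close>

lemma age_le_size:
  assumes t: "0 \<le> t" shows "age i t \<le> sz i"
proof (rule ccontr)
  assume a: "\<not> age i t \<le> sz i"
  have "\<exists>s\<ge>0. s \<le> t \<and> age i s = sz i"
    using a t ini_less[of i] by (intro IVT'[of "age i"]) (auto simp: age_0 intro: age_cont_Icc)
  then obtain s where s: "0 \<le> s" "s \<le> t" "age i s = sz i" by blast
  have "age i t = age i s" by (rule age_done) (use s in auto)
  with a s(3) show False by linarith
qed

lemma arr_old: "i < n \<Longrightarrow> arr i = 0"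
  and arr_new: "n \<le> i \<Longrightarrow> arr i = epoch w (i - n)"
  by (simp_all add: arrival_time_def epoch_def gap_def)

lemma arr_nonneg: "0 \<le> arr i"
  using epoch_pos[OF valid_w, of "i - n"] by (cases "i < n") (auto simp: arr_old arr_new)

lemma arr_mono: "i \<le> j \<Longrightarrow> arr i \<le> arr j"
  using epoch_mono[OF valid_w, of "i - n" "j - n"] arr_nonneg[of j]
  by (cases "i < n"; cases "j < n") (auto simp: arr_old arr_new)

lemma finite_arr: "finite {i. arr i \<le> t}"
proof -
  have "{i. arr i \<le> t} \<subseteq> {..<n} \<union> (\<lambda>k. k + n) ` {k. epoch w k \<le> t}"
  proof
    fix i assume "i \<in> {i. arr i \<le> t}"
    then show "i \<in> {..<n} \<union> (\<lambda>k. k + n) ` {k. epoch w k \<le> t}"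
      by (cases "i < n") (auto simp: arr_new image_iff intro!: exI[of _ "i - n"])
  qed
  then show ?thesis using finite_epoch_le[OF valid_w, of t] by (blast intro: finite_subset)
qed

lemma finite_pres: "finite {i. pres t i}"
  by (rule finite_subset[OF _ finite_arr[of t]]) (auto simp: present_def)

text \<open>Valid arrivals do not accumulate: only finitely many fall in the unit interval after
  \<open>s\<close>, so the set of jobs that have arrived is constant on some interval to the right
  of \<open>s\<close>.\<close>

lemma no_arrivals_right: "eventually (\<lambda>u. \<forall>i. arr i \<le> u \<longleftrightarrow> arr i \<le> s) (at_right s)"
proof -
  have "finite {i. arr i \<le> s + 1 \<and> s < arr i}"
    by (rule finite_subset[OF _ finite_arr[of "s + 1"]]) auto
  moreover have "eventually (\<lambda>u. u < arr i) (at_right s)" if "s < arr i" for i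
    using that by (rule order_tendstoD(2)[OF tendsto_ident_at])
  ultimately have "eventually (\<lambda>u. \<forall>i\<in>{i. arr i \<le> s + 1 \<and> s < arr i}. u < arr i) (at_right s)"
    by (intro eventually_ball_finite) auto
  moreover have "eventually (\<lambda>u. u < s + 1) (at_right s)"
    by (rule order_tendstoD(2)[OF tendsto_ident_at]) simp
  moreover have "eventually (\<lambda>u. s < u) (at_right s)"
    by (simp add: eventually_at_right_less)
  ultimately show ?thesis
  proof eventually_elim
    case (elim u)
    have "arr i \<le> s" if i: "arr i \<le> u" for i
    proof (rule ccontr)
      assume "\<not> arr i \<le> s"
      then have "i \<in> {i. arr i \<le> s + 1 \<and> s < arr i}" using i elim(2) by simp
      with elim(1) have "u < arr i" by (rule bspec)
      with i show False by simp
    qed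
    moreover have "arr i \<le> u" if "arr i \<le> s" for i using that elim(3) by simp
    ultimately show ?case by (metis (no_types))
  qed
qed

lemma srv_unique: "srv t i \<Longrightarrow> srv t j \<Longrightarrow> i = j"
proof (rule ccontr)
  assume i: "srv t i" and j: "srv t j" and ne: "i \<noteq> j"
  have "cls i < cls j \<or> cls i = cls j \<and> (age j t < age i t \<or> age j t = age i t \<and> i < j)"
    using i j ne unfolding srv_iff by blast
  moreover have "cls j < cls i \<or> cls j = cls i \<and> (age i t < age j t \<or> age i t = age j t \<and> j < i)"
    using i j ne unfolding srv_iff by blast
  ultimately show False by linarith
qed

text \<open>The finitely many present jobs have a least rank, selected in three stages: least class
  (\<open>B\<close>), greatest age (\<open>C\<close>) because ranks carry the negated age, and least
  index as the FCFS tie-break. So the server never idles while a job is present.\<close>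

lemma srv_exists:
  assumes "pres t i" shows "\<exists>k. srv t k"
proof -
  define A where "A = {i. pres t i}"
  have A: "finite A" "A \<noteq> {}" using assms finite_pres by (auto simp: A_def)
  define B where "B = {i \<in> A. cls i = Min (cls ` A)}"
  have "Min (cls ` A) \<in> cls ` A" using A by (intro Min_in) auto
  then have B: "finite B" "B \<noteq> {}" using A by (auto simp: B_def)
  define C where "C = {i \<in> B. age i t = Max ((\<lambda>i. age i t) ` B)}"
  have "Max ((\<lambda>i. age i t) ` B) \<in> (\<lambda>i. age i t) ` B" using B by (intro Max_in) auto
  then obtain i where "i \<in> B" "age i t = Max ((\<lambda>i. age i t) ` B)" by force
  then have C: "finite C" "C \<noteq> {}" using B by (auto simp: C_def)
  have k: "Min C \<in> C" using C by simp
  have "srv t (Min C)"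
    unfolding srv_iff
  proof (intro conjI allI impI)
    show "pres t (Min C)" using k by (auto simp: C_def B_def A_def)
    fix j assume j: "pres t j \<and> j \<noteq> Min C"
    have kB: "cls (Min C) = Min (cls ` A)" using k by (auto simp: C_def B_def)
    have le: "cls (Min C) \<le> cls j" unfolding kB using j A by (intro Min_le) (auto simp: A_def)
    show "cls (Min C) < cls j \<or> cls (Min C) = cls j \<and> (age j t < age (Min C) t \<or> age j t = age (Min C) t \<and> Min C < j)"
    proof (cases "cls (Min C) = cls j")
      case True
      then have jB: "j \<in> B" using j kB by (auto simp: B_def A_def)
      then have "age j t \<le> age (Min C) t" using k B by (auto simp: C_def)
      moreover have "Min C < j" if "age j t = age (Min C) t"
      proof -
        have "j \<in> C" using that jB k by (auto simp: C_def)
        then have "Min C \<le> j" using C by simp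
        with j show ?thesis by simp
      qed
      ultimately show ?thesis using True by force
    qed (use le in linarith)
  qed
  then show ?thesis by blast
qed

text \<open>The age of the served job outgrows those of its rivals to first order, so the right derivative
  at \<open>s\<close> already decides who is served just after \<open>s\<close>.\<close>

lemma srv_persists:
  assumes s: "0 \<le> s" and k: "srv s k"
  shows "eventually (\<lambda>u. srv u k) (at_right s)"
proof -
  have kp: "pres s k" using k by (simp add: served_def)
  have "eventually (\<lambda>u. age k u < sz k) (at_right s)"
    using kp by (intro order_tendstoD[OF age_tendsto_right[OF s]]) (simp add: present_def)
  moreover have gr: "eventually (\<lambda>u. s < u) (at_right s)" by (simp add: eventually_at_right_less)
  moreover have "eventually (\<lambda>u. \<forall>j\<in>{j. pres s j}. j \<noteq> k \<and> cls k = cls j \<longrightarrow> age j u < age k u) (at_right s)"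
  proof (rule eventually_ball_finite[OF finite_pres], safe)
    fix j assume j: "pres s j"
    show "eventually (\<lambda>u. j \<noteq> k \<and> cls k = cls j \<longrightarrow> age j u < age k u) (at_right s)"
    proof (cases "j \<noteq> k \<and> cls k = cls j")
      case True
      then have nsj: "\<not> srv s j" using k srv_unique by blast
      have le: "age j s \<le> age k s" using k j True unfolding srv_iff by force
      have "((\<lambda>u. age k u - age j u) has_real_derivative 1 - 0) (at_right s)"
        using age_deriv[OF s, of k] age_deriv[OF s, of j] k nsj by (intro DERIV_diff) auto
      then have "((\<lambda>y. ((age k y - age j y) - (age k s - age j s)) / (y - s)) \<longlongrightarrow> 1) (at_right s)"
        by (simp add: has_field_derivative_iff)
      then have "eventually (\<lambda>y. ((age k y - age j y) - (age k s - age j s)) / (y - s) > 0) (at_right s)"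
        by (rule order_tendstoD) simp
      with gr show ?thesis
      proof eventually_elim
        case (elim y)
        then have "(age k y - age j y) - (age k s - age j s) > 0" by (simp add: zero_less_divide_iff)
        then show ?case using le by simp
      qed
    next
      case False then show ?thesis by (intro always_eventually) blast
    qed
  qed
  ultimately show ?thesis using no_arrivals_right[of s]
  proof eventually_elim
    case (elim u)
    show ?case unfolding srv_iff
    proof (intro conjI allI impI)
      show "pres u k" using elim kp by (auto simp: present_def)
      fix j assume j: "pres u j \<and> j \<noteq> k"
      then have "pres s j" using elim age_mono[OF s, of u j] by (auto simp: present_def)
      with k j have "cls k < cls j \<or> cls k = cls j" unfolding srv_iff by blast
      then show "cls k < cls j \<or> cls k = cls j \<and> (age j u < age k u \<or> age j u = age k u \<and> k < j)"
        using elim j \<open>pres s j\<close> by blast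
    qed
  qed
qed

text \<open>Either some other job is served at \<open>s\<close>, which persists and excludes
  \<open>k\<close> by uniqueness, or nobody is present and the system stays empty until the next
  arrival.\<close>

lemma not_srv_persists:
  assumes s: "0 \<le> s" and k: "\<not> srv s k"
  shows "eventually (\<lambda>u. \<not> srv u k) (at_right s)"
proof (cases "\<exists>i. pres s i")
  case True
  then obtain j where j: "srv s j" using srv_exists by blast
  then have "j \<noteq> k" using k by blast
  then have "\<not> srv u k" if "srv u j" for u using srv_unique that by blast
  with srv_persists[OF s j] show ?thesis by (rule eventually_mono)
next
  case False
  have "eventually (\<lambda>u. s < u) (at_right s)" by (simp add: eventually_at_right_less)
  with no_arrivals_right[of s] show ?thesis
  proof eventually_elim
    case (elim u)
    have "\<not> pres s k" using False by blast
    moreover have "age k s \<le> age k u" using s elim by (intro age_mono) auto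
    ultimately have "\<not> pres u k" using elim by (auto simp: present_def)
    then show ?case by (simp add: served_def)
  qed
qed

text \<open>A vanishing right derivative at \<open>s\<close> alone does not freeze the age on an
  interval; absence of service does, because it lasts for a while.\<close>

lemma idle_right:
  assumes s: "0 \<le> s" and k: "\<not> srv s k"
  shows "eventually (\<lambda>u. age k u = age k s) (at_right s)"
proof -
  from not_srv_persists[OF s k] obtain b where b: "b > s" "\<And>y. s < y \<Longrightarrow> y < b \<Longrightarrow> \<not> srv y k"
    unfolding eventually_at_right_field by blast
  have "age k u = age k s" if "s < u" "u < b" for u
  proof (rule age_idle)
    fix y assume "s \<le> y" "y < u"
    then show "\<not> srv y k" using k b(2)[of y] that by (cases "y = s") auto
  qed (use s that in auto)
  then show ?thesis unfolding eventually_at_right_field using b by blast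
qed

text \<open>As long as \<open>i\<close> is unfinished and \<open>j\<close> has age 0,
  \<open>j\<close> loses to \<open>i\<close>: the age of \<open>i\<close> is at least 0 and a tie
  goes to the smaller index. Real induction turns this into age 0 throughout, with
  \<open>idle_right\<close> for the step forward and continuity for the step to a limit. The premise
  \<open>ini j = 0\<close> holds for the tagged job and for all later arrivals.\<close>

lemma fcfs_long:
  assumes ij: "i < j" "\<not> sh i" "\<not> sh j" "ini j = 0" and t: "0 \<le> t" and p: "age i t < sz i"
  shows "age j t = 0"
proof -
  define P where "P t \<longleftrightarrow> age i t < sz i \<longrightarrow> age j t = 0" for t
  have "P t"
  proof (rule real_induct_right[where a = 0, OF _ _ _ t])
    show "P 0" by (simp add: P_def age_0 ij)
  next
    fix s :: real assume s: "0 \<le> s" "P s"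
    show "eventually P (at_right s)"
    proof (cases "age i s < sz i")
      case False
      have "eventually (\<lambda>u. s < u) (at_right s)" by (simp add: eventually_at_right_less)
      then show ?thesis
      proof eventually_elim
        case (elim u)
        then have "age i s \<le> age i u" using s by (intro age_mono) auto
        then show ?case using False by (simp add: P_def)
      qed
    next
      case True
      then have aj: "age j s = 0" using s by (simp add: P_def)
      have "\<not> srv s j"
      proof
        assume sj: "srv s j"
        then have "arr i \<le> s" using arr_mono[of i j] ij srv_present[of s j] by simp
        then have "pres s i" using True by (simp add: present_def)
        with sj ij have "age i s < 0" unfolding srv_iff by (auto simp: aj dest!: spec[of _ i])
        then show False using age_nonneg[OF s(1), of i] by simp
      qed
      from idle_right[OF s(1) this] show ?thesis
        by eventually_elim (simp add: P_def aj)
    qed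
  next
    fix u :: real assume u: "0 < u" and below: "\<And>s. 0 \<le> s \<Longrightarrow> s < u \<Longrightarrow> P s"
    show "P u" unfolding P_def
    proof
      assume a: "age i u < sz i"
      have "age j s = 0" if "0 \<le> s" "s < u" for s
        using below[OF that] a age_mono[of s u i] that by (simp add: P_def)
      then have "eventually (\<lambda>s. age j s = 0) (at_left u)"
        unfolding eventually_at_left_field using u by (intro exI[of _ 0]) auto
      then have "(age j \<longlongrightarrow> 0) (at_left u)" by (rule tendsto_eventually)
      with age_tendsto_left[OF u, of j] show "age j u = 0"
        by (intro tendsto_unique[of "at_left u"]) auto
    qed
  qed
  then show ?thesis using p by (simp add: P_def)
qed

section \<open>Total service of a set of jobs\<close>

definition attained :: "nat set \<Rightarrow> real \<Rightarrow> real" where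
  "attained F t = (\<Sum>i\<in>F. age i t - ini i)"

lemma attained_deriv:
  assumes "0 \<le> t"
  shows "(attained F has_real_derivative (\<Sum>i\<in>F. if srv t i then 1 else 0)) (at_right t)"
proof -
  have "((\<lambda>t. \<Sum>i\<in>F. age i t - ini i) has_real_derivative (\<Sum>i\<in>F. (if srv t i then 1 else 0) - 0)) (at_right t)"
    by (intro DERIV_sum DERIV_diff age_deriv assms DERIV_const)
  then show ?thesis by (simp add: attained_def[abs_def])
qed

lemma attained_cont: "continuous_on {0..b} (attained F)"
  unfolding attained_def[abs_def] by (intro continuous_intros age_cont_Icc) simp

lemma attained_0: "attained F 0 = 0"
  by (simp add: attained_def age_0)

lemma sum_srv:
  assumes "finite F"
  shows "(\<Sum>i\<in>F. if srv t i then 1 else (0::real)) = (if \<exists>i\<in>F. srv t i then 1 else 0)"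
proof (cases "\<exists>i\<in>F. srv t i")
  case True
  then obtain k where k: "k \<in> F" "srv t k" by blast
  have "(\<Sum>i\<in>F. if srv t i then 1 else (0::real)) = (\<Sum>i\<in>F. if i = k then 1 else 0)"
    using k srv_unique by (intro sum.cong) auto
  then show ?thesis using k assms True by simp
next
  case False
  then have "(\<Sum>i\<in>F. if srv t i then 1 else (0::real)) = (\<Sum>i\<in>F. 0)" by (intro sum.cong) auto
  then show ?thesis using False by simp
qed

lemma attained_nonneg: "0 \<le> t \<Longrightarrow> 0 \<le> attained F t"
  unfolding attained_def using age_mono[of 0 t] by (intro sum_nonneg) (auto simp: age_0)

text \<open>At most one job is served at a time, so by \<open>sum_srv\<close> the right derivative
  of the total is 0 or 1, however the service is divided within \<open>F\<close>.\<close>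

lemma attained_le: "finite F \<Longrightarrow> 0 \<le> t \<Longrightarrow> attained F t \<le> t"
proof -
  assume F: "finite F" and t: "0 \<le> t"
  have "attained F t - attained F 0 \<le> 1 * (t - 0)"
    by (rule right_deriv_upper[where D = "\<lambda>t. \<Sum>i\<in>F. if srv t i then 1 else 0", OF t attained_cont attained_deriv])
       (use F in \<open>auto simp: sum_srv\<close>)
  then show ?thesis by (simp add: attained_0)
qed

lemma attained_busy:
  assumes F: "finite F" and t: "0 \<le> t" and b: "\<And>u. 0 \<le> u \<Longrightarrow> u < t \<Longrightarrow> \<exists>i\<in>F. srv u i"
  shows "attained F t = t"
proof -
  have "1 * (t - 0) \<le> attained F t - attained F 0"
    by (rule right_deriv_lower[where D = "\<lambda>t. \<Sum>i\<in>F. if srv t i then 1 else 0", OF t attained_cont attained_deriv])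
       (use F b in \<open>auto simp: sum_srv\<close>)
  with attained_le[OF F t] show ?thesis by (simp add: attained_0)
qed

end

section \<open>The response time as a hitting time\<close>

lemma workload_eq_sum:
  "workload q = (\<Sum>i<length q. job_size q w i - initial_age q i)"
  unfolding workload_def
  by (subst sum_list_sum_nth)
     (auto simp: job_size_def initial_age_def lessThan_atLeast0 split_beta intro!: sum.cong)

lemma short_service_nonneg: "valid_arrivals w \<Longrightarrow> 0 \<le> short_service (w k)"
  using valid_arrivals_service[of w k] by (simp add: short_service_def)

lemma short_work_nonneg: "valid_arrivals w \<Longrightarrow> 0 \<le> short_work w t"
  unfolding short_work_def by (intro sum_nonneg short_service_nonneg)

lemma workload_nonneg: "valid_state q \<Longrightarrow> 0 \<le> workload q"
  unfolding workload_def valid_state_def by (intro sum_list_nonneg) fastforce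

context onebit_path
begin

text \<open>Meant for a tagged long job \<open>m\<close> that is the last of the initial ones. The
  set collects all that can receive service before time \<open>t\<close> while \<open>m\<close> is
  unfinished: the initial jobs including \<open>m\<close> itself and the short jobs that arrive
  strictly before \<open>t\<close>. Long jobs behind \<open>m\<close> are left out, by FCFS.\<close>

definition ahead :: "nat \<Rightarrow> real \<Rightarrow> nat set" where
  "ahead m t = {..m} \<union> {i. m < i \<and> sh i \<and> arr i < t}"

lemma finite_ahead: "finite (ahead m t)"
proof -
  have "finite {i. m < i \<and> sh i \<and> arr i < t}"
    by (rule finite_subset[OF _ finite_arr[of t]]) auto
  then show ?thesis by (simp add: ahead_def)
qed

lemma sum_new_short:
  assumes m: "n = Suc m"
  shows "(\<Sum>i | m < i \<and> sh i \<and> arr i < t. sz i - ini i) = short_work w t"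
proof -
  have "(\<Sum>i | m < i \<and> sh i \<and> arr i < t. sz i - ini i)
      = (\<Sum>k | epoch w k < t \<and> snd (snd (w k)). short_service (w k))"
    by (rule sum.reindex_bij_witness[where i = "\<lambda>k. k + n" and j = "\<lambda>i. i - n"])
       (use m in \<open>auto simp: arr_new ini_new predicted_short_def job_size_def short_service_def service_def\<close>)
  also have "\<dots> = short_work w t"
    unfolding short_work_def
    by (rule sum.mono_neutral_left)
       (use finite_epoch_less[OF valid_w] in \<open>auto simp: short_service_def\<close>)
  finally show ?thesis .
qed

lemma sum_ahead:
  assumes m: "n = Suc m"
  shows "(\<Sum>i\<in>ahead m t. sz i - ini i) = workload q + short_work w t"
proof -
  have fin: "finite {i. m < i \<and> sh i \<and> arr i < t}"
    by (rule finite_subset[OF _ finite_ahead[of m t]]) (auto simp: ahead_def)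
  have "(\<Sum>i\<in>ahead m t. sz i - ini i) = (\<Sum>i\<le>m. sz i - ini i)
     + (\<Sum>i | m < i \<and> sh i \<and> arr i < t. sz i - ini i)"
    unfolding ahead_def by (rule sum.union_disjoint) (use fin in auto)
  also have "(\<Sum>i\<le>m. sz i - ini i) = workload q"
    using workload_eq_sum[of q w] m by (simp add: lessThan_Suc_atMost)
  finally show ?thesis using sum_new_short[OF m] by simp
qed

text \<open>While \<open>m\<close> is unfinished the server is busy, and never with an outsider: a
  later long job still has age 0 and loses to \<open>m\<close>, and a job arriving at
  \<open>t\<close> or later is not yet there. So the whole time is spent on
  \<open>ahead m t\<close>.\<close>

lemma attained_ahead:
  assumes m: "n = Suc m" "\<not> sh m" "ini m = 0" and t: "0 \<le> t"
    and un: "\<And>u. 0 \<le> u \<Longrightarrow> u < t \<Longrightarrow> age m u < sz m"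
  shows "attained (ahead m t) t = t"
proof (rule attained_busy[OF finite_ahead t])
  fix u assume u: "0 \<le> u" "u < t"
  have pm: "pres u m" using un[OF u] u m by (simp add: present_def arr_old)
  then obtain k where k: "srv u k" using srv_exists by blast
  have "k \<in> ahead m t"
  proof (rule ccontr)
    assume "k \<notin> ahead m t"
    then have km: "m < k" "\<not> sh k \<or> \<not> arr k < t" by (auto simp: ahead_def)
    then have lk: "\<not> sh k" using srv_present[OF k] u by auto
    have "age k u = 0"
      by (rule fcfs_long[of m k]) (use km m lk u un[OF u] in \<open>auto simp: ini_new\<close>)
    moreover have "age m u < age k u \<or> age m u = age k u \<and> k < m"
      using k pm km m(2) lk unfolding srv_iff by auto
    ultimately show False using age_nonneg[OF u(1), of m] km by linarith
  qed
  with k show "\<exists>i\<in>ahead m t. srv u i" by blast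
qed

text \<open>Both directions compare elapsed time, all of it spent on \<open>ahead\<close>, with the
  work contained in that set. The right-hand side speaks of some earlier \<open>u\<close> because
  the inequality \<open>workload q + short_work w u \<le> u\<close> can fail again after the
  completion, when further short jobs arrive.\<close>

lemma last_long_done_iff:
  assumes m: "n = Suc m" "\<not> sh m" "ini m = 0" and t: "0 \<le> t"
  shows "sz m \<le> age m t \<longleftrightarrow> (\<exists>u. 0 \<le> u \<and> u \<le> t \<and> workload q + short_work w u \<le> u)"
proof
  assume "\<exists>u. 0 \<le> u \<and> u \<le> t \<and> workload q + short_work w u \<le> u"
  then obtain u where u: "0 \<le> u" "u \<le> t" "workload q + short_work w u \<le> u" by blast
  show "sz m \<le> age m t"
  proof (rule ccontr)
    assume nd: "\<not> sz m \<le> age m t"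
    have un: "age m s < sz m" if "0 \<le> s" "s \<le> u" for s
      using age_mono[of s t m] that u nd by linarith
    \<comment> \<open>All of \<open>u\<close> was spent on \<open>ahead m u\<close>, yet
      \<open>m\<close> itself is unfinished, so the total service is strictly less than the work of
      this set.\<close>
    have "u = attained (ahead m u) u"
      using attained_ahead[OF m u(1)] un by auto
    also have "\<dots> < (\<Sum>i\<in>ahead m u. sz i - ini i)"
      unfolding attained_def
    proof (rule sum_strict_mono_ex1[OF finite_ahead])
      show "\<forall>i\<in>ahead m u. age i u - ini i \<le> sz i - ini i" using age_le_size[OF u(1)] by simp
      show "\<exists>i\<in>ahead m u. age i u - ini i < sz i - ini i"
        using un[of u] u by (intro bexI[of _ m]) (auto simp: ahead_def)
    qed
    also have "\<dots> = workload q + short_work w u" by (rule sum_ahead[OF m(1)])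
    finally show False using u by simp
  qed
next
  assume d: "sz m \<le> age m t"
  \<comment> \<open>Closedness of \<open>S\<close> provides the first instant \<open>R\<close> at
    which the tagged job is complete.\<close>
  define S where "S = {s \<in> {0..t}. sz m \<le> age m s}"
  have "closed S" unfolding S_def
    by (intro continuous_on_closed_Collect_le continuous_intros age_cont_Icc) auto
  moreover have "bounded S" by (rule bounded_subset[of "{0..t}"]) (auto simp: S_def)
  ultimately have "compact S" by (simp add: compact_eq_bounded_closed)
  moreover have "t \<in> S" using d t by (simp add: S_def)
  ultimately obtain R where R: "R \<in> S" "\<And>s. s \<in> S \<Longrightarrow> R \<le> s"
    using compact_attains_inf[of S] by blast
  have R0: "0 \<le> R" "R \<le> t" "sz m \<le> age m R" using R(1) by (auto simp: S_def)
  have un: "age m u < sz m" if "0 \<le> u" "u < R" for u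
    using R(2)[of u] that R0 by (force simp: S_def)
  have Rpos: "0 < R"
    using R0 ini_less[of m] age_0[of m] by (cases "R = 0") auto
  \<comment> \<open>An unfinished short job would have blocked \<open>m\<close> ever since its
    arrival before \<open>R\<close>, so \<open>m\<close> would have been complete at that arrival,
    against the minimality of \<open>R\<close>. An unfinished long job precedes \<open>m\<close> and
    would have kept its age at 0.\<close>
  have all_done: "sz i \<le> age i R" if i: "i \<in> ahead m R" for i
  proof (rule ccontr)
    assume nd: "\<not> sz i \<le> age i R"
    then have im: "i \<noteq> m" using R0 by auto
    have ai: "arr i < R" using i Rpos m by (auto simp: ahead_def arr_old)
    show False
    proof (cases "sh i")
      case True
      have "age m R = age m (arr i)"
      proof (rule age_idle[OF arr_nonneg])
        show "arr i \<le> R" using ai by simp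
        fix s assume s: "arr i \<le> s" "s < R"
        have "age i s \<le> age i R" using arr_nonneg[of i] s by (intro age_mono) auto
        then have "pres s i" using s nd by (simp add: present_def)
        then show "\<not> srv s m" using True m(2) im unfolding srv_iff by (auto dest!: spec[of _ i])
      qed
      then show False using un[OF arr_nonneg ai] R0 by simp
    next
      case False
      then have "i < m" using i im by (auto simp: ahead_def)
      then have "age m R = 0" by (rule fcfs_long) (use False m R0 nd in auto)
      then show False using R0(3) ini_less[of m] m by simp
    qed
  qed
  have "workload q + short_work w R = (\<Sum>i\<in>ahead m R. sz i - ini i)"
    by (rule sum_ahead[OF m(1), symmetric])
  also have "\<dots> \<le> attained (ahead m R) R"
    unfolding attained_def by (intro sum_mono diff_right_mono all_done)
  also have "\<dots> = R" by (rule attained_ahead[OF m R0(1) un])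
  finally show "\<exists>u. 0 \<le> u \<and> u \<le> t \<and> workload q + short_work w u \<le> u" using R0 by blast
qed

end

text \<open>First passage time of the net work \<open>v + short_work w t - t\<close> to nonpositive
  values; the infimum of the empty set is \<open>top\<close>, so work that is never exhausted counts
  as infinite.\<close>

definition hit :: "real \<Rightarrow> (nat \<Rightarrow> arrival) \<Rightarrow> ennreal" where
  "hit v w = Inf {ennreal t | t. 0 \<le> t \<and> v + short_work w t \<le> t}"

text \<open>The instants at which the job is complete form the upward closure of those satisfying
  the inequality in \<open>hit\<close>, so the infima agree even though the sets may differ.\<close>

lemma response_time_long_eq_hit:
  assumes pol: "onebit_policy age" and q: "valid_state q" and w: "valid_arrivals w" and x: "0 < x"
  shows "response_time_long age x q w = hit (workload q + x) w"
proof -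
  define Q where "Q = q @ [(False, x, 0)]"
  have vQ: "valid_state Q" using q x by (auto simp: Q_def valid_state_def)
  interpret onebit_path Q w "age Q w"
    using pol vQ w by unfold_locales (auto simp: onebit_policy_def)
  have Q: "length Q = Suc (length q)" "\<not> predicted_short Q w (length q)"
    "initial_age Q (length q) = 0" "job_size Q w (length q) = x" "workload Q = workload q + x"
    by (auto simp: Q_def predicted_short_def initial_age_def job_size_def workload_def)
  have iff: "x \<le> age Q w (length q) t \<longleftrightarrow> (\<exists>u. 0 \<le> u \<and> u \<le> t \<and> workload q + x + short_work w u \<le> u)"
    if "0 \<le> t" for t
    using last_long_done_iff[OF Q(1-3) that] Q(4,5) by simp
  show ?thesis
    unfolding response_time_long_def hit_def Q_def[symmetric]
  proof (rule antisym)
    show "Inf {ennreal t |t. 0 \<le> t \<and> x \<le> age Q w (length q) t}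
      \<le> Inf {ennreal t |t. 0 \<le> t \<and> workload q + x + short_work w t \<le> t}"
      by (rule Inf_superset_mono) (use iff in blast)
    show "Inf {ennreal t |t. 0 \<le> t \<and> workload q + x + short_work w t \<le> t}
      \<le> Inf {ennreal t |t. 0 \<le> t \<and> x \<le> age Q w (length q) t}"
    proof (rule Inf_mono)
      fix b assume "b \<in> {ennreal t |t. 0 \<le> t \<and> x \<le> age Q w (length q) t}"
      then obtain t where t: "b = ennreal t" "0 \<le> t" "x \<le> age Q w (length q) t" by blast
      then obtain u where "0 \<le> u" "u \<le> t" "workload q + x + short_work w u \<le> u"
        using iff[OF t(2)] by blast
      then show "\<exists>a\<in>{ennreal t |t. 0 \<le> t \<and> workload q + x + short_work w t \<le> t}. a \<le> b"
        using t by (intro bexI[of _ "ennreal u"]) (auto intro: ennreal_leI)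
    qed
  qed
qed

section \<open>Decomposition of the hitting time at the arrival epochs\<close>

abbreviation (input) shift :: "(nat \<Rightarrow> 'a) \<Rightarrow> nat \<Rightarrow> 'a" where "shift w \<equiv> \<lambda>k. w (Suc k)"

lemma epoch_Suc_shift: "epoch w (Suc k) = gap (w 0) + epoch (shift w) k"
  unfolding epoch_def by (rule sum.atMost_Suc_shift)

lemma valid_arrivals_shift:
  assumes "valid_arrivals w" shows "valid_arrivals (shift w)"
proof -
  have "filterlim (\<lambda>k. epoch w (Suc k)) at_top sequentially"
    using valid_arrivals_epoch[OF assms] by (rule filterlim_compose) (rule filterlim_Suc)
  then have "filterlim (\<lambda>k. - gap (w 0) + epoch w (Suc k)) at_top sequentially"
    by (rule filterlim_tendsto_add_at_top[OF tendsto_const])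
  then have "filterlim (epoch (shift w)) at_top sequentially"
    by (simp add: epoch_Suc_shift)
  then show ?thesis using assms
    by (auto simp: valid_arrivals_def epoch_def[abs_def] gap_def)
qed

lemma short_work_shift:
  assumes w: "valid_arrivals w"
  shows "short_work w t =
    (if gap (w 0) < t then short_service (w 0) + short_work (shift w) (t - gap (w 0)) else 0)"
proof (cases "gap (w 0) < t")
  case True
  have e0: "epoch w 0 = gap (w 0)" by (simp add: epoch_def)
  have "{k. epoch w k < t} = insert 0 (Suc ` {k. epoch (shift w) k < t - gap (w 0)})"
  proof (intro set_eqI)
    fix k show "k \<in> {k. epoch w k < t} \<longleftrightarrow> k \<in> insert 0 (Suc ` {k. epoch (shift w) k < t - gap (w 0)})"
      using True e0 by (cases k) (auto simp: epoch_Suc_shift)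
  qed
  then have "short_work w t = (\<Sum>k\<in>insert 0 (Suc ` {k. epoch (shift w) k < t - gap (w 0)}). short_service (w k))"
    by (simp add: short_work_def)
  also have "\<dots> = short_service (w 0) + (\<Sum>k\<in>Suc ` {k. epoch (shift w) k < t - gap (w 0)}. short_service (w k))"
    by (rule sum.insert) (use finite_epoch_less[OF valid_arrivals_shift[OF w]] in auto)
  also have "(\<Sum>k\<in>Suc ` {k. epoch (shift w) k < t - gap (w 0)}. short_service (w k)) = short_work (shift w) (t - gap (w 0))"
    unfolding short_work_def by (subst sum.reindex) auto
  finally show ?thesis using True by simp
next
  case False
  have "\<not> epoch w k < t" for k
    using epoch_mono[OF w, of 0 k] False by (auto simp: epoch_def)
  then show ?thesis using False by (simp add: short_work_def)
qed

text \<open>A Lindley recursion with 0 made absorbing: the work ahead just after the next arrival.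
  If \<open>gap y = v\<close>, the work is exhausted at the very moment of the arrival, which then
  no longer counts, in line with the strict inequality in \<open>short_work\<close>.\<close>

definition step :: "arrival \<Rightarrow> real \<Rightarrow> real" where
  "step y v = (if gap y < v then v - gap y + short_service y else 0)"

lemma step_nonneg: "valid_arrivals w \<Longrightarrow> 0 \<le> step (w k) v"
  using short_service_nonneg[of w k] by (simp add: step_def)

lemma hit_0: "valid_arrivals w \<Longrightarrow> hit 0 w = 0"
proof -
  assume w: "valid_arrivals w"
  have "short_work w 0 = 0" using valid_arrivals_gap[OF w, of 0] by (simp add: short_work_shift[OF w])
  then have "hit 0 w \<le> ennreal 0" unfolding hit_def by (intro Inf_lower) force
  then show ?thesis by simp
qed

lemma INF_add_ennreal: "(INF y\<in>A. ennreal c + y) = ennreal c + Inf A"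
proof (rule antisym)
  have "(INF y\<in>A. ennreal c + y) - ennreal c \<le> Inf A"
  proof (rule Inf_greatest)
    fix y assume "y \<in> A"
    then have "(INF y\<in>A. ennreal c + y) \<le> ennreal c + y" by (rule INF_lower)
    then show "(INF y\<in>A. ennreal c + y) - ennreal c \<le> y" by (simp add: ennreal_minus_le_iff)
  qed
  then show "(INF y\<in>A. ennreal c + y) \<le> ennreal c + Inf A" by (simp add: ennreal_minus_le_iff)
  show "ennreal c + Inf A \<le> (INF y\<in>A. ennreal c + y)"
    by (intro INF_greatest add_left_mono Inf_lower)
qed

text \<open>If the first arrival does not come strictly before \<open>v\<close>, the work runs out
  at \<open>v\<close>. Otherwise no time up to the arrival qualifies, since a hitting time is at
  least \<open>v\<close>, and the remaining time solves the same problem for the shifted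
  arrivals.\<close>

lemma hit_step:
  assumes w: "valid_arrivals w" and v: "0 \<le> v"
  shows "hit v w = ennreal (min (gap (w 0)) v) + hit (step (w 0) v) (shift w)"
proof (cases "gap (w 0) < v")
  case False
  have sw: "short_work w v = 0" using False by (simp add: short_work_shift[OF w])
  have "hit v w = ennreal v" unfolding hit_def
  proof (rule antisym)
    show "Inf {ennreal t |t. 0 \<le> t \<and> v + short_work w t \<le> t} \<le> ennreal v"
      using v sw by (intro Inf_lower) auto
    show "ennreal v \<le> Inf {ennreal t |t. 0 \<le> t \<and> v + short_work w t \<le> t}"
    proof (rule Inf_greatest)
      fix y assume "y \<in> {ennreal t |t. 0 \<le> t \<and> v + short_work w t \<le> t}"
      then obtain t where t: "y = ennreal t" "v + short_work w t \<le> t" by blast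
      then have "v \<le> t" using short_work_nonneg[OF w, of t] by simp
      then show "ennreal v \<le> y" unfolding t by (rule ennreal_leI)
    qed
  qed
  then show ?thesis using False by (simp add: step_def hit_0[OF valid_arrivals_shift[OF w]] min_def)
next
  case True
  define g where "g = gap (w 0)"
  have g: "0 < g" "g < v" using True valid_arrivals_gap[OF w, of 0] by (auto simp: g_def)
  have Y: "0 \<le> short_service (w 0)" by (rule short_service_nonneg[OF w])
  have iff: "v + short_work w (g + s) \<le> g + s \<longleftrightarrow> step (w 0) v + short_work (shift w) s \<le> s"
    if "0 \<le> s" for s
  \<comment> \<open>At the arrival itself \<open>short_work w g\<close> does not yet count the
    arriving job, so the shift formula does not produce its contribution; but both inequalities fail
    there, as \<open>g < v\<close>.\<close>
  proof (cases "s = 0")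
    case s0: True
    have "short_work (shift w) 0 \<ge> 0" using valid_arrivals_shift[OF w] by (rule short_work_nonneg)
    then show ?thesis using g Y short_work_nonneg[OF w, of g] s0 by (simp add: step_def g_def)
  next
    case False
    with that have "0 < s" by simp
    then have "short_work w (g + s) = short_service (w 0) + short_work (shift w) s"
      by (subst short_work_shift[OF w]) (simp add: g_def)
    moreover have "step (w 0) v = v - g + short_service (w 0)"
      using True by (simp add: step_def g_def)
    ultimately show ?thesis by linarith
  qed
  have "{ennreal t |t. 0 \<le> t \<and> v + short_work w t \<le> t}
     = (\<lambda>y. ennreal g + y) ` {ennreal s |s. 0 \<le> s \<and> step (w 0) v + short_work (shift w) s \<le> s}"
    (is "?A = ?B")
  proof (intro equalityI subsetI)
    fix y assume "y \<in> ?A"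
    then obtain t where t: "y = ennreal t" "0 \<le> t" "v + short_work w t \<le> t" by blast
    then have "v \<le> t" using short_work_nonneg[OF w, of t] by simp
    then have "0 \<le> t - g" using g by simp
    moreover have "step (w 0) v + short_work (shift w) (t - g) \<le> t - g"
      using iff[OF \<open>0 \<le> t - g\<close>] t by simp
    moreover have "y = ennreal g + ennreal (t - g)"
      using t g \<open>0 \<le> t - g\<close> by (simp flip: ennreal_plus)
    ultimately show "y \<in> ?B" by blast
  next
    fix y assume "y \<in> ?B"
    then obtain s where s: "y = ennreal g + ennreal s" "0 \<le> s" "step (w 0) v + short_work (shift w) s \<le> s"
      by blast
    then have "y = ennreal (g + s)" "0 \<le> g + s" "v + short_work w (g + s) \<le> g + s"
      using g iff[OF s(2)] by auto
    then show "y \<in> ?A" by blast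
  qed
  then have "hit v w = (INF y\<in>{ennreal s |s. 0 \<le> s \<and> step (w 0) v + short_work (shift w) s \<le> s}. ennreal g + y)"
    unfolding hit_def by simp
  also have "\<dots> = ennreal g + hit (step (w 0) v) (shift w)"
    unfolding hit_def
    by (rule INF_add_ennreal)
  finally show ?thesis using True by (simp add: g_def min_def)
qed

text \<open>\<open>resid K w v\<close> is the work still ahead just after the \<open>K\<close>-th arrival if \<open>v\<close> was ahead at
  time 0, with value 0 once the work has been exhausted; \<open>elapsed\<close> and \<open>joined\<close> are the time
  worked and the short work that has joined up to then.\<close>

primrec resid :: "nat \<Rightarrow> (nat \<Rightarrow> arrival) \<Rightarrow> real \<Rightarrow> real" where
  "resid 0 w v = v"
| "resid (Suc K) w v = resid K (shift w) (step (w 0) v)"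

primrec elapsed :: "nat \<Rightarrow> (nat \<Rightarrow> arrival) \<Rightarrow> real \<Rightarrow> real" where
  "elapsed 0 w v = 0"
| "elapsed (Suc K) w v = min (gap (w 0)) v + elapsed K (shift w) (step (w 0) v)"

primrec joined :: "nat \<Rightarrow> (nat \<Rightarrow> arrival) \<Rightarrow> real \<Rightarrow> real" where
  "joined 0 w v = 0"
| "joined (Suc K) w v =
    (if gap (w 0) < v then short_service (w 0) else 0) + joined K (shift w) (step (w 0) v)"

text \<open>Work conservation: what is left plus what was worked off equals what was there plus what
  joined. The step that exhausts the work is covered by \<open>min\<close>, which caps the time
  worked at \<open>v\<close>.\<close>

lemma resid_balance: "resid K w v + elapsed K w v = v + joined K w v"
proof (induction K arbitrary: w v)
  case (Suc K)
  from Suc[of "shift w" "step (w 0) v"] show ?case by (auto simp: step_def min_def split: if_splits)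
qed simp

text \<open>The definitions peel off the first arrival, which suits expectations; appending the last
  arrival instead gives access to signs, monotonicity in \<open>K\<close> and absorption at
  0.\<close>

lemma resid_Suc: "resid (Suc K) w v = step (w K) (resid K w v)"
proof (induction K arbitrary: w v)
  case (Suc K) from Suc[of "shift w" "step (w 0) v"] show ?case by simp
qed simp

lemma elapsed_Suc: "elapsed (Suc K) w v = elapsed K w v + min (gap (w K)) (resid K w v)"
proof (induction K arbitrary: w v)
  case (Suc K) from Suc[of "shift w" "step (w 0) v"] show ?case by simp
qed simp

lemma joined_Suc: "joined (Suc K) w v =
    joined K w v + (if gap (w K) < resid K w v then short_service (w K) else 0)"
proof (induction K arbitrary: w v)
  case (Suc K) from Suc[of "shift w" "step (w 0) v"] show ?case by simp
qed simp

lemma resid_nonneg: "valid_arrivals w \<Longrightarrow> 0 \<le> v \<Longrightarrow> 0 \<le> resid K w v"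
  by (cases K) (auto simp: resid_Suc step_nonneg simp del: resid.simps(2))

lemma elapsed_nonneg: "valid_arrivals w \<Longrightarrow> 0 \<le> v \<Longrightarrow> 0 \<le> elapsed K w v"
  using valid_arrivals_gap[of w] resid_nonneg[of w v]
  by (induction K) (auto simp: elapsed_Suc less_imp_le simp del: elapsed.simps(2))

lemma joined_nonneg: "valid_arrivals w \<Longrightarrow> 0 \<le> joined K w v"
  using short_service_nonneg[of w]
  by (induction K) (auto simp: joined_Suc simp del: joined.simps(2))

lemma elapsed_mono: "valid_arrivals w \<Longrightarrow> 0 \<le> v \<Longrightarrow> mono (\<lambda>K. elapsed K w v)"
  using valid_arrivals_gap[of w] resid_nonneg[of w v]
  by (intro incseq_SucI) (simp add: elapsed_Suc less_imp_le del: elapsed.simps(2))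

lemma joined_mono: "valid_arrivals w \<Longrightarrow> mono (\<lambda>K. joined K w v)"
  using short_service_nonneg[of w]
  by (intro incseq_SucI) (simp add: joined_Suc del: joined.simps(2))

lemma resid_0_stays:
  assumes w: "valid_arrivals w" and z: "resid K w v = 0" and le: "K \<le> L"
  shows "resid L w v = 0" "elapsed L w v = elapsed K w v"
proof -
  have "resid L w v = 0 \<and> elapsed L w v = elapsed K w v"
    using le
  proof (induction L rule: dec_induct)
    case base then show ?case using z by simp
  next
    case (step L)
    have "0 < gap (w L)" by (rule valid_arrivals_gap[OF w])
    with step.IH show ?case
      by (simp add: resid_Suc elapsed_Suc step_def del: resid.simps elapsed.simps)
  qed
  then show "resid L w v = 0" "elapsed L w v = elapsed K w v" by auto
qed

lemma elapsed_alive: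
  assumes "\<And>K. resid K w v \<noteq> 0" shows "elapsed K w v = (\<Sum>k<K. gap (w k))"
proof (induction K)
  case (Suc K)
  have "gap (w K) < resid K w v"
    using assms[of "Suc K"] by (auto simp: resid_Suc step_def simp del: resid.simps split: if_splits)
  with Suc show ?case by (simp add: elapsed_Suc del: elapsed.simps)
qed simp

lemma hit_iterate:
  assumes "valid_arrivals w" "0 \<le> v"
  shows "hit v w = ennreal (elapsed K w v) + hit (resid K w v) (\<lambda>k. w (K + k))"
  using assms
proof (induction K arbitrary: w v)
  case (Suc K)
  note w = Suc.prems(1) and v = Suc.prems(2)
  have w': "valid_arrivals (shift w)" by (rule valid_arrivals_shift[OF w])
  have s: "0 \<le> step (w 0) v" by (rule step_nonneg[OF w])
  have "0 \<le> min (gap (w 0)) v" using valid_arrivals_gap[OF w, of 0] v by simp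
  then show ?case
    using hit_step[OF w v] Suc.IH[OF w' s] elapsed_nonneg[OF w' s, of K]
    by (simp add: ennreal_plus ac_simps)
qed simp

lemma valid_arrivals_shift_iter: "valid_arrivals w \<Longrightarrow> valid_arrivals (\<lambda>k. w (K + k))"
proof (induction K)
  case (Suc K) from valid_arrivals_shift[OF Suc.IH[OF Suc.prems]] show ?case by simp
qed simp

text \<open>If the work is never exhausted, every gap is worked in full, so the time worked is an
  arrival epoch and diverges.\<close>

lemma alive_elapsed_unbounded:
  assumes w: "valid_arrivals w" and nz: "\<And>K. resid K w v \<noteq> 0"
  shows "(SUP K. ennreal (elapsed K w v)) = top"
proof (rule ennreal_SUP_eq_top)
  fix N :: nat
  have "eventually (\<lambda>k. epoch w k > real N) sequentially"
    using valid_arrivals_epoch[OF w] by (simp add: filterlim_at_top_dense)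
  then obtain k where "epoch w k > real N" by (auto simp: eventually_sequentially)
  then have "elapsed (Suc k) w v \<ge> real N"
    using elapsed_alive[OF nz, of "Suc k"] by (simp add: epoch_def lessThan_Suc_atMost)
  then have "ennreal (real N) \<le> ennreal (elapsed (Suc k) w v)" by (rule ennreal_leI)
  then show "\<exists>K\<in>UNIV. of_nat N \<le> ennreal (elapsed K w v)"     unfolding ennreal_of_nat_eq_real_of_nat by blast
qed

text \<open>Once the residual work is 0, the hitting time is the time worked so far; if that never
  happens, both sides are infinite. The supremum is countable and increasing in \<open>K\<close>, so
  it stands in for \<open>hit\<close> wherever measurability or monotone convergence is called
  for.\<close>

lemma hit_eq_SUP_elapsed:
  assumes w: "valid_arrivals w" and v: "0 \<le> v"
  shows "hit v w = (SUP K. ennreal (elapsed K w v))"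
proof (rule antisym)
  show "(SUP K. ennreal (elapsed K w v)) \<le> hit v w"
  proof (rule SUP_least)
    fix K show "ennreal (elapsed K w v) \<le> hit v w"
      by (subst hit_iterate[OF w v, of K]) simp
  qed
  show "hit v w \<le> (SUP K. ennreal (elapsed K w v))"
  proof (cases "\<exists>K. resid K w v = 0")
    case True
    then obtain K where K: "resid K w v = 0" ..
    have "hit v w = ennreal (elapsed K w v)"
      using hit_iterate[OF w v, of K] K hit_0[OF valid_arrivals_shift_iter[OF w]] by simp
    then show ?thesis by (auto intro: SUP_upper)
  next
    case False
    then have "(SUP K. ennreal (elapsed K w v)) = top" by (intro alive_elapsed_unbounded[OF w]) auto
    then show ?thesis by (simp only: top_greatest)
  qed
qed

section \<open>The arrival process\<close>

locale onebit_model =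
  fixes lam :: real and f p :: "real \<Rightarrow> real"
  assumes lam: "0 < lam"
    and f_meas [measurable]: "f \<in> borel_measurable borel"
    and f_nonneg: "0 \<le> f x"
    and f_zero: "x \<le> 0 \<Longrightarrow> f x = 0"
    and f_int: "(\<integral>\<^sup>+ x. ennreal (f x) \<partial>lborel) = 1"
    and p_meas [measurable]: "p \<in> borel_measurable borel"
    and p_range: "x > 0 \<Longrightarrow> 0 \<le> p x \<and> p x \<le> 1"
begin

definition gap_law :: "real measure" where
  "gap_law = density lborel (\<lambda>g. ennreal (exponential_density lam g))"

definition mark_law :: "(real \<times> bool) measure" where
  "mark_law = density (lborel \<Otimes>\<^sub>M count_space UNIV)
     (\<lambda>(s, b). ennreal (f s * (if b then p s else 1 - p s)))"

definition job_law :: "arrival measure" where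
  "job_law = gap_law \<Otimes>\<^sub>M mark_law"

abbreviation arrivals :: "(nat \<Rightarrow> arrival) measure" where
  "arrivals \<equiv> \<Pi>\<^sub>M k\<in>UNIV. job_law"

lemma arrival_law_eq: "arrival_law lam f p = arrivals"
  by (simp add: arrival_law_def job_law_def gap_law_def mark_law_def)

lemma sets_gap_law [measurable_cong]: "sets gap_law = sets borel"
  by (simp add: gap_law_def)

lemma sets_mark_law [measurable_cong]: "sets mark_law = sets (borel \<Otimes>\<^sub>M count_space UNIV)"
  unfolding mark_law_def sets_density by (intro sets_pair_measure_cong) auto

lemma sets_job_law [measurable_cong]:
  "sets job_law = sets (borel \<Otimes>\<^sub>M (borel \<Otimes>\<^sub>M count_space UNIV))"
  unfolding job_law_def by (intro sets_pair_measure_cong sets_gap_law sets_mark_law)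

lemma space_laws [simp]: "space gap_law = UNIV" "space mark_law = UNIV" "space job_law = UNIV"
  using sets_eq_imp_space_eq[OF sets_gap_law] sets_eq_imp_space_eq[OF sets_mark_law]
    sets_eq_imp_space_eq[OF sets_job_law] by (auto simp: space_pair_measure)

lemma gap_measurable [measurable]: "gap \<in> borel_measurable job_law"
  unfolding gap_def[abs_def] by measurable

lemma service_measurable [measurable]: "service \<in> borel_measurable job_law"
  unfolding service_def[abs_def] by measurable

lemma short_service_measurable [measurable]: "short_service \<in> borel_measurable job_law"
  unfolding short_service_def[abs_def] by measurable

lemma nn_integral_mark:
  assumes [measurable]: "h \<in> borel_measurable (borel \<Otimes>\<^sub>M count_space UNIV)"
  shows "(\<integral>\<^sup>+ y. h y \<partial>mark_law) = (\<integral>\<^sup>+ s. ennreal (f s) *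
    (ennreal (p s) * h (s, True) + ennreal (1 - p s) * h (s, False)) \<partial>lborel)"
proof -
  interpret C: sigma_finite_measure "count_space (UNIV :: bool set)"
    by (rule sigma_finite_measure_count_space_finite) simp
  have [measurable]: "h \<in> borel_measurable (lborel \<Otimes>\<^sub>M count_space UNIV)"
    by (subst measurable_cong_sets[OF sets_pair_measure_cong[OF sets_lborel refl] refl]) fact
  have "(\<integral>\<^sup>+ y. h y \<partial>mark_law)
     = (\<integral>\<^sup>+ y. (case y of (s, b) \<Rightarrow> ennreal (f s * (if b then p s else 1 - p s))) * h y
         \<partial>(lborel \<Otimes>\<^sub>M count_space UNIV))"
    unfolding mark_law_def by (subst nn_integral_density) auto
  also have "\<dots> = (\<integral>\<^sup>+ s. \<integral>\<^sup>+ b. ennreal (f s * (if b then p s else 1 - p s)) * h (s, b)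
        \<partial>count_space UNIV \<partial>lborel)"
    by (subst C.nn_integral_fst[symmetric]) auto
  also have "\<dots> = (\<integral>\<^sup>+ s. ennreal (f s) *
    (ennreal (p s) * h (s, True) + ennreal (1 - p s) * h (s, False)) \<partial>lborel)"
  proof (rule nn_integral_cong)
    fix s :: real
    have "(\<integral>\<^sup>+ b. ennreal (f s * (if b then p s else 1 - p s)) * h (s, b) \<partial>count_space UNIV)
      = ennreal (f s * p s) * h (s, True) + ennreal (f s * (1 - p s)) * h (s, False)"
      by (subst nn_integral_count_space_finite) (simp_all add: UNIV_bool ac_simps)
    then show "(\<integral>\<^sup>+ b. ennreal (f s * (if b then p s else 1 - p s)) * h (s, b) \<partial>count_space UNIV)
      = ennreal (f s) * (ennreal (p s) * h (s, True) + ennreal (1 - p s) * h (s, False))"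
      by (simp add: ennreal_mult' f_nonneg distrib_left mult.assoc)
  qed
  finally show ?thesis .
qed

text \<open>The prediction is integrated out: its weights sum to 1 for \<open>s > 0\<close>, and
  \<open>f\<close> carries no mass elsewhere.\<close>

lemma nn_integral_size:
  assumes [measurable]: "h \<in> borel_measurable borel"
  shows "(\<integral>\<^sup>+ y. h (fst y) \<partial>mark_law) = (\<integral>\<^sup>+ s. ennreal (f s) * h s \<partial>lborel)"
proof (subst nn_integral_mark)
  show "(\<integral>\<^sup>+ s. ennreal (f s) * (ennreal (p s) * h (fst (s, True)) + ennreal (1 - p s) * h (fst (s, False))) \<partial>lborel)
      = (\<integral>\<^sup>+ s. ennreal (f s) * h s \<partial>lborel)"
  proof (rule nn_integral_cong)
    fix s :: real
    show "ennreal (f s) * (ennreal (p s) * h (fst (s, True)) + ennreal (1 - p s) * h (fst (s, False))) = ennreal (f s) * h s"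
    proof (cases "s > 0")
      case True
      then have "ennreal (p s) + ennreal (1 - p s) = 1"
        using p_range[OF True] by (simp flip: ennreal_plus)
      then show ?thesis by (simp flip: distrib_right)
    qed (simp add: f_zero)
  qed
qed measurable

lemma load_eq: "load lam f = ennreal lam * (\<integral>\<^sup>+ m. ennreal (fst m) \<partial>mark_law)"
proof -
  have "(\<integral>\<^sup>+ m. ennreal (fst m) \<partial>mark_law) = (\<integral>\<^sup>+ s. ennreal (f s) * ennreal s \<partial>lborel)"
    by (rule nn_integral_size) simp
  also have "\<dots> = (\<integral>\<^sup>+ s\<in>{0<..}. ennreal (s * f s) \<partial>lborel)"
    using f_nonneg f_zero
    by (intro nn_integral_cong) (auto simp: mult.commute not_less split: split_indicator simp flip: ennreal_mult')
  finally show ?thesis by (simp add: load_def)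
qed

text \<open>The form with \<open>/ 2\<close> is the one that the second-order expansion of the
  Laplace transform produces.\<close>

lemma second_moment_eq: "(\<integral>\<^sup>+ m. ennreal ((fst m)\<^sup>2 / 2) \<partial>mark_law) = ennreal (1 / 2) * second_moment f"
proof -
  have "(\<integral>\<^sup>+ m. ennreal ((fst m)\<^sup>2 / 2) \<partial>mark_law) = (\<integral>\<^sup>+ s. ennreal (f s) * ennreal (s\<^sup>2 / 2) \<partial>lborel)"
    by (rule nn_integral_size) simp
  also have "\<dots> = (\<integral>\<^sup>+ s. ennreal (1 / 2) * (ennreal (s\<^sup>2 * f s) * indicator {0<..} s) \<partial>lborel)"
  proof (rule nn_integral_cong)
    fix s :: real
    show "ennreal (f s) * ennreal (s\<^sup>2 / 2) = ennreal (1 / 2) * (ennreal (s\<^sup>2 * f s) * indicator {0<..} s)"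
    proof (cases "0 < s")
      case True
      have "ennreal (f s) * ennreal (s\<^sup>2 / 2) = ennreal (f s * (s\<^sup>2 / 2))"
        by (rule ennreal_mult'[symmetric]) (rule f_nonneg)
      also have "f s * (s\<^sup>2 / 2) = 1 / 2 * (s\<^sup>2 * f s)" by simp
      also have "ennreal \<dots> = ennreal (1 / 2) * ennreal (s\<^sup>2 * f s)" by (rule ennreal_mult') simp
      finally show ?thesis using True by (simp only: indicator_simps greaterThan_iff mult_1_right)
    qed (simp add: f_zero)
  qed
  also have "\<dots> = ennreal (1 / 2) * second_moment f"
    unfolding second_moment_def by (rule nn_integral_cmult) simp
  finally show ?thesis .
qed

sublocale gap: prob_space gap_law
  unfolding gap_law_def using lam by (rule prob_space_exponential_density)

sublocale mark: prob_space mark_law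
proof
  have "emeasure mark_law (space mark_law) = (\<integral>\<^sup>+ y. 1 \<partial>mark_law)" by simp
  also have "\<dots> = (\<integral>\<^sup>+ s. ennreal (f s) * 1 \<partial>lborel)" by (rule nn_integral_size) simp
  finally show "emeasure mark_law (space mark_law) = 1" by (simp add: f_int)
qed

sublocale gap_mark: pair_prob_space gap_law mark_law ..

sublocale job: prob_space job_law
  unfolding job_law_def by (rule gap_mark.P.prob_space_axioms)

sublocale arr: sequence_space job_law ..

lemma nn_integral_job:
  assumes [measurable]: "h \<in> borel_measurable job_law"
  shows "(\<integral>\<^sup>+ y. h y \<partial>job_law) = (\<integral>\<^sup>+ g. \<integral>\<^sup>+ m. h (g, m) \<partial>mark_law \<partial>gap_law)"
proof -
  have "h \<in> borel_measurable (gap_law \<Otimes>\<^sub>M mark_law)" using assms by (simp add: job_law_def)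
  then show ?thesis unfolding job_law_def by (rule mark.nn_integral_fst[symmetric])
qed

text \<open>Renewal at the first arrival: it is independent of the later ones, which form an arrival
  sequence with the same law. Functionals defined by peeling off the first arrival are integrated
  this way.\<close>

lemma nn_integral_arrivals_Suc:
  assumes [measurable]: "h \<in> borel_measurable arrivals"
  shows "(\<integral>\<^sup>+ w. h w \<partial>arrivals) = (\<integral>\<^sup>+ y. \<integral>\<^sup>+ w. h (case_nat y w) \<partial>arrivals \<partial>job_law)"
proof -
  have m: "(\<lambda>(s, \<omega>). case_nat s \<omega>) \<in> job_law \<Otimes>\<^sub>M arrivals \<rightarrow>\<^sub>M arrivals"
    by measurable
  have "(\<integral>\<^sup>+ w. h w \<partial>arrivals) = (\<integral>\<^sup>+ w. h w \<partial>distr (job_law \<Otimes>\<^sub>M arrivals) arrivals (\<lambda>(s, \<omega>). case_nat s \<omega>))"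
    by (simp add: arr.PiM_iter)
  also have "\<dots> = (\<integral>\<^sup>+ z. h ((\<lambda>(s, \<omega>). case_nat s \<omega>) z) \<partial>(job_law \<Otimes>\<^sub>M arrivals))"
    by (rule nn_integral_distr[OF m]) simp
  also have "\<dots> = (\<integral>\<^sup>+ y. \<integral>\<^sup>+ w. h (case_nat y w) \<partial>arrivals \<partial>job_law)"
    by (subst arr.P.nn_integral_fst[symmetric]) (use m in \<open>auto intro!: measurable_compose[OF m]\<close>)
  finally show ?thesis .
qed

lemma nn_integral_gap:
  assumes [measurable]: "h \<in> borel_measurable borel"
  shows "(\<integral>\<^sup>+ g. h g \<partial>gap_law) = (\<integral>\<^sup>+ g. ennreal (exponential_density lam g) * h g \<partial>lborel)"
  unfolding gap_law_def by (subst nn_integral_density) auto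

lemma emeasure_gap_greater:
  assumes "0 \<le> v" shows "emeasure gap_law {v<..} = ennreal (exp (- lam * v))"
proof -
  have "distributed gap_law lborel (\<lambda>x. x) (exponential_density lam)"
    unfolding distributed_def using lam
    by (auto simp: gap_law_def distr_id2 exponential_density_nonneg)
  from gap.exponential_distributedD_gt[OF this assms lam]
  have "gap.prob {v<..} = exp (- v * lam)" by (simp add: greaterThan_def)
  then show ?thesis by (simp add: gap.emeasure_eq_measure mult.commute)
qed

lemma emeasure_gap_atMost:
  assumes "0 \<le> v" shows "emeasure gap_law {..v} = ennreal (1 - exp (- lam * v))"
proof -
  have "{..v} = space gap_law - {v<..}" by auto
  then have "gap.prob {..v} = 1 - gap.prob {v<..}"
    using gap.prob_compl[of "{v<..}"] by (simp add: sets_gap_law)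
  also have "gap.prob {v<..} = exp (- lam * v)"
    using emeasure_gap_greater[OF assms] by (simp add: gap.emeasure_eq_measure)
  finally show ?thesis by (simp add: gap.emeasure_eq_measure)
qed

lemma AE_gap_neq: "AE g in gap_law. g \<noteq> c"
  unfolding gap_law_def by (subst AE_density) (auto intro: AE_I2 AE_mp[OF AE_lborel_singleton])

lemma AE_gap_pos: "AE g in gap_law. 0 < g"
proof -
  have "AE g in gap_law. g \<notin> {..0}"
    by (rule AE_not_in) (simp add: null_sets_def emeasure_gap_atMost sets_gap_law)
  then show ?thesis by (auto simp: not_le)
qed

lemma emeasure_gap_less:
  assumes "0 \<le> v" shows "emeasure gap_law {..<v} = ennreal (1 - exp (- lam * v))"
proof -
  have "emeasure gap_law {..<v} = emeasure gap_law {..v}"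
    by (rule emeasure_eq_AE) (use AE_gap_neq[of v] in \<open>auto simp: sets_gap_law\<close>)
  then show ?thesis using emeasure_gap_atMost[OF assms] by simp
qed

text \<open>Both sides are \<open>1 - exp (- lam * v)\<close>.\<close>

lemma nn_integral_min_gap:
  assumes v: "0 \<le> v"
  shows "ennreal lam * (\<integral>\<^sup>+ g. ennreal (min g v) \<partial>gap_law) = emeasure gap_law {..<v}"
proof -
  \<comment> \<open>For \<open>g > 0\<close>, \<open>min g v\<close> is the length of the set of
    \<open>t\<close> in \<open>{0..v}\<close> with \<open>t < g\<close>; exchanging the integrals
    turns its mean into an integral of the exponential tail.\<close>
  have "(\<integral>\<^sup>+ g. ennreal (min g v) \<partial>gap_law)
     = (\<integral>\<^sup>+ g. \<integral>\<^sup>+ t. indicator {0..v} t * indicator {t<..} g \<partial>lborel \<partial>gap_law)"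
  proof (rule nn_integral_cong_AE, use AE_gap_pos in eventually_elim)
    case (elim g)
    have "(\<integral>\<^sup>+ t. indicator {0..v} t * indicator {t<..} g \<partial>lborel)
        = (\<integral>\<^sup>+ t. indicator {0..min g v} t \<partial>lborel)"
    proof (rule nn_integral_cong_AE, use AE_lborel_singleton[of g] in eventually_elim)
      case (elim t) then show ?case by (auto split: split_indicator)
    qed
    also have "\<dots> = ennreal (min g v)" using elim v by (subst nn_integral_indicator) auto
    finally show ?case by simp
  qed
  also have "\<dots> = (\<integral>\<^sup>+ t. \<integral>\<^sup>+ g. indicator {0..v} t * indicator {t<..} g \<partial>gap_law \<partial>lborel)"
  proof -
    interpret pair_sigma_finite gap_law lborel ..
    show ?thesis
      by (rule Fubini'[symmetric]) (simp add: greaterThan_def indicator_def[abs_def] split_beta')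
  qed
  also have "\<dots> = (\<integral>\<^sup>+ t. ennreal (exp (- lam * t)) * indicator {0..v} t \<partial>lborel)"
  proof (rule nn_integral_cong)
    fix t :: real
    show "(\<integral>\<^sup>+ g. indicator {0..v} t * indicator {t<..} g \<partial>gap_law) = ennreal (exp (- lam * t)) * indicator {0..v} t"
    proof (cases "t \<in> {0..v}")
      case True then show ?thesis by (simp add: emeasure_gap_greater sets_gap_law)
    qed simp
  qed
  also have "\<dots> = ennreal (- exp (- lam * v) / lam - - exp (- lam * 0) / lam)"
    by (rule nn_integral_FTC_Icc) (use v lam in \<open>auto intro!: derivative_eq_intros\<close>)
  finally show ?thesis
    using lam v by (simp add: emeasure_gap_less divide_simps flip: ennreal_mult')
qed

end

section \<open>The mean hitting time\<close>

context onebit_model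
begin

lemma space_arrivals [simp]: "space arrivals = UNIV"
  by (simp add: space_PiM)

lemma emeasure_UNIV [simp]:
  "emeasure gap_law UNIV = 1" "emeasure mark_law UNIV = 1"
  "emeasure job_law UNIV = 1" "emeasure arrivals UNIV = 1"
  using gap.emeasure_space_1 mark.emeasure_space_1 job.emeasure_space_1 arr.P.emeasure_space_1
  unfolding space_laws space_arrivals .

lemma AE_mark_pos: "AE m in mark_law. 0 < fst m"
proof -
  have m: "(\<lambda>m :: real \<times> bool. fst m) \<in> borel_measurable mark_law" by measurable
  have s: "{m. fst m \<le> 0} \<in> sets mark_law"
    using measurable_sets[OF m, of "{..0}"] by (simp add: vimage_def)
  have "emeasure mark_law {m. fst m \<le> 0} = (\<integral>\<^sup>+ m. indicator {..0} (fst m) \<partial>mark_law)"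
    by (subst nn_integral_indicator[OF s, symmetric]) (auto intro!: nn_integral_cong split: split_indicator)
  also have "\<dots> = (\<integral>\<^sup>+ s. ennreal (f s) * indicator {..0} s \<partial>lborel)"
    by (rule nn_integral_size) simp
  also have "\<dots> = (\<integral>\<^sup>+ s. 0 \<partial>(lborel :: real measure))"
    by (intro nn_integral_cong) (auto simp: f_zero split: split_indicator)
  finally have "{m. fst m \<le> 0} \<in> null_sets mark_law" using s by (simp add: null_sets_def)
  then have "AE m in mark_law. m \<notin> {m. fst m \<le> 0}" by (rule AE_not_in)
  then show ?thesis by (auto simp: not_le)
qed

lemma AE_job_pos: "AE y in job_law. 0 < gap y \<and> 0 < service y"
proof -
  have "AE y in gap_law \<Otimes>\<^sub>M mark_law. 0 < fst y \<and> 0 < fst (snd y)"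
  proof (rule gap_mark.AE_pair_measure)
    show "{x \<in> space (gap_law \<Otimes>\<^sub>M mark_law). 0 < fst x \<and> 0 < fst (snd x)} \<in> sets (gap_law \<Otimes>\<^sub>M mark_law)"
      by measurable
    show "AE x in gap_law. AE y in mark_law. 0 < fst (x, y) \<and> 0 < fst (snd (x, y))"
      using AE_gap_pos AE_mark_pos by (auto elim!: AE_mp intro!: AE_I2)
  qed
  then show ?thesis unfolding job_law_def[symmetric] gap_def service_def .
qed

lemma job_component_measurable [measurable]: "(\<lambda>w. w k) \<in> arrivals \<rightarrow>\<^sub>M job_law"
  by (rule measurable_component_singleton) simp

text \<open>The Laplace transform of the gap at 1, equal to \<open>lam / (lam + 1)\<close>. A value
  below 1 is what excludes an accumulation of arrivals.\<close>

lemma nn_integral_exp_gap_less: "(\<integral>\<^sup>+ y. ennreal (exp (- gap y)) \<partial>job_law) < 1"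
proof -
  have "(\<integral>\<^sup>+ y. ennreal (exp (- gap y)) \<partial>job_law)
      = (\<integral>\<^sup>+ g. \<integral>\<^sup>+ m. ennreal (exp (- g)) \<partial>mark_law \<partial>gap_law)"
    by (subst nn_integral_job) (simp_all add: gap_def)
  also have "\<dots> = (\<integral>\<^sup>+ g. ennreal (exp (- g)) \<partial>gap_law)"
    by simp
  also have "\<dots> = (\<integral>\<^sup>+ g. ennreal (exponential_density lam g) * ennreal (exp (- g)) \<partial>lborel)"
    by (rule nn_integral_gap) simp
  also have "\<dots> = (\<integral>\<^sup>+ g. ennreal (lam * exp (- (lam + 1) * g)) * indicator {0..} g \<partial>lborel)"
    using lam by (intro nn_integral_cong)
      (auto simp: exponential_density_def ennreal_mult'[symmetric] mult_exp_exp algebra_simps split: split_indicator)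
  also have "\<dots> = ennreal (0 - - (lam / (lam + 1)) * exp (- (lam + 1) * 0))"
  proof (rule nn_integral_FTC_atLeast)
    show "((\<lambda>x. - (lam / (lam + 1)) * exp (- (lam + 1) * x)) \<longlongrightarrow> 0) at_top"
      using lam by real_asymp
    fix x
    show "((\<lambda>x. - (lam / (lam + 1)) * exp (- (lam + 1) * x)) has_real_derivative
          lam * exp (- (lam + 1) * x)) (at x)"
    proof -
      have "lam + 1 \<noteq> 0" using lam by simp
      moreover have "- (a / c) * (e * - c) = a * e" if "c \<noteq> 0" for a c e :: real
        using that by simp
      ultimately have "- (lam / (lam + 1)) * (exp (- (lam + 1) * x) * - (lam + 1)) = lam * exp (- (lam + 1) * x)"
        by blast
      moreover have "((\<lambda>x. - (lam / (lam + 1)) * exp (- (lam + 1) * x)) has_real_derivative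
          - (lam / (lam + 1)) * (exp (- (lam + 1) * x) * - (lam + 1))) (at x)"
        by (intro DERIV_cmult DERIV_fun_exp DERIV_cmult_Id)
      ultimately show ?thesis by (simp only:)
    qed
  qed (use lam in auto)
  also have "\<dots> < 1" using lam by (simp add: divide_simps ennreal_less_one_iff)
  finally show ?thesis .
qed

lemma nn_integral_exp_epoch:
  "(\<integral>\<^sup>+ w. ennreal (exp (- (\<Sum>k<K. gap (w k)))) \<partial>arrivals) = (\<integral>\<^sup>+ y. ennreal (exp (- gap y)) \<partial>job_law) ^ K"
proof (induction K)
  case 0 then show ?case by simp
next
  case (Suc K)
  have "(\<integral>\<^sup>+ w. ennreal (exp (- (\<Sum>k<Suc K. gap (w k)))) \<partial>arrivals)
      = (\<integral>\<^sup>+ y. \<integral>\<^sup>+ w. ennreal (exp (- gap y)) * ennreal (exp (- (\<Sum>k<K. gap (w k)))) \<partial>arrivals \<partial>job_law)"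
    by (subst nn_integral_arrivals_Suc)
       (simp_all add: sum.lessThan_Suc_shift mult_exp_exp del: sum.lessThan_Suc flip: ennreal_mult')
  also have "\<dots> = (\<integral>\<^sup>+ y. ennreal (exp (- gap y)) \<partial>job_law) ^ Suc K"
    by (subst nn_integral_cmult) (simp_all add: Suc nn_integral_multc)
  finally show ?case .
qed

text \<open>The exponential of minus the \<open>K\<close>-th partial sum of the gaps has mean
  \<open>a ^ K\<close> with \<open>a < 1\<close>, so the infimum \<open>I\<close> over all
  \<open>K\<close> has mean 0 and vanishes almost surely. Hence the partial sums are unbounded, and
  as the gaps are positive they tend to infinity.\<close>

lemma AE_valid_arrivals: "AE w in arrivals. valid_arrivals w"
proof -
  define a where "a = (\<integral>\<^sup>+ y. ennreal (exp (- gap y)) \<partial>job_law)"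
  define I where "I w = (INF K. ennreal (exp (- (\<Sum>k<K. gap (w k)))))" for w :: "nat \<Rightarrow> arrival"
  have I_meas [measurable]: "I \<in> borel_measurable arrivals"
    unfolding I_def[abs_def] by measurable
  have "(\<integral>\<^sup>+ w. I w \<partial>arrivals) \<le> a ^ K" for K
    unfolding a_def nn_integral_exp_epoch[symmetric] I_def
    by (intro nn_integral_mono INF_lower) simp
  moreover obtain r where r: "a = ennreal r" "0 \<le> r" "r < 1"
    using nn_integral_exp_gap_less unfolding a_def[symmetric]
    by (cases a) (auto simp: ennreal_less_one_iff)
  ultimately have "(\<integral>\<^sup>+ w. I w \<partial>arrivals) \<le> ennreal (r ^ K)" for K
    by (simp add: ennreal_power)
  moreover have "(\<lambda>K. ennreal (r ^ K)) \<longlonglongrightarrow> ennreal 0"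
    by (intro tendsto_ennrealI LIMSEQ_power_zero) (use r in auto)
  ultimately have "(\<integral>\<^sup>+ w. I w \<partial>arrivals) \<le> 0"
    by (intro LIMSEQ_le_const[of _ "0::ennreal"]) auto
  then have "AE w in arrivals. I w = 0"
    by (subst (asm) le_zero_eq) (simp add: nn_integral_0_iff_AE)
  moreover have "AE w in arrivals. \<forall>k. 0 < gap (w k) \<and> 0 < service (w k)"
    unfolding AE_all_countable using AE_job_pos by (intro allI AE_PiM_component) (auto intro: job.prob_space_axioms)
  ultimately show ?thesis
  proof eventually_elim
    case (elim w)
    have inc: "(\<Sum>k<K. gap (w k)) \<le> (\<Sum>k<L. gap (w k))" if "K \<le> L" for K L
      using that elim(2) by (intro sum_mono2) (auto intro: less_imp_le)
    have "filterlim (\<lambda>n. \<Sum>k\<le>n. fst (w k)) at_top sequentially"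
      unfolding filterlim_at_top
    proof
      fix Z :: real
      have "I w < ennreal (exp (- Z))" using elim(1) by simp
      then obtain K where "ennreal (exp (- (\<Sum>k<K. gap (w k)))) < ennreal (exp (- Z))"
        unfolding I_def by (auto simp: INF_less_iff)
      then have K: "Z < (\<Sum>k<K. gap (w k))" by (simp add: ennreal_less_iff)
      show "eventually (\<lambda>n. Z \<le> (\<Sum>k\<le>n. fst (w k))) sequentially"
        unfolding eventually_sequentially
      proof (intro exI[of _ K] allI impI)
        fix n assume "K \<le> n"
        then have "(\<Sum>k<K. gap (w k)) \<le> (\<Sum>k<Suc n. gap (w k))" by (intro inc) simp
        then show "Z \<le> (\<Sum>k\<le>n. fst (w k))" using K by (simp add: lessThan_Suc_atMost gap_def)
      qed
    qed
    then show ?case using elim(2) by (auto simp: valid_arrivals_def gap_def service_def)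
  qed
qed

section \<open>Joint measurability in the arrivals and the initial work\<close>

lemma shift_measurable:
  "g \<in> M \<rightarrow>\<^sub>M arrivals \<Longrightarrow> (\<lambda>x. shift (g x)) \<in> M \<rightarrow>\<^sub>M arrivals"
  by (rule measurable_PiM_single') (auto intro: measurable_compose[OF _ job_component_measurable])

lemma step_measurable [measurable (raw)]:
  assumes [measurable]: "y \<in> M \<rightarrow>\<^sub>M job_law" "v \<in> borel_measurable M"
  shows "(\<lambda>x. step (y x) (v x)) \<in> borel_measurable M"
  unfolding step_def by measurable

lemma component_measurable_raw:
  "g \<in> M \<rightarrow>\<^sub>M arrivals \<Longrightarrow> (\<lambda>x. g x k) \<in> M \<rightarrow>\<^sub>M job_law"
  by (rule measurable_compose[OF _ job_component_measurable])

text \<open>The initial work depends on the random state, so measurability is needed jointly; the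
  induction generalises \<open>w\<close> and \<open>v\<close> because \<open>step\<close> feeds the
  first arrival into the work.\<close>

lemma resid_measurable [measurable (raw)]:
  "w \<in> M \<rightarrow>\<^sub>M arrivals \<Longrightarrow> v \<in> borel_measurable M \<Longrightarrow> (\<lambda>x. resid K (w x) (v x)) \<in> borel_measurable M"
proof (induction K arbitrary: w v)
  case (Suc K)
  note [measurable] = Suc.prems component_measurable_raw[OF Suc.prems(1)] shift_measurable[OF Suc.prems(1)]
  show ?case unfolding resid.simps by (rule Suc.IH) measurable
qed simp

lemma elapsed_measurable [measurable (raw)]:
  "w \<in> M \<rightarrow>\<^sub>M arrivals \<Longrightarrow> v \<in> borel_measurable M \<Longrightarrow> (\<lambda>x. elapsed K (w x) (v x)) \<in> borel_measurable M"
proof (induction K arbitrary: w v)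
  case (Suc K)
  note [measurable] = Suc.prems component_measurable_raw[OF Suc.prems(1)] shift_measurable[OF Suc.prems(1)]
  have [measurable]: "(\<lambda>x. elapsed K (shift (w x)) (step (w x 0) (v x))) \<in> borel_measurable M"
    by (rule Suc.IH) measurable
  show ?case unfolding elapsed.simps by measurable
qed simp

lemma joined_measurable [measurable (raw)]:
  "w \<in> M \<rightarrow>\<^sub>M arrivals \<Longrightarrow> v \<in> borel_measurable M \<Longrightarrow> (\<lambda>x. joined K (w x) (v x)) \<in> borel_measurable M"
proof (induction K arbitrary: w v)
  case (Suc K)
  note [measurable] = Suc.prems component_measurable_raw[OF Suc.prems(1)] shift_measurable[OF Suc.prems(1)]
  have [measurable]: "(\<lambda>x. joined K (shift (w x)) (step (w x 0) (v x))) \<in> borel_measurable M"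
    by (rule Suc.IH) measurable
  show ?case unfolding joined.simps by measurable
qed simp

section \<open>Mean drift of the work ahead\<close>

lemma nn_integral_short_service:
  "ennreal lam * (\<integral>\<^sup>+ m. ennreal (short_service (g, m)) \<partial>mark_law) = load_new_ext lam f p"
proof -
  have "(\<integral>\<^sup>+ m. ennreal (short_service (g, m)) \<partial>mark_law)
    = (\<integral>\<^sup>+ m. ennreal (if snd m then fst m else 0) \<partial>mark_law)"
    by (simp only: short_service_def service_def fst_conv snd_conv)
  also have "\<dots> = (\<integral>\<^sup>+ s. ennreal (f s) * (ennreal (p s) * ennreal s) \<partial>lborel)"
    by (subst nn_integral_mark) simp_all
  also have "\<dots> = (\<integral>\<^sup>+ s\<in>{0<..}. ennreal (p s * s * f s) \<partial>lborel)"
  proof (rule nn_integral_cong)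
    fix s :: real
    show "ennreal (f s) * (ennreal (p s) * ennreal s) = ennreal (p s * s * f s) * indicator {0<..} s"
      using f_nonneg[of s] p_range[of s]
      by (cases "0 < s") (simp_all add: f_zero mult_ac flip: ennreal_mult)
  qed
  finally show ?thesis by (simp add: load_new_ext_def)
qed

lemma load_new_le_load: "load_new_ext lam f p \<le> load lam f"
  unfolding load_new_ext_def load_def
proof (intro mult_left_mono nn_integral_mono)
  fix s :: real
  show "ennreal (p s * s * f s) * indicator {0<..} s \<le> ennreal (s * f s) * indicator {0<..} s"
    using f_nonneg[of s] p_range[of s]
    by (auto split: split_indicator intro!: ennreal_leI mult_right_mono mult_left_le_one_le)
qed simp

text \<open>Short work joins on the event \<open>gap y < v\<close> and is independent of the gap;
  the Poisson identity \<open>nn_integral_min_gap\<close> expresses the probability of this event as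
  \<open>lam\<close> times the mean time worked. The equation is additive because subtraction is
  unreliable for possibly infinite terms.\<close>

lemma nn_integral_step:
  assumes v: "0 \<le> v"
  shows "(\<integral>\<^sup>+ y. ennreal (step y v) \<partial>job_law) + (\<integral>\<^sup>+ y. ennreal (min (gap y) v) \<partial>job_law)
    = ennreal v + load_new_ext lam f p * (\<integral>\<^sup>+ y. ennreal (min (gap y) v) \<partial>job_law)"
proof -
  have m: "(\<integral>\<^sup>+ y. ennreal (min (gap y) v) \<partial>job_law) = (\<integral>\<^sup>+ g. ennreal (min g v) \<partial>gap_law)"
    by (subst nn_integral_job) (simp_all add: gap_def)
  have "(\<integral>\<^sup>+ y. ennreal (step y v) \<partial>job_law) + (\<integral>\<^sup>+ y. ennreal (min (gap y) v) \<partial>job_law)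
     = (\<integral>\<^sup>+ y. ennreal (step y v) + ennreal (min (gap y) v) \<partial>job_law)"
    by (rule nn_integral_add[symmetric]) measurable
  also have "\<dots> = (\<integral>\<^sup>+ y. ennreal v + indicator {..<v} (gap y) * ennreal (short_service y) \<partial>job_law)"
  proof (rule nn_integral_cong_AE, use AE_job_pos in eventually_elim)
    case (elim y)
    then have "0 \<le> short_service y" by (simp add: short_service_def)
    then show ?case using v elim by (auto simp: step_def min_def simp flip: ennreal_plus)
  qed
  also have "\<dots> = ennreal v + (\<integral>\<^sup>+ y. indicator {..<v} (gap y) * ennreal (short_service y) \<partial>job_law)"
    by (subst nn_integral_add) simp_all
  also have "(\<integral>\<^sup>+ y. indicator {..<v} (gap y) * ennreal (short_service y) \<partial>job_law)
     = (\<integral>\<^sup>+ g. indicator {..<v} g * (\<integral>\<^sup>+ m. ennreal (short_service (g, m)) \<partial>mark_law) \<partial>gap_law)"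
  proof (subst nn_integral_job)
    have [measurable]: "(\<lambda>m. short_service (g, m)) \<in> borel_measurable mark_law" for g
      unfolding short_service_def service_def fst_conv snd_conv by measurable
    show "(\<integral>\<^sup>+ g. \<integral>\<^sup>+ m. indicator {..<v} (gap (g, m)) * ennreal (short_service (g, m)) \<partial>mark_law \<partial>gap_law)
      = (\<integral>\<^sup>+ g. indicator {..<v} g * (\<integral>\<^sup>+ m. ennreal (short_service (g, m)) \<partial>mark_law) \<partial>gap_law)"
      unfolding gap_def fst_conv by (intro nn_integral_cong nn_integral_cmult) measurable
  qed measurable
  also have "\<dots> = (\<integral>\<^sup>+ g. indicator {..<v} g * (\<integral>\<^sup>+ m. ennreal (short_service (0, m)) \<partial>mark_law) \<partial>gap_law)"
    by (simp only: short_service_def service_def fst_conv snd_conv)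
  also have "\<dots> = emeasure gap_law {..<v} * (\<integral>\<^sup>+ m. ennreal (short_service (0, m)) \<partial>mark_law)"
    by (subst nn_integral_multc) (simp_all add: sets_gap_law)
  also have "\<dots> = load_new_ext lam f p * (\<integral>\<^sup>+ g. ennreal (min g v) \<partial>gap_law)"
    unfolding nn_integral_min_gap[OF v, symmetric] nn_integral_short_service[of 0, symmetric]
    by (simp add: ac_simps)
  finally show ?thesis by (simp add: m)
qed

definition mean_resid :: "nat \<Rightarrow> real \<Rightarrow> ennreal" where
  "mean_resid K v = (\<integral>\<^sup>+ w. ennreal (resid K w v) \<partial>arrivals)"

definition mean_elapsed :: "nat \<Rightarrow> real \<Rightarrow> ennreal" where
  "mean_elapsed K v = (\<integral>\<^sup>+ w. ennreal (elapsed K w v) \<partial>arrivals)"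

definition mean_min_gap :: "real \<Rightarrow> ennreal" where
  "mean_min_gap v = (\<integral>\<^sup>+ y. ennreal (min (gap y) v) \<partial>job_law)"

lemma mean_elapsed_measurable [measurable]: "mean_elapsed K \<in> borel_measurable borel"
  unfolding mean_elapsed_def[abs_def] by (rule arr.P.borel_measurable_nn_integral) measurable

lemma mean_resid_measurable [measurable]: "mean_resid K \<in> borel_measurable borel"
  unfolding mean_resid_def[abs_def] by (rule arr.P.borel_measurable_nn_integral) measurable

lemma AE_step_nonneg: "AE y in job_law. 0 \<le> step y v"
  using AE_job_pos by eventually_elim (simp add: step_def short_service_def)

lemma mean_resid_Suc: "mean_resid (Suc K) v = (\<integral>\<^sup>+ y. mean_resid K (step y v) \<partial>job_law)"
proof -
  have "(\<lambda>w. ennreal (resid (Suc K) w v)) \<in> borel_measurable arrivals" by measurable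
  from nn_integral_arrivals_Suc[OF this] show ?thesis by (simp add: mean_resid_def)
qed

lemma mean_elapsed_Suc:
  assumes v: "0 \<le> v"
  shows "mean_elapsed (Suc K) v = mean_min_gap v + (\<integral>\<^sup>+ y. mean_elapsed K (step y v) \<partial>job_law)"
proof -
  have "mean_elapsed (Suc K) v =
    (\<integral>\<^sup>+ y. \<integral>\<^sup>+ w. ennreal (min (gap y) v + elapsed K w (step y v)) \<partial>arrivals \<partial>job_law)"
  proof -
    have "(\<lambda>w. ennreal (elapsed (Suc K) w v)) \<in> borel_measurable arrivals" by measurable
    from nn_integral_arrivals_Suc[OF this] show ?thesis by (simp add: mean_elapsed_def)
  qed
  also have "\<dots> = (\<integral>\<^sup>+ y. ennreal (min (gap y) v) + mean_elapsed K (step y v) \<partial>job_law)"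
  proof (rule nn_integral_cong_AE, use AE_step_nonneg[of v] AE_job_pos in eventually_elim)
    case (elim y)
    have "(\<integral>\<^sup>+ w. ennreal (min (gap y) v + elapsed K w (step y v)) \<partial>arrivals)
      = (\<integral>\<^sup>+ w. ennreal (min (gap y) v) + ennreal (elapsed K w (step y v)) \<partial>arrivals)"
    proof (rule nn_integral_cong_AE, use AE_valid_arrivals in eventually_elim)
      case (elim w)
      from elapsed_nonneg[OF elim, of "step y v" K] v \<open>0 \<le> step y v\<close> \<open>0 < gap y \<and> 0 < service y\<close>
      show ?case by (intro ennreal_plus) auto
    qed
    also have "\<dots> = ennreal (min (gap y) v) + mean_elapsed K (step y v)"
      unfolding mean_elapsed_def by (subst nn_integral_add) simp_all
    finally show ?case .
  qed
  also have "\<dots> = mean_min_gap v + (\<integral>\<^sup>+ y. mean_elapsed K (step y v) \<partial>job_law)"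
    unfolding mean_min_gap_def by (rule nn_integral_add) measurable
  finally show ?thesis .
qed

text \<open>A Wald identity for the walk stopped on exhaustion or after \<open>K\<close> arrivals:
  short work joins at mean rate \<open>load_new_ext lam f p\<close> per unit of time worked. The
  induction hypothesis is applied after the first arrival, from \<open>step y v\<close>, and the
  drift of one step is added.\<close>

lemma mean_balance:
  assumes "0 \<le> v"
  shows "mean_resid K v + mean_elapsed K v = ennreal v + load_new_ext lam f p * mean_elapsed K v"
  using assms
proof (induction K arbitrary: v)
  case 0 then show ?case by (simp add: mean_resid_def mean_elapsed_def)
next
  case (Suc K)
  let ?r = "load_new_ext lam f p"
  let ?E = "\<integral>\<^sup>+ y. mean_elapsed K (step y v) \<partial>job_law"
  have "(\<integral>\<^sup>+ y. mean_resid K (step y v) \<partial>job_law) + ?E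
     = (\<integral>\<^sup>+ y. mean_resid K (step y v) + mean_elapsed K (step y v) \<partial>job_law)"
    by (rule nn_integral_add[symmetric]) measurable
  also have "\<dots> = (\<integral>\<^sup>+ y. ennreal (step y v) + ?r * mean_elapsed K (step y v) \<partial>job_law)"
    by (rule nn_integral_cong_AE, use AE_step_nonneg[of v] in eventually_elim) (rule Suc.IH)
  also have "\<dots> = (\<integral>\<^sup>+ y. ennreal (step y v) \<partial>job_law) + ?r * ?E"
    by (subst nn_integral_add) (simp_all add: nn_integral_cmult)
  finally have *: "(\<integral>\<^sup>+ y. mean_resid K (step y v) \<partial>job_law) + ?E = (\<integral>\<^sup>+ y. ennreal (step y v) \<partial>job_law) + ?r * ?E" .
  have "mean_resid (Suc K) v + mean_elapsed (Suc K) v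
      = ((\<integral>\<^sup>+ y. mean_resid K (step y v) \<partial>job_law) + ?E) + mean_min_gap v"
    by (simp add: mean_resid_Suc mean_elapsed_Suc[OF Suc.prems] ac_simps)
  also have "\<dots> = ((\<integral>\<^sup>+ y. ennreal (step y v) \<partial>job_law) + mean_min_gap v) + ?r * ?E"
    unfolding * by (simp add: ac_simps)
  also have "\<dots> = ennreal v + ?r * mean_min_gap v + ?r * ?E"
    unfolding mean_min_gap_def nn_integral_step[OF Suc.prems] ..
  also have "\<dots> = ennreal v + ?r * mean_elapsed (Suc K) v"
    by (simp add: mean_elapsed_Suc[OF Suc.prems] distrib_left ac_simps)
  finally show ?case .
qed

text \<open>The balance gives no bound as long as the mean might be infinite, so the bound is proved
  on its own. The function \<open>v / (1 - r)\<close> solves the one-step equation exactly: with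
  \<open>a' = v - (1 - r) * m\<close>, the sum \<open>m + a' / (1 - r)\<close> is again
  \<open>v / (1 - r)\<close>.\<close>

lemma mean_elapsed_le:
  assumes r: "load_new_ext lam f p = ennreal r" "0 \<le> r" "r < 1" and v: "0 \<le> v"
  shows "mean_elapsed K v \<le> ennreal (v / (1 - r))"
  using v
proof (induction K arbitrary: v)
  case 0 then show ?case by (simp add: mean_elapsed_def)
next
  case (Suc K)
  define a where "a = (\<integral>\<^sup>+ y. ennreal (step y v) \<partial>job_law)"
  have bal: "a + mean_min_gap v = ennreal v + ennreal r * mean_min_gap v"
    using nn_integral_step[OF Suc.prems] r by (simp add: a_def mean_min_gap_def)
  have "mean_min_gap v \<le> (\<integral>\<^sup>+ y. ennreal v \<partial>job_law)"
    unfolding mean_min_gap_def by (intro nn_integral_mono ennreal_leI) simp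
  then have "mean_min_gap v \<noteq> top" by (auto simp: top_unique)
  then obtain m where m: "mean_min_gap v = ennreal m" "0 \<le> m" by (cases "mean_min_gap v") auto
  have bal': "a + ennreal m = ennreal (v + r * m)"
    using bal r m Suc.prems by (simp add: ennreal_mult)
  then have "a \<noteq> top" by (metis ennreal_add_eq_top ennreal_neq_top)
  then obtain a' where a': "a = ennreal a'" "0 \<le> a'" by (cases a) auto
  have eq: "a' + m = v + r * m"
    using bal' a' m r Suc.prems by (subst (asm) a'(1)) (simp flip: ennreal_plus)
  have "mean_elapsed (Suc K) v = mean_min_gap v + (\<integral>\<^sup>+ y. mean_elapsed K (step y v) \<partial>job_law)"
    by (rule mean_elapsed_Suc[OF Suc.prems])
  also have "(\<integral>\<^sup>+ y. mean_elapsed K (step y v) \<partial>job_law) \<le> (\<integral>\<^sup>+ y. ennreal (1 / (1 - r)) * ennreal (step y v) \<partial>job_law)"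
  proof (rule nn_integral_mono_AE, use AE_step_nonneg[of v] in eventually_elim)
    case (elim y)
    from Suc.IH[OF elim] elim r show ?case by (simp flip: ennreal_mult)
  qed
  also have "\<dots> = ennreal (1 / (1 - r)) * a"
    unfolding a_def by (rule nn_integral_cmult) measurable
  also have "mean_min_gap v + ennreal (1 / (1 - r)) * a = ennreal (m + 1 / (1 - r) * a')"
  proof -
    have "ennreal (1 / (1 - r)) * ennreal a' = ennreal (1 / (1 - r) * a')"
      using a'(2) r by (intro ennreal_mult[symmetric]) auto
    then show ?thesis unfolding m(1) a'(1) using m(2) a'(2) r by (simp flip: ennreal_plus)
  qed
  also have "m + 1 / (1 - r) * a' = v / (1 - r)"
  proof -
    have "a' = v - (1 - r) * m" using eq by (simp add: algebra_simps)
    then show ?thesis using r by (simp add: field_simps)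
  qed
  finally show ?case by (simp add: add_left_mono)
qed

text \<open>Means are taken in \<open>resid_balance\<close> and compared with
  \<open>mean_balance\<close>; the finite term \<open>v\<close> cancels. The result controls the
  work that joins, which later serves as a dominating function.\<close>

lemma mean_joined:
  assumes r: "load_new_ext lam f p = ennreal r" "0 \<le> r" "r < 1" and v: "0 \<le> v"
  shows "(\<integral>\<^sup>+ w. ennreal (joined K w v) \<partial>arrivals) = ennreal r * mean_elapsed K v"
proof -
  have "ennreal v + (\<integral>\<^sup>+ w. ennreal (joined K w v) \<partial>arrivals) = (\<integral>\<^sup>+ w. ennreal v + ennreal (joined K w v) \<partial>arrivals)"
    by (subst nn_integral_add) simp_all
  also have "\<dots> = (\<integral>\<^sup>+ w. ennreal (resid K w v) + ennreal (elapsed K w v) \<partial>arrivals)"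
  proof (rule nn_integral_cong_AE, use AE_valid_arrivals in eventually_elim)
    case (elim w)
    show ?case
      using resid_balance[of K w v] resid_nonneg[OF elim v, of K] elapsed_nonneg[OF elim v, of K]
        joined_nonneg[OF elim, of K v] v by (simp flip: ennreal_plus)
  qed
  also have "\<dots> = mean_resid K v + mean_elapsed K v"
    unfolding mean_resid_def mean_elapsed_def by (rule nn_integral_add) measurable
  also have "\<dots> = ennreal v + ennreal r * mean_elapsed K v"
    using mean_balance[OF v] r by simp
  finally show ?thesis by (simp add: ennreal_add_left_cancel)
qed

lemma hit_integral_eq_SUP:
  assumes v: "0 \<le> v"
  shows "(\<integral>\<^sup>+ w. hit v w \<partial>arrivals) = (SUP K. mean_elapsed K v)"
proof -
  have "(\<integral>\<^sup>+ w. hit v w \<partial>arrivals) = (\<integral>\<^sup>+ w. (SUP K. ennreal (elapsed K w v)) \<partial>arrivals)"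
    by (rule nn_integral_cong_AE, use AE_valid_arrivals in eventually_elim)
       (rule hit_eq_SUP_elapsed[OF _ v])
  also have "\<dots> = (SUP K. mean_elapsed K v)"
    unfolding mean_elapsed_def
  proof (rule nn_integral_monotone_convergence_SUP_AE)
    fix K show "AE w in arrivals. ennreal (elapsed K w v) \<le> ennreal (elapsed (Suc K) w v)"
      using AE_valid_arrivals
      by eventually_elim (intro ennreal_leI monoD[OF elapsed_mono[OF _ v]], simp_all)
  qed measurable
  finally show ?thesis .
qed

text \<open>The hitting time has a finite mean and is thus finite almost surely, so the residual
  work is 0 from some \<open>K\<close> on. It is dominated by \<open>v\<close> plus all short work
  that ever joins, whose mean is finite by monotone convergence. This shows that no work escapes
  from the balance in the limit.\<close>

lemma mean_resid_tendsto_0: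
  assumes r: "load_new_ext lam f p = ennreal r" "0 \<le> r" "r < 1" and v: "0 \<le> v"
  shows "(\<lambda>K. mean_resid K v) \<longlonglongrightarrow> 0"
proof -
  let ?J = "\<lambda>w. SUP K. ennreal (joined K w v)"
  have J: "(\<integral>\<^sup>+ w. ?J w \<partial>arrivals) = (SUP K. \<integral>\<^sup>+ w. ennreal (joined K w v) \<partial>arrivals)"
  proof (rule nn_integral_monotone_convergence_SUP_AE)
    fix K show "AE w in arrivals. ennreal (joined K w v) \<le> ennreal (joined (Suc K) w v)"
      using AE_valid_arrivals
      by eventually_elim (intro ennreal_leI monoD[OF joined_mono], simp_all)
  qed measurable
  also have "\<dots> \<le> ennreal r * ennreal (v / (1 - r))"
    by (intro SUP_least) (simp only: mean_joined[OF r v], intro mult_left_mono mean_elapsed_le[OF r v], simp)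
  finally have Jfin: "(\<integral>\<^sup>+ w. ?J w \<partial>arrivals) < top"
    by (rule le_less_trans) (simp add: ennreal_mult_less_top)
  have "(SUP K. mean_elapsed K v) \<le> ennreal (v / (1 - r))"
    by (intro SUP_least mean_elapsed_le[OF r v])
  then have "(\<integral>\<^sup>+ w. hit v w \<partial>arrivals) \<le> ennreal (v / (1 - r))"
    unfolding hit_integral_eq_SUP[OF v] .
  moreover have "(\<integral>\<^sup>+ w. hit v w \<partial>arrivals) = (\<integral>\<^sup>+ w. (SUP K. ennreal (elapsed K w v)) \<partial>arrivals)"
    by (rule nn_integral_cong_AE, use AE_valid_arrivals in eventually_elim)
       (rule hit_eq_SUP_elapsed[OF _ v])
  ultimately have "(\<integral>\<^sup>+ w. (SUP K. ennreal (elapsed K w v)) \<partial>arrivals) \<noteq> \<infinity>"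
    by (auto simp: top_unique)
  then have "AE w in arrivals. (SUP K. ennreal (elapsed K w v)) \<noteq> \<infinity>"
    by (intro nn_integral_PInf_AE) measurable
  then have lim: "AE w in arrivals. (\<lambda>K. ennreal (resid K w v)) \<longlonglongrightarrow> 0"
    using AE_valid_arrivals
  proof eventually_elim
    case (elim w)
    then obtain K where K: "resid K w v = 0"
      using alive_elapsed_unbounded[OF elim(2), of v] by auto
    have "eventually (\<lambda>L. ennreal (resid L w v) = 0) sequentially"
      unfolding eventually_sequentially
      by (intro exI[of _ K] allI impI) (simp add: resid_0_stays(1)[OF elim(2) K])
    then show ?case by (rule tendsto_eventually)
  qed
  have dom: "AE w in arrivals. ennreal (resid K w v) \<le> ennreal v + ?J w" for K
    using AE_valid_arrivals
  proof eventually_elim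
    case (elim w)
    have "resid K w v \<le> v + joined K w v"
      using resid_balance[of K w v] elapsed_nonneg[OF elim v, of K] by simp
    then have "ennreal (resid K w v) \<le> ennreal v + ennreal (joined K w v)"
      using v joined_nonneg[OF elim, of K v] by (simp add: ennreal_leI flip: ennreal_plus)
    also have "\<dots> \<le> ennreal v + ?J w" by (intro add_left_mono SUP_upper) simp
    finally show ?case .
  qed
  have "(\<lambda>K. \<integral>\<^sup>+ w. ennreal (resid K w v) \<partial>arrivals) \<longlonglongrightarrow> (\<integral>\<^sup>+ w. 0 \<partial>arrivals)"
  proof (rule nn_integral_dominated_convergence[where w = "\<lambda>w. ennreal v + ?J w"])
    show "(\<integral>\<^sup>+ w. ennreal v + ?J w \<partial>arrivals) < \<infinity>"
      using Jfin by (subst nn_integral_add) simp_all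
  qed (use lim dom in auto)
  then show ?thesis by (simp add: mean_resid_def)
qed

lemma nn_integral_hit:
  assumes load: "load_new_ext lam f p < 1" and v: "0 \<le> v"
  shows "(\<integral>\<^sup>+ w. hit v w \<partial>arrivals) = ennreal v / (1 - load_new_ext lam f p)"
proof -
  obtain r where r: "load_new_ext lam f p = ennreal r" "0 \<le> r" "r < 1"
    using load by (cases "load_new_ext lam f p") (auto simp: ennreal_less_one_iff)
  let ?M = "SUP K. mean_elapsed K v"
  have inc: "incseq (\<lambda>K. mean_elapsed K v)"
    unfolding mean_elapsed_def
  proof (intro incseq_SucI nn_integral_mono_AE)
    fix K show "AE w in arrivals. ennreal (elapsed K w v) \<le> ennreal (elapsed (Suc K) w v)"
      using AE_valid_arrivals
      by eventually_elim (intro ennreal_leI monoD[OF elapsed_mono[OF _ v]], simp_all)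
  qed
  have L: "(\<lambda>K. mean_elapsed K v) \<longlonglongrightarrow> ?M" by (rule LIMSEQ_SUP[OF inc])
  have "(\<lambda>K. mean_resid K v + mean_elapsed K v) \<longlonglongrightarrow> 0 + ?M"
    by (intro tendsto_add L mean_resid_tendsto_0[OF r v])
  moreover have "(\<lambda>K. ennreal v + ennreal r * mean_elapsed K v) \<longlonglongrightarrow> ennreal v + ennreal r * ?M"
    by (intro tendsto_add tendsto_const ennreal_tendsto_cmult L) simp
  ultimately have eq: "?M = ennreal v + ennreal r * ?M"
    using mean_balance[OF v] r by (simp add: LIMSEQ_unique)
  \<comment> \<open>The equation for \<open>?M\<close> is also satisfied by \<open>top\<close>; the
    bound uniform in \<open>K\<close> excludes that.\<close>
  have "?M \<le> ennreal (v / (1 - r))" by (intro SUP_least mean_elapsed_le[OF r v])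
  then have "?M \<noteq> top" by (rule neq_top_trans[OF ennreal_neq_top])
  then obtain M where M: "?M = ennreal M" "0 \<le> M" by (cases ?M) auto
  have "M = v + r * M" using eq r v M(2) unfolding M(1) by (simp flip: ennreal_mult ennreal_plus)
  then have "M = v / (1 - r)" using r by (simp add: field_simps)
  moreover have "ennreal v / (1 - ennreal r) = ennreal (v / (1 - r))"
    using r v ennreal_minus[of r 1] by (simp add: divide_ennreal)
  ultimately show ?thesis using M r by (simp add: hit_integral_eq_SUP[OF v])
qed

end

section \<open>The workload\<close>

lemma workload_map_sorted:
  assumes "finite A"
  shows "workload (map (\<lambda>i. (b i, s i, a i)) (sorted_list_of_set A)) = (\<Sum>i\<in>A. s i - a i)"
  using assms by (simp add: workload_def comp_def flip: sum_list_distinct_conv_sum_set sum.distinct_set_conv_list)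

context onebit_path
begin

text \<open>The schedule enters the workload only through the total service of the jobs that have
  arrived; finished jobs contribute 0, as their age equals their size.\<close>

lemma workload_state_at:
  assumes A: "A q w = age" and t: "0 \<le> t"
  shows "workload (state_at A t q w) =
    workload q + (\<Sum>k | epoch w k \<le> t. service (w k)) - attained {i. arr i \<le> t} t"
proof -
  have "workload (state_at A t q w) = (\<Sum>i | pres t i. sz i - age i t)"
    unfolding state_at_def A by (rule workload_map_sorted[OF finite_pres])
  also have "\<dots> = (\<Sum>i | arr i \<le> t. sz i - age i t)"
  proof (rule sum.mono_neutral_left[OF finite_arr])
    show "\<forall>i\<in>{i. arr i \<le> t} - {i. pres t i}. sz i - age i t = 0"
      using age_le_size[OF t] by (force simp: present_def intro: antisym)
  qed (auto simp: present_def)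
  also have "\<dots> = (\<Sum>i | arr i \<le> t. sz i - ini i) - attained {i. arr i \<le> t} t"
    unfolding attained_def sum_subtractf[symmetric] by simp
  also have "(\<Sum>i | arr i \<le> t. sz i - ini i) = (\<Sum>i<n. sz i - ini i) + (\<Sum>i | n \<le> i \<and> arr i \<le> t. sz i - ini i)"
  proof (subst sum.union_disjoint[symmetric])
    show "finite {i. n \<le> i \<and> arr i \<le> t}" by (rule finite_subset[OF _ finite_arr[of t]]) auto
    show "sum (\<lambda>i. sz i - ini i) {i. arr i \<le> t} = sum (\<lambda>i. sz i - ini i) ({..<n} \<union> {i. n \<le> i \<and> arr i \<le> t})"
      using t arr_old by (intro sum.cong) (auto simp: not_less)
  qed auto
  also have "(\<Sum>i<n. sz i - ini i) = workload q" by (rule workload_eq_sum[symmetric])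
  also have "(\<Sum>i | n \<le> i \<and> arr i \<le> t. sz i - ini i) = (\<Sum>k | epoch w k \<le> t. service (w k))"
    by (rule sum.reindex_bij_witness[where i = "\<lambda>k. k + n" and j = "\<lambda>i. i - n"])
       (auto simp: arr_new ini_new job_size_def service_def)
  finally show ?thesis .
qed

text \<open>Either all initial jobs are finished at \<open>t\<close>, or one is unfinished, was
  present all along and kept the server busy with initial jobs.\<close>

lemma attained_no_arrivals:
  assumes t: "0 \<le> t" "t < gap (w 0)"
  shows "attained {i. arr i \<le> t} t = min t (workload q)"
proof -
  have no: "\<not> epoch w k \<le> t" for k
    using epoch_mono[OF valid_w, of 0 k] t by (simp add: epoch_def)
  then have F: "{i. arr i \<le> t} = {..<n}"
    using t arr_old arr_new by (auto simp: not_less) (metis linorder_not_le)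
  have le: "attained {..<n} t \<le> workload q"
    unfolding attained_def workload_eq_sum[of q w] by (intro sum_mono diff_right_mono age_le_size t)
  show ?thesis
  proof (cases "\<forall>i<n. sz i \<le> age i t")
    case True
    then have "workload q \<le> attained {..<n} t"
      unfolding attained_def workload_eq_sum[of q w] by (intro sum_mono diff_right_mono) simp
    then have "attained {..<n} t = workload q" using le by simp
    then show ?thesis using attained_le[of "{..<n}" t] t F by (simp add: min_def)
  next
    case False
    then obtain i where i: "i < n" "age i t < sz i" by (auto simp: not_le)
    have "attained {..<n} t = t"
    proof (rule attained_busy)
      fix u assume u: "0 \<le> u" "u < t"
      have "pres u i" using i u age_mono[of u t i] by (simp add: present_def arr_old)
      then obtain k where k: "srv u k" using srv_exists by blast
      then have "k \<in> {i. arr i \<le> t}" using srv_present[OF k] u by simp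
      with k show "\<exists>i\<in>{..<n}. srv u i" unfolding F by blast
    qed (use t in auto)
    then show ?thesis using le F by (simp add: min_def)
  qed
qed

end

lemma workload_state_at_no_arrivals:
  assumes "onebit_policy A" "valid_state q" "valid_arrivals w" "0 \<le> t" "t < gap (w 0)"
  shows "workload (state_at A t q w) = max (workload q - t) 0"
proof -
  interpret onebit_path q w "A q w"
    using assms by unfold_locales (auto simp: onebit_policy_def)
  have no: "\<not> epoch w k \<le> t" for k
    using epoch_mono[OF valid_w, of 0 k] assms(5) by (simp add: epoch_def)
  show ?thesis
    using workload_state_at[of A t, OF refl assms(4)] attained_no_arrivals[OF assms(4,5)] no by simp
qed

text \<open>The crude error \<open>t\<close> is enough, because an arrival up to time
  \<open>t\<close> already has a probability of order \<open>t\<close>. The second arrival is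
  excluded through its own gap rather than its epoch, so that the exceptional event is an
  intersection of independent ones.\<close>

lemma workload_state_at_one_arrival:
  assumes "onebit_policy A" "valid_state q" "valid_arrivals w" "0 \<le> t"
    and g: "gap (w 0) \<le> t" "t < gap (w 1)"
  shows "\<bar>workload (state_at A t q w) - (workload q + service (w 0))\<bar> \<le> t"
proof -
  interpret onebit_path q w "A q w"
    using assms by unfold_locales (auto simp: onebit_policy_def)
  have "t < epoch w 1" using g valid_arrivals_gap[OF valid_w, of 0] by (simp add: epoch_def)
  then have "t < epoch w k" if "k \<noteq> 0" for k
    using epoch_mono[OF valid_w, of 1 k] that by simp
  then have "{k. epoch w k \<le> t} = {0}" using g(1) by (force simp: epoch_def)
  moreover have "0 \<le> attained {i. arr i \<le> t} t" "attained {i. arr i \<le> t} t \<le> t"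
    using attained_nonneg[OF assms(4)] attained_le[OF finite_arr assms(4)] by auto
  ultimately show ?thesis
    using workload_state_at[of A t, OF refl assms(4)] by simp
qed

lemma workload_state_at_nonneg:
  assumes "onebit_policy A" "valid_state q" "valid_arrivals w" "0 \<le> t"
  shows "0 \<le> workload (state_at A t q w)"
proof -
  interpret onebit_path q w "A q w"
    using assms by unfold_locales (auto simp: onebit_policy_def)
  show ?thesis
    unfolding state_at_def workload_map_sorted[OF finite_pres]
    by (intro sum_nonneg) (auto simp: present_def)
qed

section \<open>Measurability of the workload on the state space\<close>

lemma space_state_space [simp]: "space state_space = UNIV"
  by (simp add: state_space_def space_measure_of_conv)

lemma length_measurable [measurable]: "length \<in> state_space \<rightarrow>\<^sub>M count_space UNIV"
proof (rule measurableI)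
  fix B :: "nat set"
  have "{q. length q = m} \<in> sets state_space" for m
    unfolding state_space_def
    by (rule in_measure_of) (auto intro!: exI[of _ m] exI[of _ "\<lambda>_. UNIV"] sets.top[where M = "count_space UNIV \<Otimes>\<^sub>M borel \<Otimes>\<^sub>M borel", unfolded space_pair_measure, simplified])
  then have "(\<Union>m\<in>B. {q. length q = m}) \<in> sets state_space" by (intro sets.countable_UN') auto
  also have "(\<Union>m\<in>B. {q. length q = m}) = length -` B \<inter> space state_space" by auto
  finally show "length -` B \<inter> space state_space \<in> sets state_space" .
qed simp

text \<open>The default job for short lists makes the coordinate a total map; preimages are
  assembled from generating cylinders by a countable union over the length of the list.\<close>

lemma nth_measurable:
  "(\<lambda>q. if i < length q then q ! i else (False, 0, 0)) \<in>
     state_space \<rightarrow>\<^sub>M count_space UNIV \<Otimes>\<^sub>M borel \<Otimes>\<^sub>M borel"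
proof (rule measurableI)
  fix B :: "job set" assume B: "B \<in> sets (count_space UNIV \<Otimes>\<^sub>M borel \<Otimes>\<^sub>M borel)"
  have top: "UNIV \<in> sets (count_space (UNIV :: bool set) \<Otimes>\<^sub>M (borel :: real measure) \<Otimes>\<^sub>M (borel :: real measure))"
    using sets.top[of "count_space (UNIV :: bool set) \<Otimes>\<^sub>M (borel :: real measure) \<Otimes>\<^sub>M (borel :: real measure)"]
    by (simp add: space_pair_measure)
  have cyl: "{q. length q = m \<and> q ! i \<in> B} \<in> sets state_space" if "i < m" for m
    unfolding state_space_def
  proof (rule in_measure_of)
    show "{q. length q = m \<and> q ! i \<in> B} \<in>
      {{q. length q = n \<and> (\<forall>i<n. q ! i \<in> A i)} |n A.
        \<forall>i. A i \<in> sets (count_space UNIV \<Otimes>\<^sub>M borel \<Otimes>\<^sub>M borel)}"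
      by (intro CollectI exI[of _ m] exI[of _ "\<lambda>j. if j = i then B else UNIV"]) (use that B top in auto)
  qed simp
  have [measurable]: "{q. i < length q \<and> q ! i \<in> B} \<in> sets state_space"
  proof -
    have "(\<Union>m\<in>{i<..}. {q. length q = m \<and> q ! i \<in> B}) \<in> sets state_space"
      using cyl by (intro sets.countable_UN') auto
    also have "(\<Union>m\<in>{i<..}. {q. length q = m \<and> q ! i \<in> B}) = {q. i < length q \<and> q ! i \<in> B}" by auto
    finally show ?thesis .
  qed
  have "{q \<in> space state_space. q \<in> {q. i < length q \<and> q ! i \<in> B} \<or> (\<not> i < length q \<and> (False, 0, 0) \<in> B)}
      \<in> sets state_space" by measurable
  also have "{q \<in> space state_space. q \<in> {q. i < length q \<and> q ! i \<in> B} \<or> (\<not> i < length q \<and> (False, 0, 0) \<in> B)}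
    = (\<lambda>q. if i < length q then q ! i else (False, 0, 0)) -` B \<inter> space state_space" by (rule set_eqI) simp
  finally show "(\<lambda>q. if i < length q then q ! i else (False, 0, 0)) -` B \<inter> space state_space \<in> sets state_space" .
qed (simp add: space_pair_measure)

lemma workload_measurable [measurable]: "workload \<in> borel_measurable state_space"
proof -
  define c where "c i q = (case if i < length q then q ! i else (False, 0, 0) of (b, s, a) \<Rightarrow> s - a)"
    for i and q :: state
  have [measurable]: "c i \<in> borel_measurable state_space" for i
    unfolding c_def by (rule measurable_compose[OF nth_measurable]) measurable
  have "(\<lambda>q. \<Sum>i<length q. c i q) \<in> borel_measurable state_space"
    by (rule measurable_compose_countable[where f = "\<lambda>m q. \<Sum>i<m. c i q"]) measurable
  also have "(\<lambda>q. \<Sum>i<length q. c i q) = workload"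
    by (auto simp: workload_def sum_list_sum_nth c_def lessThan_atLeast0 split_beta intro!: ext sum.cong)
  finally show ?thesis .
qed

section \<open>The stationary workload\<close>

locale onebit_stationary = onebit_model +
  fixes age :: "state \<Rightarrow> (nat \<Rightarrow> arrival) \<Rightarrow> nat \<Rightarrow> real \<Rightarrow> real" and \<pi> :: "state measure"
  assumes policy: "onebit_policy age" and stat: "stationary lam f p age \<pi>"
begin

lemma pi_prob: "prob_space \<pi>"
  and sets_pi [measurable_cong]: "sets \<pi> = sets state_space"
  and AE_pi_valid: "AE q in \<pi>. valid_state q"
  and state_at_measurable: "0 \<le> t \<Longrightarrow>
    case_prod (state_at age t) \<in> completion (\<pi> \<Otimes>\<^sub>M arrivals) \<rightarrow>\<^sub>M state_space"
  and state_at_distr: "0 \<le> t \<Longrightarrow>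
    distr (completion (\<pi> \<Otimes>\<^sub>M arrivals)) state_space (case_prod (state_at age t)) = \<pi>"
  using stat unfolding stationary_def arrival_law_eq by auto

sublocale pi: prob_space \<pi> by (rule pi_prob)

sublocale joint: pair_prob_space \<pi> arrivals ..

lemma space_pi [simp]: "space \<pi> = UNIV"
  using sets_eq_imp_space_eq[OF sets_pi] by simp

lemma AE_joint_valid: "AE (q, w) in \<pi> \<Otimes>\<^sub>M arrivals. valid_state q \<and> valid_arrivals w"
proof -
  have "AE z in \<pi> \<Otimes>\<^sub>M arrivals. valid_state (fst z)"
  proof (rule AE_distrD[OF measurable_fst])
    have "distr (\<pi> \<Otimes>\<^sub>M arrivals) \<pi> fst = \<pi>"
    proof (rule measure_eqI)
      fix B assume B: "B \<in> sets (distr (\<pi> \<Otimes>\<^sub>M arrivals) \<pi> fst)"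
      then have "emeasure (distr (\<pi> \<Otimes>\<^sub>M arrivals) \<pi> fst) B = emeasure (\<pi> \<Otimes>\<^sub>M arrivals) (B \<times> UNIV)"
        by (subst emeasure_distr) (auto simp: space_pair_measure intro!: arg_cong2[where f = emeasure])
      also have "\<dots> = emeasure \<pi> B"
        using B sets.top[of arrivals] by (subst arr.P.emeasure_pair_measure_Times) auto
      finally show "emeasure (distr (\<pi> \<Otimes>\<^sub>M arrivals) \<pi> fst) B = emeasure \<pi> B" .
    qed simp
    then show "AE q in distr (\<pi> \<Otimes>\<^sub>M arrivals) \<pi> fst. valid_state q" using AE_pi_valid by (simp only:)
  qed
  moreover have "AE z in \<pi> \<Otimes>\<^sub>M arrivals. valid_arrivals (snd z)"
  proof (rule AE_distrD[OF measurable_snd])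
    have "distr (\<pi> \<Otimes>\<^sub>M arrivals) arrivals snd = arrivals"
    proof (rule measure_eqI)
      fix B assume B: "B \<in> sets (distr (\<pi> \<Otimes>\<^sub>M arrivals) arrivals snd)"
      then have "emeasure (distr (\<pi> \<Otimes>\<^sub>M arrivals) arrivals snd) B = emeasure (\<pi> \<Otimes>\<^sub>M arrivals) (UNIV \<times> B)"
        by (subst emeasure_distr) (auto simp: space_pair_measure intro!: arg_cong2[where f = emeasure])
      also have "\<dots> = emeasure arrivals B"
        using B sets.top[of \<pi>] pi.emeasure_space_1 by (subst arr.P.emeasure_pair_measure_Times) auto
      finally show "emeasure (distr (\<pi> \<Otimes>\<^sub>M arrivals) arrivals snd) B = emeasure arrivals B" .
    qed simp
    then show "AE w in distr (\<pi> \<Otimes>\<^sub>M arrivals) arrivals snd. valid_arrivals w" using AE_valid_arrivals by (simp only:)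
  qed
  ultimately show ?thesis by eventually_elim auto
qed

definition laplace_work :: "real \<Rightarrow> real" where
  "laplace_work \<theta> = (LINT q|\<pi>. exp (- \<theta> * workload q))"

text \<open>Transform of the workload after a time \<open>h\<close> without arrivals. The
  probability of an empty system enters the balance through its right derivative at
  \<open>h = 0\<close>.\<close>

definition laplace_drained :: "real \<Rightarrow> real \<Rightarrow> real" where
  "laplace_drained \<theta> h = (LINT q|\<pi>. exp (- \<theta> * max (workload q - h) 0))"

definition laplace_size :: "real \<Rightarrow> real" where
  "laplace_size \<theta> = (LINT m|mark_law. exp (- \<theta> * fst m))"

definition idle_prob :: real where
  "idle_prob = pi.prob {q. workload q = 0}"

lemma AE_workload_nonneg: "AE q in \<pi>. 0 \<le> workload q"
  using AE_pi_valid by eventually_elim (rule workload_nonneg)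

lemma integrable_laplace_work: "0 \<le> \<theta> \<Longrightarrow> integrable \<pi> (\<lambda>q. exp (- \<theta> * workload q))"
  using AE_workload_nonneg
  by (intro pi.integrable_const_bound[where B = 1]) (auto elim!: eventually_mono)

lemma integrable_laplace_drained: "0 \<le> \<theta> \<Longrightarrow> integrable \<pi> (\<lambda>q. exp (- \<theta> * max (workload q - h) 0))"
  by (intro pi.integrable_const_bound[where B = 1]) auto

lemma integrable_laplace_size: "0 \<le> \<theta> \<Longrightarrow> integrable mark_law (\<lambda>m. exp (- \<theta> * fst m))"
  using AE_mark_pos
  by (intro mark.integrable_const_bound[where B = 1]) (auto elim!: eventually_mono)

lemma nn_laplace_work: "0 \<le> \<theta> \<Longrightarrow> (\<integral>\<^sup>+ q. ennreal (exp (- \<theta> * workload q)) \<partial>\<pi>) = ennreal (laplace_work \<theta>)"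
  unfolding laplace_work_def by (intro nn_integral_eq_integral integrable_laplace_work) auto

lemma nn_laplace_drained: "0 \<le> \<theta> \<Longrightarrow>
    (\<integral>\<^sup>+ q. ennreal (exp (- \<theta> * max (workload q - h) 0)) \<partial>\<pi>) = ennreal (laplace_drained \<theta> h)"
  unfolding laplace_drained_def by (intro nn_integral_eq_integral integrable_laplace_drained) auto

lemma nn_laplace_size: "0 \<le> \<theta> \<Longrightarrow> (\<integral>\<^sup>+ m. ennreal (exp (- \<theta> * fst m)) \<partial>mark_law) = ennreal (laplace_size \<theta>)"
  unfolding laplace_size_def by (intro nn_integral_eq_integral integrable_laplace_size) auto

lemma laplace_nonneg: "0 \<le> laplace_work \<theta>" "0 \<le> laplace_drained \<theta> h" "0 \<le> laplace_size \<theta>"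
  unfolding laplace_work_def laplace_drained_def laplace_size_def by (auto intro: integral_nonneg_AE)

text \<open>By stationarity the state at \<open>t\<close> has law \<open>\<pi>\<close> again. The
  integral is over the completion because \<open>state_at\<close> is known to be measurable only
  there.\<close>

lemma laplace_work_state_at:
  assumes "0 \<le> t" "0 \<le> \<theta>"
  shows "(\<integral>\<^sup>+ z. ennreal (exp (- \<theta> * workload (case_prod (state_at age t) z))) \<partial>completion (\<pi> \<Otimes>\<^sub>M arrivals))
    = ennreal (laplace_work \<theta>)"
proof -
  have "ennreal (laplace_work \<theta>) = (\<integral>\<^sup>+ q. ennreal (exp (- \<theta> * workload q))
      \<partial>distr (completion (\<pi> \<Otimes>\<^sub>M arrivals)) state_space (case_prod (state_at age t)))"
    by (simp only: state_at_distr[OF assms(1)] nn_laplace_work[OF assms(2)])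
  also have "\<dots> = (\<integral>\<^sup>+ z. ennreal (exp (- \<theta> * workload (case_prod (state_at age t) z))) \<partial>completion (\<pi> \<Otimes>\<^sub>M arrivals))"
    by (rule nn_integral_distr[OF state_at_measurable[OF assms(1)]]) simp
  finally show ?thesis ..
qed

text \<open>The first-order approximation of \<open>exp (- \<theta> * V)\<close> for the workload \<open>V\<close> at a small time \<open>h\<close>.\<close>

definition approx :: "real \<Rightarrow> real \<Rightarrow> state \<times> (nat \<Rightarrow> arrival) \<Rightarrow> real" where
  "approx \<theta> h z = (if h < gap (snd z 0) then exp (- \<theta> * max (workload (fst z) - h) 0)
     else exp (- \<theta> * (workload (fst z) + service (snd z 0))))"

text \<open>If only the first gap is at most \<open>h\<close>, the workload is off by at most
  \<open>h\<close>, and \<open>exp (- \<theta> * v)\<close> is Lipschitz in \<open>v\<close> with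
  constant \<open>\<theta>\<close>; if the second gap is at most \<open>h\<close> too, the trivial
  bound 1 is added. All of this carries the condition \<open>gap (w 0) \<le> h\<close>, so the mean
  is of order \<open>h^2\<close>.\<close>

definition err :: "real \<Rightarrow> real \<Rightarrow> (nat \<Rightarrow> arrival) \<Rightarrow> real" where
  "err \<theta> h w = (if gap (w 0) \<le> h then \<theta> * h + (if gap (w 1) \<le> h then 1 else 0) else 0)"

lemma snd_component_measurable [measurable]: "(\<lambda>z. snd z k) \<in> \<pi> \<Otimes>\<^sub>M arrivals \<rightarrow>\<^sub>M job_law"
  by (rule measurable_compose[OF measurable_snd job_component_measurable])

lemma approx_measurable [measurable]: "approx \<theta> h \<in> borel_measurable (\<pi> \<Otimes>\<^sub>M arrivals)"
  unfolding approx_def[abs_def] by measurable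

lemma err_measurable [measurable]: "err \<theta> h \<in> borel_measurable arrivals"
  unfolding err_def[abs_def] by measurable

lemma exp_lipschitz:
  fixes a b \<theta> :: real
  assumes "0 \<le> \<theta>" "0 \<le> a" "0 \<le> b"
  shows "\<bar>exp (- \<theta> * a) - exp (- \<theta> * b)\<bar> \<le> \<theta> * \<bar>a - b\<bar>"
proof -
  have *: "\<bar>exp (- \<theta> * a) - exp (- \<theta> * b)\<bar> \<le> \<theta> * \<bar>a - b\<bar>" if "0 \<le> a" "a \<le> b" for a b :: real
  proof -
    have "exp (- \<theta> * b) = exp (- \<theta> * a) * exp (- (\<theta> * (b - a)))"
      by (simp add: mult_exp_exp algebra_simps)
    then have "exp (- \<theta> * a) - exp (- \<theta> * b) = exp (- \<theta> * a) * (1 - exp (- (\<theta> * (b - a))))"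
      by (simp add: algebra_simps)
    also have "\<dots> \<le> 1 * (\<theta> * (b - a))"
      using exp_ge_add_one_self[of "- (\<theta> * (b - a))"] that assms
      by (intro mult_mono) auto
    finally have "exp (- \<theta> * a) - exp (- \<theta> * b) \<le> \<theta> * (b - a)" by simp
    moreover have "exp (- \<theta> * b) \<le> exp (- \<theta> * a)" using that assms by (simp add: mult_left_mono)
    ultimately show ?thesis using that by simp
  qed
  show ?thesis using *[of a b] *[of b a] assms by (cases "a \<le> b") (auto simp: abs_minus_commute)
qed

lemma approx_error:
  assumes h: "0 \<le> h" and th: "0 \<le> \<theta>" and q: "valid_state q" and w: "valid_arrivals w"
  shows "\<bar>exp (- \<theta> * workload (state_at age h q w)) - approx \<theta> h (q, w)\<bar> \<le> err \<theta> h w"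
proof -
  let ?V = "workload (state_at age h q w)"
  have V: "0 \<le> ?V" by (rule workload_state_at_nonneg[OF policy q w h])
  have V0: "0 \<le> workload q + service (w 0)"
    using workload_nonneg[OF q] valid_arrivals_service[OF w, of 0] by simp
  show ?thesis
  proof (cases "h < gap (w 0)")
    case True
    then show ?thesis
      using workload_state_at_no_arrivals[OF policy q w h True] by (simp add: approx_def err_def)
  next
    case no: False
    show ?thesis
    proof (cases "h < gap (w 1)")
      case True
      have "\<bar>exp (- \<theta> * ?V) - exp (- \<theta> * (workload q + service (w 0)))\<bar>
          \<le> \<theta> * \<bar>?V - (workload q + service (w 0))\<bar>"
        by (rule exp_lipschitz[OF th V V0])
      also have "\<dots> \<le> \<theta> * h"
        using workload_state_at_one_arrival[OF policy q w h _ True] no th by (intro mult_left_mono) auto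
      finally show ?thesis using no True by (simp add: approx_def err_def)
    next
      case False
      have "0 \<le> \<theta> * ?V" "0 \<le> \<theta> * (workload q + service (w 0))" using th V V0 by auto
      then have "exp (- \<theta> * ?V) \<le> 1" "exp (- \<theta> * (workload q + service (w 0))) \<le> 1" by simp_all
      then have "\<bar>exp (- \<theta> * ?V) - exp (- \<theta> * (workload q + service (w 0)))\<bar> \<le> 1"
        using exp_gt_zero[of "- \<theta> * ?V"] exp_gt_zero[of "- \<theta> * (workload q + service (w 0))"]
        unfolding abs_le_iff by linarith
      also have "1 \<le> \<theta> * h + 1" using th h by simp
      finally show ?thesis using no False by (simp add: approx_def err_def)
    qed
  qed
qed

lemma nn_integral_job_gap:
  assumes [measurable]: "k \<in> borel_measurable borel"
  shows "(\<integral>\<^sup>+ y. k (gap y) \<partial>job_law) = (\<integral>\<^sup>+ g. k g \<partial>gap_law)"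
  by (subst nn_integral_job) (simp_all add: gap_def)

lemma nn_integral_err:
  assumes h: "0 \<le> h" and th: "0 \<le> \<theta>"
  shows "(\<integral>\<^sup>+ w. ennreal (err \<theta> h w) \<partial>arrivals)
    = ennreal ((1 - exp (- lam * h)) * (\<theta> * h + (1 - exp (- lam * h))))"
proof -
  let ?I = "\<lambda>g. indicator {..h} g :: ennreal"
  have I: "(\<integral>\<^sup>+ y. ?I (gap y) \<partial>job_law) = ennreal (1 - exp (- lam * h))"
    using nn_integral_job_gap[of ?I] by (simp add: emeasure_gap_atMost[OF h] sets_gap_law)
  have "(\<integral>\<^sup>+ w. ennreal (err \<theta> h w) \<partial>arrivals)
     = (\<integral>\<^sup>+ w. ?I (gap (w 0)) * (ennreal (\<theta> * h) + ?I (gap (w 1))) \<partial>arrivals)"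
    using h th by (intro nn_integral_cong) (auto simp: err_def split: split_indicator)
  also have "\<dots> = (\<integral>\<^sup>+ y. \<integral>\<^sup>+ w. ?I (gap y) * (ennreal (\<theta> * h) + ?I (gap (w 0))) \<partial>arrivals \<partial>job_law)"
    by (subst nn_integral_arrivals_Suc) simp_all
  also have "\<dots> = (\<integral>\<^sup>+ y. ?I (gap y) * (ennreal (\<theta> * h) + (\<integral>\<^sup>+ w. ?I (gap (w 0)) \<partial>arrivals)) \<partial>job_law)"
    by (simp add: nn_integral_cmult nn_integral_add)
  also have "(\<integral>\<^sup>+ w. ?I (gap (w 0)) \<partial>arrivals) = ennreal (1 - exp (- lam * h))"
    by (subst nn_integral_arrivals_Suc) (simp_all add: I)
  also have "(\<integral>\<^sup>+ y. ?I (gap y) * (ennreal (\<theta> * h) + ennreal (1 - exp (- lam * h))) \<partial>job_law)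
     = ennreal (1 - exp (- lam * h)) * (ennreal (\<theta> * h) + ennreal (1 - exp (- lam * h)))"
    by (simp add: nn_integral_multc I)
  also have "\<dots> = ennreal ((1 - exp (- lam * h)) * (\<theta> * h + (1 - exp (- lam * h))))"
    using h th lam by (simp add: ennreal_mult)
  finally show ?thesis .
qed

lemma nn_integral_approx:
  assumes h: "0 \<le> h" and th: "0 \<le> \<theta>"
  shows "(\<integral>\<^sup>+ z. ennreal (approx \<theta> h z) \<partial>(\<pi> \<Otimes>\<^sub>M arrivals))
    = ennreal (exp (- lam * h) * laplace_drained \<theta> h + (1 - exp (- lam * h)) * (laplace_work \<theta> * laplace_size \<theta>))"
proof -
  let ?e = "exp (- lam * h)"
  let ?J = "\<lambda>g. indicator {h<..} g :: ennreal" and ?I = "\<lambda>g. indicator {..h} g :: ennreal"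
  let ?D = "\<lambda>q. ennreal (exp (- \<theta> * max (workload q - h) 0))" and ?W = "\<lambda>q. ennreal (exp (- \<theta> * workload q))"
  have J: "(\<integral>\<^sup>+ y. ?J (gap y) \<partial>job_law) = ennreal ?e"
    using nn_integral_job_gap[of ?J] by (simp add: emeasure_gap_greater[OF h] sets_gap_law)
  have "(\<lambda>y :: arrival. ?I (gap y) * ennreal (exp (- \<theta> * service y))) \<in> borel_measurable job_law" by measurable
  from nn_integral_job[OF this]
  have "(\<integral>\<^sup>+ y. ?I (gap y) * ennreal (exp (- \<theta> * service y)) \<partial>job_law)
     = (\<integral>\<^sup>+ g. \<integral>\<^sup>+ m. ?I g * ennreal (exp (- \<theta> * fst m)) \<partial>mark_law \<partial>gap_law)"
    by (simp add: gap_def service_def)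
  also have "\<dots> = (\<integral>\<^sup>+ g. ?I g * ennreal (laplace_size \<theta>) \<partial>gap_law)"
    by (subst nn_integral_cmult) (simp_all only: nn_laplace_size[OF th], measurable)
  also have "\<dots> = ennreal (1 - ?e) * ennreal (laplace_size \<theta>)"
    by (subst nn_integral_multc) (simp_all add: sets_gap_law emeasure_gap_atMost[OF h])
  finally have S: "(\<integral>\<^sup>+ y. ?I (gap y) * ennreal (exp (- \<theta> * service y)) \<partial>job_law)
     = ennreal (1 - ?e) * ennreal (laplace_size \<theta>)" .
  have inner: "(\<integral>\<^sup>+ w. ennreal (approx \<theta> h (q, w)) \<partial>arrivals)
     = ?D q * ennreal ?e + ?W q * (ennreal (1 - ?e) * ennreal (laplace_size \<theta>))" for q
  proof -
    have "(\<integral>\<^sup>+ w. ennreal (approx \<theta> h (q, w)) \<partial>arrivals)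
      = (\<integral>\<^sup>+ w. ?D q * ?J (gap (w 0)) + ?W q * (?I (gap (w 0)) * ennreal (exp (- \<theta> * service (w 0)))) \<partial>arrivals)"
      by (intro nn_integral_cong)
         (auto simp: approx_def mult_exp_exp algebra_simps split: split_indicator simp flip: ennreal_mult)
    also have "\<dots> = (\<integral>\<^sup>+ y. ?D q * ?J (gap y) + ?W q * (?I (gap y) * ennreal (exp (- \<theta> * service y))) \<partial>job_law)"
      by (subst nn_integral_arrivals_Suc) simp_all
    also have "\<dots> = ?D q * ennreal ?e + ?W q * (ennreal (1 - ?e) * ennreal (laplace_size \<theta>))"
      by (subst nn_integral_add) (simp_all add: nn_integral_cmult J[simplified] S[simplified])
    finally show ?thesis .
  qed
  have "(\<integral>\<^sup>+ z. ennreal (approx \<theta> h z) \<partial>(\<pi> \<Otimes>\<^sub>M arrivals))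
     = (\<integral>\<^sup>+ q. \<integral>\<^sup>+ w. ennreal (approx \<theta> h (q, w)) \<partial>arrivals \<partial>\<pi>)"
    by (rule arr.P.nn_integral_fst[symmetric]) measurable
  also have "\<dots> = ennreal (laplace_drained \<theta> h) * ennreal ?e
      + ennreal (laplace_work \<theta>) * (ennreal (1 - ?e) * ennreal (laplace_size \<theta>))"
    unfolding inner nn_laplace_work[OF th, symmetric] nn_laplace_drained[OF th, symmetric]
    by (subst nn_integral_add) (simp_all add: nn_integral_multc)
  also have "\<dots> = ennreal (?e * laplace_drained \<theta> h + (1 - ?e) * (laplace_work \<theta> * laplace_size \<theta>))"
    using h lam laplace_nonneg by (simp add: ac_simps flip: ennreal_mult ennreal_plus)
  finally show ?thesis .
qed

text \<open>Stationarity identifies the transform at time \<open>h\<close> with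
  \<open>laplace_work \<theta>\<close>, so \<open>approx_error\<close> becomes an approximate
  equation for it. The two inequalities are proved separately, with the error added on the larger
  side, to stay within nonnegative integrals.\<close>

lemma laplace_near:
  assumes h: "0 \<le> h" and th: "0 \<le> \<theta>"
  shows "\<bar>laplace_work \<theta> - (exp (- lam * h) * laplace_drained \<theta> h
      + (1 - exp (- lam * h)) * (laplace_work \<theta> * laplace_size \<theta>))\<bar>
    \<le> (1 - exp (- lam * h)) * (\<theta> * h + (1 - exp (- lam * h)))" (is "\<bar>?L - ?R\<bar> \<le> ?E")
proof -
  let ?N = "\<pi> \<Otimes>\<^sub>M arrivals"
  let ?g = "\<lambda>z. exp (- \<theta> * workload (case_prod (state_at age h) z))"
  have E0: "0 \<le> ?E" using h th lam by (intro mult_nonneg_nonneg add_nonneg_nonneg) auto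
  have R0: "0 \<le> ?R" using h lam laplace_nonneg by (intro mult_nonneg_nonneg add_nonneg_nonneg) auto
  have err: "AE z in completion ?N. \<bar>?g z - approx \<theta> h z\<bar> \<le> err \<theta> h (snd z)"
    by (rule AE_completion, use AE_joint_valid in eventually_elim)
       (use approx_error[OF h th] in auto)
  have err_int: "(\<integral>\<^sup>+ z. ennreal (err \<theta> h (snd z)) \<partial>completion ?N) = ennreal ?E"
  proof -
    have "(\<integral>\<^sup>+ z. ennreal (err \<theta> h (snd z)) \<partial>?N) = (\<integral>\<^sup>+ q. \<integral>\<^sup>+ w. ennreal (err \<theta> h w) \<partial>arrivals \<partial>\<pi>)"
      by (subst arr.P.nn_integral_fst[symmetric]) (auto intro: measurable_compose[OF measurable_snd])
    then show ?thesis using pi.emeasure_space_1 by (simp add: nn_integral_completion nn_integral_err[OF h th])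
  qed
  have approx_int: "(\<integral>\<^sup>+ z. ennreal (approx \<theta> h z) \<partial>completion ?N) = ennreal ?R"
    by (simp only: nn_integral_completion nn_integral_approx[OF h th])
  have [measurable]: "(\<lambda>z. err \<theta> h (snd z)) \<in> borel_measurable ?N"
    by (rule measurable_compose[OF measurable_snd err_measurable])
  have m1: "(\<lambda>z. ennreal (err \<theta> h (snd z))) \<in> borel_measurable (completion ?N)"
    and m2: "(\<lambda>z. ennreal (approx \<theta> h z)) \<in> borel_measurable (completion ?N)"
    by (auto intro!: measurable_completion)
  have "workload \<circ> case_prod (state_at age h) \<in> borel_measurable (completion ?N)"
    by (rule measurable_comp[OF state_at_measurable[OF h] workload_measurable])
  then have m3: "(\<lambda>z. ennreal (?g z)) \<in> borel_measurable (completion ?N)"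
    unfolding comp_def by measurable
  have err_nonneg: "0 \<le> err \<theta> h w" for w using h th by (simp add: err_def)
  have approx_nonneg: "0 \<le> approx \<theta> h z" for z by (simp add: approx_def)
  have "ennreal ?L \<le> (\<integral>\<^sup>+ z. ennreal (approx \<theta> h z) + ennreal (err \<theta> h (snd z)) \<partial>completion ?N)"
    unfolding laplace_work_state_at[OF h th, symmetric]
  proof (rule nn_integral_mono_AE, use err in eventually_elim)
    case (elim z)
    then have "?g z \<le> approx \<theta> h z + err \<theta> h (snd z)" by linarith
    then show ?case using err_nonneg approx_nonneg by (simp add: ennreal_leI flip: ennreal_plus)
  qed
  also have "\<dots> = ennreal ?R + ennreal ?E"
    by (subst nn_integral_add[OF m2 m1]) (simp only: approx_int err_int)
  also have "\<dots> = ennreal (?R + ?E)" using R0 E0 by (rule ennreal_plus[symmetric])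
  finally have 1: "?L \<le> ?R + ?E" using R0 E0 by (simp add: ennreal_le_iff del: ennreal_plus)
  have "ennreal ?R \<le> (\<integral>\<^sup>+ z. ennreal (?g z) + ennreal (err \<theta> h (snd z)) \<partial>completion ?N)"
    unfolding approx_int[symmetric]
  proof (rule nn_integral_mono_AE, use err in eventually_elim)
    case (elim z)
    then have "approx \<theta> h z \<le> ?g z + err \<theta> h (snd z)" by linarith
    then show ?case using err_nonneg by (simp add: ennreal_leI flip: ennreal_plus)
  qed
  also have "\<dots> = ennreal ?L + ennreal ?E"
    by (subst nn_integral_add[OF m3 m1]) (simp only: laplace_work_state_at[OF h th] err_int)
  also have "\<dots> = ennreal (?L + ?E)" using laplace_nonneg(1) E0 by (rule ennreal_plus[symmetric])
  finally have 2: "?R \<le> ?L + ?E"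
    using laplace_nonneg(1) E0 by (simp add: ennreal_le_iff del: ennreal_plus)
  from 1 2 show ?thesis by linarith
qed

end

text \<open>The limit may have an infinite integral and need not be approached monotonically. Fatou
  gives the lower bound, and domination by the limit itself gives the upper one.\<close>

lemma nn_integral_tendsto_from_below:
  fixes u :: "nat \<Rightarrow> 'a \<Rightarrow> ennreal"
  assumes [measurable]: "\<And>n. u n \<in> borel_measurable M"
    and le: "\<And>n. AE x in M. u n x \<le> U x"
    and lim: "AE x in M. (\<lambda>n. u n x) \<longlonglongrightarrow> U x"
  shows "(\<lambda>n. \<integral>\<^sup>+ x. u n x \<partial>M) \<longlonglongrightarrow> (\<integral>\<^sup>+ x. U x \<partial>M)"
proof -
  have "(\<integral>\<^sup>+ x. U x \<partial>M) = (\<integral>\<^sup>+ x. liminf (\<lambda>n. u n x) \<partial>M)"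
    by (rule nn_integral_cong_AE, use lim in eventually_elim)
       (simp add: tendsto_iff_Liminf_eq_Limsup)
  also have "\<dots> \<le> liminf (\<lambda>n. \<integral>\<^sup>+ x. u n x \<partial>M)" by (rule nn_integral_liminf) simp
  finally have 1: "(\<integral>\<^sup>+ x. U x \<partial>M) \<le> liminf (\<lambda>n. \<integral>\<^sup>+ x. u n x \<partial>M)" .
  have 2: "limsup (\<lambda>n. \<integral>\<^sup>+ x. u n x \<partial>M) \<le> (\<integral>\<^sup>+ x. U x \<partial>M)"
    by (intro Limsup_bounded always_eventually allI nn_integral_mono_AE le)
  have 3: "liminf (\<lambda>n. \<integral>\<^sup>+ x. u n x \<partial>M) \<le> limsup (\<lambda>n. \<integral>\<^sup>+ x. u n x \<partial>M)"
    by (rule Liminf_le_Limsup) simp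
  show ?thesis
    unfolding tendsto_iff_Liminf_eq_Limsup[OF sequentially_bot]
    using 1 2 3 by (auto intro: antisym order_trans)
qed

text \<open>The product of \<open>1 - y + y^2 / 2\<close> and \<open>1 + y + y^2 / 2\<close> is
  \<open>1 + y^4 / 4\<close>, hence at least 1, and the second factor is at most
  \<open>exp y\<close>.\<close>

lemma exp_minus_le_quadratic:
  fixes y :: real
  assumes "0 \<le> y" shows "exp (- y) \<le> 1 - y + y\<^sup>2 / 2"
proof -
  have "1 \<le> (1 - y + y\<^sup>2 / 2) * (1 + y + y\<^sup>2 / 2)"
    using assms by (simp add: algebra_simps power2_eq_square)
  also have "\<dots> \<le> (1 - y + y\<^sup>2 / 2) * exp y"
  proof (rule mult_left_mono[OF exp_lower_Taylor_quadratic[OF assms]])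
    have "0 \<le> (1 - y)\<^sup>2 + 1" by simp
    then show "0 \<le> 1 - y + y\<^sup>2 / 2" by (simp add: power2_eq_square algebra_simps)
  qed
  finally show ?thesis by (simp add: exp_minus field_simps)
qed

text \<open>One null sequence for both the time step \<open>h\<close> and the argument
  \<open>\<theta>\<close>, since the convergence theorems for integrals are about sequences.\<close>

abbreviation tiny :: "nat \<Rightarrow> real" where "tiny n \<equiv> 1 / real (Suc n)"

lemma tiny_diff_tendsto: "(\<lambda>n. (1 - exp (- tiny n * x)) / tiny n) \<longlonglongrightarrow> x"
proof (cases x "0 :: real" rule: linorder_cases)
  case less then show ?thesis by real_asymp
next
  case greater then show ?thesis by real_asymp
qed simp

lemma tiny_diff2_tendsto: "(\<lambda>n. (exp (- tiny n * x) - 1 + tiny n * x) / (tiny n)\<^sup>2) \<longlonglongrightarrow> x\<^sup>2 / 2"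
proof (cases x "0 :: real" rule: linorder_cases)
  case less then show ?thesis by real_asymp (simp add: power2_eq_square)
next
  case greater then show ?thesis by real_asymp (simp add: power2_eq_square)
qed simp

section \<open>Moments as limits of Laplace transforms\<close>

context prob_space
begin

lemma integrable_exp_minus:
  assumes [measurable]: "X \<in> borel_measurable M" and nn: "AE x in M. 0 \<le> X x" and "0 \<le> (t::real)"
  shows "integrable M (\<lambda>x. exp (- t * X x))"
  using nn assms(3) by (intro integrable_const_bound[where B = 1]) (auto elim!: eventually_mono)

text \<open>The difference quotient lies below \<open>X\<close> and converges to it pointwise, so
  the limit is valid even if the mean of \<open>X\<close> is infinite.\<close>

lemma laplace_first_moment:
  assumes [measurable]: "X \<in> borel_measurable M" and nn: "AE x in M. 0 \<le> X x"
  shows "(\<lambda>n. ennreal ((1 - (LINT x|M. exp (- tiny n * X x))) / tiny n)) \<longlonglongrightarrow> (\<integral>\<^sup>+ x. ennreal (X x) \<partial>M)"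
proof -
  have "ennreal ((1 - (LINT x|M. exp (- tiny n * X x))) / tiny n)
      = (\<integral>\<^sup>+ x. ennreal ((1 - exp (- tiny n * X x)) / tiny n) \<partial>M)" for n
  proof -
    have int: "integrable M (\<lambda>x. exp (- tiny n * X x))"
      by (rule integrable_exp_minus[OF assms]) simp
    have "(\<integral>\<^sup>+ x. ennreal ((1 - exp (- tiny n * X x)) / tiny n) \<partial>M)
        = ennreal (LINT x|M. (1 - exp (- tiny n * X x)) / tiny n)"
    proof (rule nn_integral_eq_integral)
      show "integrable M (\<lambda>x. (1 - exp (- tiny n * X x)) / tiny n)" using int by simp
      show "AE x in M. 0 \<le> (1 - exp (- tiny n * X x)) / tiny n"
        using nn by eventually_elim simp
    qed
    also have "(LINT x|M. (1 - exp (- tiny n * X x)) / tiny n) = (1 - (LINT x|M. exp (- tiny n * X x))) / tiny n"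
      using int by (subst integral_divide_zero, subst Bochner_Integration.integral_diff) (simp_all add: prob_space)
    finally show ?thesis ..
  qed
  moreover have "(\<lambda>n. \<integral>\<^sup>+ x. ennreal ((1 - exp (- tiny n * X x)) / tiny n) \<partial>M) \<longlonglongrightarrow> (\<integral>\<^sup>+ x. ennreal (X x) \<partial>M)"
  proof (rule nn_integral_tendsto_from_below)
    show "AE x in M. (\<lambda>n. ennreal ((1 - exp (- tiny n * X x)) / tiny n)) \<longlonglongrightarrow> ennreal (X x)"
      by (intro AE_I2 tendsto_ennrealI tiny_diff_tendsto)
    fix n show "AE x in M. ennreal ((1 - exp (- tiny n * X x)) / tiny n) \<le> ennreal (X x)"
    proof (intro AE_I2 ennreal_leI)
      fix x show "(1 - exp (- tiny n * X x)) / tiny n \<le> X x"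
        using exp_ge_add_one_self[of "- tiny n * X x"]
        by (subst pos_divide_le_eq) (simp_all add: mult.commute)
    qed
  qed measurable
  ultimately show ?thesis by (simp only:)
qed

lemma laplace_second_moment:
  assumes int_X: "integrable M X" and nn: "AE x in M. 0 \<le> X x"
  shows "(\<lambda>n. ennreal (((LINT x|M. exp (- tiny n * X x)) - 1 + tiny n * (LINT x|M. X x)) / (tiny n)\<^sup>2))
    \<longlonglongrightarrow> (\<integral>\<^sup>+ x. ennreal ((X x)\<^sup>2 / 2) \<partial>M)"
proof -
  have [measurable]: "X \<in> borel_measurable M" using int_X by simp
  have "ennreal (((LINT x|M. exp (- tiny n * X x)) - 1 + tiny n * (LINT x|M. X x)) / (tiny n)\<^sup>2)
      = (\<integral>\<^sup>+ x. ennreal ((exp (- tiny n * X x) - 1 + tiny n * X x) / (tiny n)\<^sup>2) \<partial>M)" for n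
  proof -
    have int: "integrable M (\<lambda>x. exp (- tiny n * X x))"
      by (rule integrable_exp_minus[OF _ nn]) simp_all
    have "(\<integral>\<^sup>+ x. ennreal ((exp (- tiny n * X x) - 1 + tiny n * X x) / (tiny n)\<^sup>2) \<partial>M)
        = ennreal (LINT x|M. (exp (- tiny n * X x) - 1 + tiny n * X x) / (tiny n)\<^sup>2)"
    proof (rule nn_integral_eq_integral)
      show "integrable M (\<lambda>x. (exp (- tiny n * X x) - 1 + tiny n * X x) / (tiny n)\<^sup>2)"
        using int int_X by (intro integrable_divide_zero) simp
      show "AE x in M. 0 \<le> (exp (- tiny n * X x) - 1 + tiny n * X x) / (tiny n)\<^sup>2"
      proof (intro AE_I2 divide_nonneg_nonneg)
        fix x show "0 \<le> exp (- tiny n * X x) - 1 + tiny n * X x"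
          using exp_ge_add_one_self[of "- tiny n * X x"] by simp
      qed simp
    qed
    also have "(LINT x|M. (exp (- tiny n * X x) - 1 + tiny n * X x) / (tiny n)\<^sup>2)
       = ((LINT x|M. exp (- tiny n * X x)) - 1 + tiny n * (LINT x|M. X x)) / (tiny n)\<^sup>2"
      using int int_X
      by (subst integral_divide_zero, subst Bochner_Integration.integral_add, simp, simp,
          subst Bochner_Integration.integral_diff) (simp_all add: prob_space)
    finally show ?thesis ..
  qed
  moreover have "(\<lambda>n. \<integral>\<^sup>+ x. ennreal ((exp (- tiny n * X x) - 1 + tiny n * X x) / (tiny n)\<^sup>2) \<partial>M)
      \<longlonglongrightarrow> (\<integral>\<^sup>+ x. ennreal ((X x)\<^sup>2 / 2) \<partial>M)"
  proof (rule nn_integral_tendsto_from_below)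
    show "AE x in M. (\<lambda>n. ennreal ((exp (- tiny n * X x) - 1 + tiny n * X x) / (tiny n)\<^sup>2)) \<longlonglongrightarrow> ennreal ((X x)\<^sup>2 / 2)"
      by (intro AE_I2 tendsto_ennrealI tiny_diff2_tendsto)
    fix n show "AE x in M. ennreal ((exp (- tiny n * X x) - 1 + tiny n * X x) / (tiny n)\<^sup>2) \<le> ennreal ((X x)\<^sup>2 / 2)"
      using nn
    proof eventually_elim
      case (elim x)
      have "exp (- (tiny n * X x)) - 1 + tiny n * X x \<le> (X x)\<^sup>2 / 2 * (tiny n)\<^sup>2"
      proof -
        have "0 \<le> tiny n * X x" using elim by simp
        from exp_minus_le_quadratic[OF this] show ?thesis
          unfolding power_mult_distrib by (simp add: mult_ac)
      qed
      then have "(exp (- tiny n * X x) - 1 + tiny n * X x) / (tiny n)\<^sup>2 \<le> (X x)\<^sup>2 / 2"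
        by (subst pos_divide_le_eq) (simp_all only: mult_minus_left zero_less_power2, simp)
      then show ?case by (rule ennreal_leI)
    qed
  qed measurable
  ultimately show ?thesis by (simp only:)
qed

end

context onebit_stationary
begin

text \<open>Where the workload is positive, draining eventually just subtracts \<open>tiny n\<close>
  and the quotient tends to \<open>\<theta> * exp (- \<theta> * workload q)\<close>; where it is 0,
  draining has no effect and the indicator removes the contribution. The Lipschitz constant
  \<open>\<theta>\<close> dominates.\<close>

lemma drained_quotient_tendsto:
  assumes th: "0 < \<theta>"
  shows "(\<lambda>n. (laplace_drained \<theta> (tiny n) - laplace_work \<theta>) / tiny n) \<longlonglongrightarrow> \<theta> * (laplace_work \<theta> - idle_prob)"
proof -
  have [measurable]: "{q. workload q = 0} \<in> sets \<pi>"
  proof -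
    have "{q \<in> space \<pi>. workload q = 0} \<in> sets \<pi>" by measurable
    then show ?thesis by simp
  qed
  let ?s = "\<lambda>n q. (exp (- \<theta> * max (workload q - tiny n) 0) - exp (- \<theta> * workload q)) / tiny n"
  let ?l = "\<lambda>q. \<theta> * (exp (- \<theta> * workload q) - indicator {q. workload q = 0} q)"
  have "(\<lambda>n. LINT q|\<pi>. ?s n q) \<longlonglongrightarrow> (LINT q|\<pi>. ?l q)"
  proof (rule integral_dominated_convergence[where w = "\<lambda>_. \<theta>"])
    show "AE q in \<pi>. (\<lambda>n. ?s n q) \<longlonglongrightarrow> ?l q"
      using AE_workload_nonneg
    proof eventually_elim
      case (elim q)
      show ?case
      proof (cases "workload q = 0")
        case True then show ?thesis by (simp add: max_def)
      next
        case False
        with elim have pos: "0 < workload q" by simp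
        have "tiny \<longlonglongrightarrow> 0" by real_asymp
        then have "eventually (\<lambda>n. tiny n < workload q) sequentially" using pos by (rule order_tendstoD)
        then have "eventually (\<lambda>n. exp (- \<theta> * workload q) * ((exp (\<theta> * tiny n) - 1) / tiny n) = ?s n q) sequentially"
        proof eventually_elim
          case (elim n)
          have "exp (- \<theta> * (workload q - tiny n)) = exp (- \<theta> * workload q) * exp (\<theta> * tiny n)"
            unfolding mult_exp_exp by (simp add: right_diff_distrib)
          moreover have "max (workload q - tiny n) 0 = workload q - tiny n" using elim by simp
          ultimately show ?case by (simp only: times_divide_eq_right right_diff_distrib mult_1_right)
        qed
        moreover have "(\<lambda>n. (exp (\<theta> * tiny n) - 1) / tiny n) \<longlonglongrightarrow> \<theta>" using th by real_asymp
        then have "(\<lambda>n. exp (- \<theta> * workload q) * ((exp (\<theta> * tiny n) - 1) / tiny n)) \<longlonglongrightarrow> exp (- \<theta> * workload q) * \<theta>"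
          by (rule tendsto_mult_left)
        ultimately have "(\<lambda>n. ?s n q) \<longlonglongrightarrow> exp (- \<theta> * workload q) * \<theta>"
          by (rule Lim_transform_eventually[rotated])
        then show ?thesis using False by (simp add: mult.commute)
      qed
    qed
    fix n show "AE q in \<pi>. norm (?s n q) \<le> \<theta>"
      using AE_workload_nonneg
    proof eventually_elim
      case (elim q)
      have "\<bar>exp (- \<theta> * max (workload q - tiny n) 0) - exp (- \<theta> * workload q)\<bar>
          \<le> \<theta> * \<bar>max (workload q - tiny n) 0 - workload q\<bar>"
        using th elim by (intro exp_lipschitz) auto
      also have "\<dots> \<le> \<theta> * tiny n"
        using th elim by (intro mult_left_mono) (auto simp: max_def)
      finally have le: "\<bar>exp (- \<theta> * max (workload q - tiny n) 0) - exp (- \<theta> * workload q)\<bar> \<le> \<theta> * tiny n" .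
      have "0 < tiny n" "\<bar>tiny n\<bar> = tiny n" by simp_all
      with le show ?case by (simp only: real_norm_def abs_divide pos_divide_le_eq)
    qed
  qed measurable
  moreover have "(LINT q|\<pi>. ?s n q) = (laplace_drained \<theta> (tiny n) - laplace_work \<theta>) / tiny n" for n
    unfolding laplace_drained_def laplace_work_def
    using th integrable_laplace_work[of \<theta>] integrable_laplace_drained[of \<theta> "tiny n"]
    by (subst integral_divide_zero, subst Bochner_Integration.integral_diff) auto
  moreover have "integrable \<pi> (indicator {q. workload q = 0} :: state \<Rightarrow> real)"
    by (rule integrable_real_indicator) (simp_all add: pi.emeasure_eq_measure)
  then have "(LINT q|\<pi>. ?l q) = \<theta> * (laplace_work \<theta> - idle_prob)"
    unfolding laplace_work_def idle_prob_def using th integrable_laplace_work[of \<theta>]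
    by (subst integral_mult_right_zero, subst Bochner_Integration.integral_diff) auto
  ultimately show ?thesis by (simp only:)
qed

text \<open>\<open>laplace_near\<close> divided by \<open>h = tiny n\<close>: the error of order
  \<open>h^2\<close> disappears, while the quotients \<open>A\<close> for arrivals and
  \<open>B\<close> for draining have limits. The outcome is the Pollaczek-Khinchine equation with
  \<open>idle_prob\<close> still unknown.\<close>

lemma laplace_balance:
  assumes th: "0 < \<theta>"
  shows "laplace_work \<theta> * (\<theta> - lam * (1 - laplace_size \<theta>)) = \<theta> * idle_prob"
proof -
  define e where "e n = exp (- lam * tiny n)" for n
  define A where "A n = (1 - e n) / tiny n" for n
  define B where "B n = (laplace_drained \<theta> (tiny n) - laplace_work \<theta>) / tiny n" for n
  let ?L = "laplace_work \<theta>" and ?F = "laplace_size \<theta>"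
  have e: "e \<longlonglongrightarrow> 1" unfolding e_def using lam by real_asymp
  have A: "A \<longlonglongrightarrow> lam" unfolding A_def e_def using tiny_diff_tendsto[of lam] by (simp add: mult.commute)
  have B: "B \<longlonglongrightarrow> \<theta> * (?L - idle_prob)" unfolding B_def by (rule drained_quotient_tendsto[OF th])
  have t: "tiny \<longlonglongrightarrow> 0" by real_asymp
  let ?X = "\<lambda>n. A n * ?L - e n * B n - A n * (?L * ?F)"
  have X: "?X \<longlonglongrightarrow> lam * ?L - 1 * (\<theta> * (?L - idle_prob)) - lam * (?L * ?F)"
    by (intro tendsto_intros A B e)
  have "(\<lambda>n. A n * (\<theta> * tiny n + (1 - e n))) \<longlonglongrightarrow> lam * (\<theta> * 0 + (1 - 1))"
    by (intro tendsto_intros A e t)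
  then have bd: "(\<lambda>n. A n * (\<theta> * tiny n + (1 - e n))) \<longlonglongrightarrow> 0" by simp
  have le: "\<bar>?X n\<bar> \<le> A n * (\<theta> * tiny n + (1 - e n))" for n
  proof -
    have tn: "0 < tiny n" by simp
    \<comment> \<open>\<open>?X n\<close> is the difference estimated in
      \<open>laplace_near\<close>, divided by \<open>tiny n\<close>, with \<open>?L\<close> split as
      \<open>(1 - e n) * ?L + e n * ?L\<close>.\<close>
    have "?X n * tiny n = ?L - (e n * laplace_drained \<theta> (tiny n) + (1 - e n) * (?L * ?F))"
    proof -
      have A': "A n * tiny n = 1 - e n" and B': "B n * tiny n = laplace_drained \<theta> (tiny n) - ?L"
        by (simp_all add: A_def B_def)
      have "?X n * tiny n = (A n * tiny n) * ?L - e n * (B n * tiny n) - (A n * tiny n) * (?L * ?F)"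
        by (simp only: left_diff_distrib right_diff_distrib mult_ac)
      also have "\<dots> = ?L - (e n * laplace_drained \<theta> (tiny n) + (1 - e n) * (?L * ?F))"
        unfolding A' B' by (simp add: algebra_simps)
      finally show ?thesis .
    qed
    then have "\<bar>?X n * tiny n\<bar> \<le> (1 - e n) * (\<theta> * tiny n + (1 - e n))"
      using laplace_near[of "tiny n" \<theta>] th by (simp only: e_def) simp
    also have "(1 - e n) * (\<theta> * tiny n + (1 - e n)) = A n * (\<theta> * tiny n + (1 - e n)) * tiny n"
      using tn by (simp add: A_def)
    finally show ?thesis using tn by (simp only: abs_mult abs_of_pos mult_le_cancel_right_pos)
  qed
  have "?X \<longlonglongrightarrow> 0"
    by (rule Lim_null_comparison[OF always_eventually bd]) (simp only: real_norm_def le simp_thms)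
  then have "lam * ?L - 1 * (\<theta> * (?L - idle_prob)) - lam * (?L * ?F) = 0"
    using X LIMSEQ_unique by blast
  then show ?thesis by (simp add: algebra_simps)
qed

text \<open>The workload is a real number, so no mass sits at infinity. This normalisation fixes
  \<open>idle_prob\<close> in the balance equation.\<close>

lemma laplace_work_tendsto_1: "(\<lambda>n. laplace_work (tiny n)) \<longlonglongrightarrow> 1"
proof -
  have "(\<lambda>n. LINT q|\<pi>. exp (- tiny n * workload q)) \<longlonglongrightarrow> (LINT q|\<pi>. 1)"
  proof (rule integral_dominated_convergence[where w = "\<lambda>_. 1"])
    show "AE q in \<pi>. (\<lambda>n. exp (- tiny n * workload q)) \<longlonglongrightarrow> 1"
    proof (rule AE_I2)
      fix q
      have "tiny \<longlonglongrightarrow> 0" by real_asymp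
      then have "(\<lambda>n. exp (- tiny n * workload q)) \<longlonglongrightarrow> exp (- 0 * workload q)"
        by (intro tendsto_intros)
      then show "(\<lambda>n. exp (- tiny n * workload q)) \<longlonglongrightarrow> 1" by simp
    qed
    fix n show "AE q in \<pi>. norm (exp (- tiny n * workload q)) \<le> 1"
      using AE_workload_nonneg by eventually_elim simp
  qed measurable
  then show ?thesis using pi.prob_space by (simp add: laplace_work_def)
qed

text \<open>Solving the balance for \<open>laplace_work\<close> expresses its first difference
  quotient as \<open>lam / D n\<close> times the second-order quotient \<open>Q n\<close> of the
  service time transform; the factors tend to \<open>lam / (1 - \<rho>)\<close> and to half the
  second moment.\<close>

lemma mean_workload:
  assumes rho: "load lam f = ennreal \<rho>" "0 \<le> \<rho>" "\<rho> < 1"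
  shows "(\<integral>\<^sup>+ q. ennreal (workload q) \<partial>\<pi>) = ennreal (lam / (1 - \<rho>)) * (ennreal (1 / 2) * second_moment f)"
proof -
  have [measurable]: "(\<lambda>m. fst m) \<in> borel_measurable mark_law" by measurable
  have size_nonneg: "AE m in mark_law. 0 \<le> fst m" using AE_mark_pos by eventually_elim simp
  have "(\<integral>\<^sup>+ m. ennreal (fst m) \<partial>mark_law) \<noteq> top"
    using rho lam load_eq by (auto simp: ennreal_mult_eq_top_iff ennreal_mult_top)
  then have fin: "(\<integral>\<^sup>+ m. ennreal (fst m) \<partial>mark_law) < \<infinity>" by (simp add: less_top)
  have int: "integrable mark_law (\<lambda>m. fst m)"
    by (rule integrableI_nonneg) (use fin size_nonneg in auto)
  define ES where "ES = (LINT m|mark_law. fst m)"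
  have ES0: "0 \<le> ES" unfolding ES_def by (rule integral_nonneg_AE) (rule size_nonneg)
  have ES: "(\<integral>\<^sup>+ m. ennreal (fst m) \<partial>mark_law) = ennreal ES"
    unfolding ES_def by (rule nn_integral_eq_integral[OF int size_nonneg])
  have "ennreal \<rho> = ennreal (lam * ES)" using load_eq rho lam ES ES0 by (simp add: ennreal_mult')
  then have rho_ES: "\<rho> = lam * ES" using rho lam ES0 by simp
  define U where "U n = (1 - laplace_size (tiny n)) / tiny n" for n
  define Q where "Q n = (laplace_size (tiny n) - 1 + tiny n * ES) / (tiny n)\<^sup>2" for n
  \<comment> \<open>The bracket of \<open>laplace_balance\<close> divided by
    \<open>\<theta> = tiny n\<close>, so that the balance reads
    \<open>laplace_work (tiny n) * D n = idle_prob\<close>.\<close>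
  define D where "D n = 1 - lam * U n" for n
  have "(\<lambda>n. ennreal (U n)) \<longlonglongrightarrow> ennreal ES"
    using mark.laplace_first_moment[OF _ size_nonneg] by (simp only: U_def laplace_size_def ES) simp
  moreover have U0: "0 \<le> U n" for n
  proof -
    have "laplace_size (tiny n) \<le> (LINT m|mark_law. 1)"
      unfolding laplace_size_def
    proof (rule integral_mono_AE)
      show "integrable mark_law (\<lambda>m. exp (- tiny n * fst m))" by (rule integrable_laplace_size) simp
      show "AE m in mark_law. exp (- tiny n * fst m) \<le> 1" using size_nonneg by eventually_elim simp
    qed simp
    then show ?thesis using mark.prob_space by (simp add: U_def)
  qed
  ultimately have U: "U \<longlonglongrightarrow> ES" using ES0 by (simp add: tendsto_ennreal_iff)
  have D: "D \<longlonglongrightarrow> 1 - \<rho>" unfolding D_def rho_ES by (intro tendsto_intros U)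
  have bal: "laplace_work (tiny n) * D n = idle_prob" for n
  proof -
    have "laplace_work (tiny n) * (tiny n - lam * (1 - laplace_size (tiny n))) = tiny n * idle_prob"
      by (rule laplace_balance) simp
    moreover have "tiny n - lam * (1 - laplace_size (tiny n)) = tiny n * D n"
      by (simp add: D_def U_def right_diff_distrib)
    ultimately have "tiny n * (laplace_work (tiny n) * D n) = tiny n * idle_prob" by (simp only: mult_ac)
    then show ?thesis by simp
  qed
  have "(\<lambda>n. laplace_work (tiny n) * D n) \<longlonglongrightarrow> 1 * (1 - \<rho>)"
    by (intro tendsto_mult laplace_work_tendsto_1 D)
  then have idle: "idle_prob = 1 - \<rho>" unfolding bal by (simp add: LIMSEQ_const_iff)
  have Q0: "0 \<le> Q n" for n
  proof -
    have "U n \<le> ES"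
    proof -
      have "(LINT m|mark_law. 1 - tiny n * fst m) \<le> laplace_size (tiny n)"
        unfolding laplace_size_def
      proof (rule integral_mono)
        show "integrable mark_law (\<lambda>m. 1 - tiny n * fst m)" using int by simp
        show "integrable mark_law (\<lambda>m. exp (- tiny n * fst m))" by (rule integrable_laplace_size) simp
        show "1 - tiny n * fst m \<le> exp (- tiny n * fst m)" for m :: "real \<times> bool"
          using exp_ge_add_one_self[of "- tiny n * fst m"] by simp
      qed
      moreover have "(LINT m|mark_law. 1 - tiny n * fst m) = 1 - tiny n * ES"
        unfolding ES_def using int
        by (subst Bochner_Integration.integral_diff) (simp_all add: mark.prob_space[simplified])
      ultimately have "1 - laplace_size (tiny n) \<le> ES * tiny n" by (simp add: mult.commute)
      then show ?thesis unfolding U_def by (subst pos_divide_le_eq) simp_all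
    qed
    then have "1 - laplace_size (tiny n) \<le> ES * tiny n"
      unfolding U_def by (subst (asm) pos_divide_le_eq) simp_all
    then show ?thesis unfolding Q_def by (intro divide_nonneg_nonneg) (simp_all add: mult.commute)
  qed
  \<comment> \<open>Its product with a nonnegative transform is \<open>1 - \<rho> > 0\<close>, so
    \<open>D n\<close> may be divided by for every \<open>n\<close>, not only for large
    ones.\<close>
  have Dpos: "0 < D n" for n
  proof -
    have "0 \<le> laplace_work (tiny n)" by (rule laplace_nonneg)
    moreover have "0 < laplace_work (tiny n) * D n" unfolding bal idle using rho by simp
    ultimately show ?thesis by (simp add: zero_less_mult_iff)
  qed
  have quot: "(1 - laplace_work (tiny n)) / tiny n = lam / D n * Q n" for n
  proof -
    have "laplace_work (tiny n) = (1 - \<rho>) / D n"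
      using bal[of n] Dpos[of n] idle by (simp add: field_simps)
    then have "1 - laplace_work (tiny n) = (D n - (1 - \<rho>)) / D n"
      using Dpos[of n] by (simp add: diff_divide_distrib)
    also have "D n - (1 - \<rho>) = lam * (ES - U n)" by (simp add: D_def rho_ES algebra_simps)
    also have "ES - U n = tiny n * Q n"
    proof -
      have *: "E - (1 - F) / t = t * ((F - 1 + t * E) / t\<^sup>2)" if "t \<noteq> 0" for E F t :: real
        using that by (simp add: field_simps power2_eq_square)
      show ?thesis unfolding Q_def U_def by (rule *) simp
    qed
    finally show ?thesis by simp
  qed
  have "(\<lambda>n. ennreal (Q n)) \<longlonglongrightarrow> ennreal (1 / 2) * second_moment f"
    using mark.laplace_second_moment[OF int size_nonneg]
    unfolding Q_def laplace_size_def ES_def second_moment_eq .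
  moreover have "(\<lambda>n. ennreal (lam / D n)) \<longlonglongrightarrow> ennreal (lam / (1 - \<rho>))"
    using rho by (intro tendsto_ennrealI tendsto_divide tendsto_const D) simp
  \<comment> \<open>A limit of products in \<open>ennreal\<close> must not be of the form
    \<open>0 * top\<close>; the first factor has a positive finite limit, so the second moment may
    be \<open>top\<close>.\<close>
  moreover have "0 < lam / (1 - \<rho>)" using lam rho by simp
  ultimately have "(\<lambda>n. ennreal (lam / D n) * ennreal (Q n)) \<longlonglongrightarrow> ennreal (lam / (1 - \<rho>)) * (ennreal (1 / 2) * second_moment f)"
    by (intro tendsto_mult_ennreal) (auto simp: ennreal_eq_0_iff)
  moreover have "ennreal (lam / D n) * ennreal (Q n) = ennreal ((1 - laplace_work (tiny n)) / tiny n)" for n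
    unfolding quot using lam Dpos[of n] Q0[of n] by (intro ennreal_mult[symmetric]) simp_all
  moreover have "(\<lambda>n. ennreal ((1 - laplace_work (tiny n)) / tiny n)) \<longlonglongrightarrow> (\<integral>\<^sup>+ q. ennreal (workload q) \<partial>\<pi>)"
    unfolding laplace_work_def by (rule pi.laplace_first_moment) (simp_all add: AE_workload_nonneg)
  ultimately show ?thesis by (simp only: LIMSEQ_unique)
qed

text \<open>On valid states and arrivals, hence almost surely, the response time equals
  \<open>?H\<close>, which is jointly measurable. The arrivals can then be integrated out for a
  fixed state, where the work ahead is the number \<open>workload q + x\<close>.\<close>

lemma mean_response_long_eq:
  assumes load: "load_new_ext lam f p < 1" and x: "0 < x"
  shows "mean_response_long lam f p age \<pi> x
    = ((\<integral>\<^sup>+ q. ennreal (workload q) \<partial>\<pi>) + ennreal x) / (1 - load_new_ext lam f p)"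
proof -
  let ?H = "\<lambda>z. SUP K. ennreal (elapsed K (snd z) (workload (fst z) + x))"
  have meas [measurable]: "?H \<in> borel_measurable (\<pi> \<Otimes>\<^sub>M arrivals)" by measurable
  have "mean_response_long lam f p age \<pi> x = (\<integral>\<^sup>+ z. ?H z \<partial>(\<pi> \<Otimes>\<^sub>M arrivals))"
    unfolding mean_response_long_def arrival_law_eq
  proof (rule nn_integral_cong_AE, use AE_joint_valid in eventually_elim)
    case (elim z)
    obtain q w where z: "z = (q, w)" by (cases z)
    with elim have q: "valid_state q" and w: "valid_arrivals w" by auto
    have "0 \<le> workload q + x" using workload_nonneg[OF q] x by simp
    then show ?case
      using response_time_long_eq_hit[OF policy q w x] hit_eq_SUP_elapsed[OF w] z by simp
  qed
  also have "\<dots> = (\<integral>\<^sup>+ q. \<integral>\<^sup>+ w. ?H (q, w) \<partial>arrivals \<partial>\<pi>)"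
    by (rule arr.P.nn_integral_fst[OF meas, symmetric])
  also have "\<dots> = (\<integral>\<^sup>+ q. (ennreal (workload q) + ennreal x) / (1 - load_new_ext lam f p) \<partial>\<pi>)"
  proof (rule nn_integral_cong_AE, use AE_workload_nonneg in eventually_elim)
    case (elim q)
    have v: "0 \<le> workload q + x" using elim x by simp
    have "(\<integral>\<^sup>+ w. ?H (q, w) \<partial>arrivals) = (\<integral>\<^sup>+ w. hit (workload q + x) w \<partial>arrivals)"
      by (rule nn_integral_cong_AE, use AE_valid_arrivals in eventually_elim)
         (simp add: hit_eq_SUP_elapsed[OF _ v])
    also have "\<dots> = ennreal (workload q + x) / (1 - load_new_ext lam f p)"
      by (rule nn_integral_hit[OF load v])
    finally show ?case using elim x by simp
  qed
  also have "\<dots> = (\<integral>\<^sup>+ q. ennreal (workload q) + ennreal x \<partial>\<pi>) / (1 - load_new_ext lam f p)"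
    by (rule nn_integral_divide) measurable
  also have "(\<integral>\<^sup>+ q. ennreal (workload q) + ennreal x \<partial>\<pi>) = (\<integral>\<^sup>+ q. ennreal (workload q) \<partial>\<pi>) + ennreal x"
    using pi.emeasure_space_1 by (subst nn_integral_add) simp_all
  finally show ?thesis .
qed

end

text \<open>The mean workload is inserted into \<open>mean_response_long_eq\<close>. Both loads are
  reals below 1, so the divisions become multiplications by finite reals, and the rearrangement in
  \<open>ennreal\<close> remains valid with an infinite second moment. The integral has a constant
  integrand and accounts for the size of the job itself.\<close>

theorem lemma9:
  fixes lam xJ :: real and f pT :: "real \<Rightarrow> real"
    and age :: "state \<Rightarrow> (nat \<Rightarrow> arrival) \<Rightarrow> nat \<Rightarrow> real \<Rightarrow> real"
    and \<pi> :: "state measure"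
  assumes "lam > 0"
    and "f \<in> borel_measurable borel"
    and "\<And>x. f x \<ge> 0"
    and "\<And>x. x \<le> 0 \<Longrightarrow> f x = 0"
    and "(\<integral>\<^sup>+ x. ennreal (f x) \<partial>lborel) = 1"
    and "pT \<in> borel_measurable borel"
    and "\<And>x. x > 0 \<Longrightarrow> 0 \<le> pT x \<and> pT x \<le> 1"
    and "load lam f < 1"
    and "xJ > 0"
    and "onebit_policy age"
    and "stationary lam f pT age \<pi>"
  shows "mean_response_long lam f pT age \<pi> xJ =
      ennreal lam / (2 * (1 - load lam f) * (1 - load_new_ext lam f pT)) * second_moment f
      + (\<integral>\<^sup>+ a\<in>{0..xJ}. 1 / (1 - load_new_ext lam f pT) \<partial>lborel)"
proof -
  interpret onebit_stationary lam f pT age \<pi>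
    by unfold_locales (use assms in auto)
  have "load_new_ext lam f pT < 1" using load_new_le_load assms(8) by (rule le_less_trans)
  then obtain r where r: "load_new_ext lam f pT = ennreal r" "0 \<le> r" "r < 1"
    by (cases "load_new_ext lam f pT") (auto simp: ennreal_less_one_iff)
  obtain \<rho> where rho: "load lam f = ennreal \<rho>" "0 \<le> \<rho>" "\<rho> < 1"
    using assms(8) by (cases "load lam f") (auto simp: ennreal_less_one_iff)
  have one_minus: "1 - ennreal c = ennreal (1 - c)" if "0 \<le> c" for c
    using ennreal_minus[OF that, of 1] by simp
  have div: "a / ennreal (1 - r) = a * ennreal (1 / (1 - r))" for a
    using r by (simp add: divide_ennreal_def inverse_ennreal inverse_eq_divide)
  have two: "(2 :: ennreal) = ennreal 2" by simp
  have coef: "ennreal lam / (2 * (1 - load lam f) * (1 - load_new_ext lam f pT))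
      = ennreal (lam / (1 - \<rho>)) * ennreal (1 / 2) * ennreal (1 / (1 - r))"
  proof -
    have "2 * (1 - load lam f) * (1 - load_new_ext lam f pT) = ennreal (2 * (1 - \<rho>) * (1 - r))"
      unfolding rho(1) r(1) one_minus[OF rho(2)] one_minus[OF r(2)] two
      using rho r by (simp only: ennreal_mult[symmetric] zero_le_mult_iff) (simp add: ennreal_mult)
    moreover have "ennreal (lam / (1 - \<rho>)) * ennreal (1 / 2) * ennreal (1 / (1 - r))
        = ennreal (lam / (2 * (1 - \<rho>) * (1 - r)))"
    proof -
      have *: "ennreal a * ennreal b * ennreal c = ennreal (a * b * c)"
        if "0 \<le> a" "0 \<le> b" "0 \<le> c" for a b c
        using that by (simp add: ennreal_mult)
      have "ennreal (lam / (1 - \<rho>)) * ennreal (1 / 2) * ennreal (1 / (1 - r))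
          = ennreal (lam / (1 - \<rho>) * (1 / 2) * (1 / (1 - r)))"
        by (rule *) (use assms(1) rho r in auto)
      also have "lam / (1 - \<rho>) * (1 / 2) * (1 / (1 - r)) = lam / (2 * (1 - \<rho>) * (1 - r))" by simp
      finally show ?thesis .
    qed
    ultimately show ?thesis using assms(1) rho r by (simp add: divide_ennreal)
  qed
  have "(\<integral>\<^sup>+ a\<in>{0..xJ}. 1 / (1 - load_new_ext lam f pT) \<partial>lborel) = ennreal (1 / (1 - r)) * ennreal xJ"
    using assms(9) unfolding r(1) one_minus[OF r(2)] div by (simp add: nn_integral_cmult_indicator)
  moreover have "mean_response_long lam f pT age \<pi> xJ
      = (ennreal (lam / (1 - \<rho>)) * (ennreal (1 / 2) * second_moment f) + ennreal xJ) * ennreal (1 / (1 - r))"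
    using mean_response_long_eq[OF _ assms(9)] r mean_workload[OF rho]
    by (simp only: one_minus[OF r(2)] div) (simp add: ennreal_less_one_iff div)
  ultimately show ?thesis
    unfolding coef by (simp only: distrib_left distrib_right mult_ac)
qed

end
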